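(* Let $\Lambda$ be a basic and connected Nakayama algebra over an algebraically closed field $k$. Let $M$ be a nonzero finitely generated $\Lambda$-module whose pairwise non-isomorphic indecomposable direct summands are $M_1,\dots,M_r$. Then $\mathrm{End}_\Lambda(M)$ is symmetric if and only if for every $i\neq j$ the pair $(M_i,M_j)$ satisfies one of: (a) with $l=\min\{\ell\ell(M_i),\ell\ell(M_j)\}$, $\mathrm{Top}(M_j)$ has multiplicity zero in $\mathrm{Soc}^l(M_i)$ and $\mathrm{Top}(M_i)$ has multiplicity zero in $\mathrm{Soc}^l(M_j)$; (b) for some $m\ge1$, $\mathrm{Top}(M_i)$ has multiplicity $m+1$ in $M_i$ and $m$ in $M_j$, and $\mathrm{Top}(M_j)$ has multiplicity $m+1$ in $M_j$ and $m$ in $M_i$. In particular, if $\mathrm{End}_\Lambda(M)$ is symmetric then $\mathrm{Top}(M_i)\not\simeq\mathrm{Top}(M_j)$ for $i\neq j$.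
   Context: All algebras are finite-dimensional. $\Lambda$ is Nakayama if its left and right regular modules are direct sums of uniserial modules. $\mathrm{Top}(N)=N/J(N)$; $\mathrm{Soc}^l(N)$ is the $l$-th term of the socle series; $\ell\ell(N)$ is the Loewy length; the multiplicity of a simple $S$ in $N$ is the number of composition factors of $N$ isomorphic to $S$. Symmetric: the algebra is isomorphic to its $k$-dual as a bimodule. *)

theory Defs
  imports "HOL-Computational_Algebra.Polynomial"
begin

definition alg_closed :: "'k::field itself \<Rightarrow> bool" where
  "alg_closed _ \<longleftrightarrow> (\<forall>p::'k poly. degree p > 0 \<longrightarrow> (\<exists>x. poly p x = 0))"

definition kalg :: "('k::field \<Rightarrow> 'a::ring_1 \<Rightarrow> 'a) \<Rightarrow> bool" where
  "kalg sa \<longleftrightarrow>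
     (\<forall>c x y. sa c (x + y) = sa c x + sa c y) \<and>
     (\<forall>c d x. sa (c + d) x = sa c x + sa d x) \<and>
     (\<forall>c d x. sa (c * d) x = sa c (sa d x)) \<and>
     (\<forall>x. sa 1 x = x) \<and>
     (\<forall>c x y. sa c (x * y) = sa c x * y \<and> sa c (x * y) = x * sa c y)"

definition findim :: "('k::field \<Rightarrow> 'a::ab_group_add \<Rightarrow> 'a) \<Rightarrow> bool" where
  "findim sa \<longleftrightarrow> (\<exists>B. finite B \<and> (\<forall>x. \<exists>c. x = (\<Sum>b\<in>B. sa (c b) b)))"

definition is_module ::
  "('k::field \<Rightarrow> 'a::ring_1 \<Rightarrow> 'a) \<Rightarrow> ('k \<Rightarrow> 'm::ab_group_add \<Rightarrow> 'm) \<Rightarrow> ('a \<Rightarrow> 'm \<Rightarrow> 'm) \<Rightarrow> 'm set \<Rightarrow> bool" where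
  "is_module sa sm act M \<longleftrightarrow>
     0 \<in> M \<and> (\<forall>x\<in>M. \<forall>y\<in>M. x + y \<in> M) \<and> (\<forall>c. \<forall>x\<in>M. sm c x \<in> M) \<and> (\<forall>a. \<forall>x\<in>M. act a x \<in> M) \<and>
     (\<forall>c. \<forall>x\<in>M. \<forall>y\<in>M. sm c (x + y) = sm c x + sm c y) \<and>
     (\<forall>c d. \<forall>x\<in>M. sm (c + d) x = sm c x + sm d x) \<and>
     (\<forall>c d. \<forall>x\<in>M. sm (c * d) x = sm c (sm d x)) \<and>
     (\<forall>x\<in>M. sm 1 x = x) \<and>
     (\<forall>a. \<forall>x\<in>M. \<forall>y\<in>M. act a (x + y) = act a x + act a y) \<and>
     (\<forall>a b. \<forall>x\<in>M. act (a + b) x = act a x + act b x) \<and>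
     (\<forall>a b. \<forall>x\<in>M. act (a * b) x = act a (act b x)) \<and>
     (\<forall>x\<in>M. act 1 x = x) \<and>
     (\<forall>c a. \<forall>x\<in>M. act (sa c a) x = sm c (act a x) \<and> act a (sm c x) = sm c (act a x))"

text \<open>Submodules: subsets closed under the operations (for a right action
  act a x = x * a this gives right submodules / right ideals).\<close>
definition submod :: "('k \<Rightarrow> 'm::ab_group_add \<Rightarrow> 'm) \<Rightarrow> ('a \<Rightarrow> 'm \<Rightarrow> 'm) \<Rightarrow> 'm set \<Rightarrow> bool" where
  "submod sm act N \<longleftrightarrow> 0 \<in> N \<and> (\<forall>x\<in>N. \<forall>y\<in>N. x + y \<in> N \<and> x - y \<in> N) \<and>
     (\<forall>c. \<forall>x\<in>N. sm c x \<in> N) \<and> (\<forall>a. \<forall>x\<in>N. act a x \<in> N)"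

definition gen :: "('k \<Rightarrow> 'm::ab_group_add \<Rightarrow> 'm) \<Rightarrow> ('a \<Rightarrow> 'm \<Rightarrow> 'm) \<Rightarrow> 'm set \<Rightarrow> 'm set" where
  "gen sm act S = \<Inter>{N. submod sm act N \<and> S \<subseteq> N}"

definition fin_gen :: "('k \<Rightarrow> 'm::ab_group_add \<Rightarrow> 'm) \<Rightarrow> ('a \<Rightarrow> 'm \<Rightarrow> 'm) \<Rightarrow> 'm set \<Rightarrow> bool" where
  "fin_gen sm act M \<longleftrightarrow> (\<exists>S. finite S \<and> S \<subseteq> M \<and> gen sm act S = M)"

definition int_dsum :: "('k \<Rightarrow> 'm::ab_group_add \<Rightarrow> 'm) \<Rightarrow> ('a \<Rightarrow> 'm \<Rightarrow> 'm) \<Rightarrow> 'm set list \<Rightarrow> 'm set \<Rightarrow> bool" where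
  "int_dsum sm act Ns N \<longleftrightarrow> (\<forall>P\<in>set Ns. submod sm act P \<and> P \<subseteq> N) \<and>
     (\<forall>x\<in>N. \<exists>!xs. length xs = length Ns \<and> (\<forall>i<length Ns. xs ! i \<in> Ns ! i) \<and> sum_list xs = x)"

definition dsum2 :: "('k \<Rightarrow> 'm::ab_group_add \<Rightarrow> 'm) \<Rightarrow> ('a \<Rightarrow> 'm \<Rightarrow> 'm) \<Rightarrow> 'm set \<Rightarrow> 'm set \<Rightarrow> 'm set \<Rightarrow> bool" where
  "dsum2 sm act U V N \<longleftrightarrow> submod sm act U \<and> submod sm act V \<and> U \<inter> V = {0} \<and>
     {u + v | u v. u \<in> U \<and> v \<in> V} = N"

definition indecomp :: "('k \<Rightarrow> 'm::ab_group_add \<Rightarrow> 'm) \<Rightarrow> ('a \<Rightarrow> 'm \<Rightarrow> 'm) \<Rightarrow> 'm set \<Rightarrow> bool" where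
  "indecomp sm act N \<longleftrightarrow> N \<noteq> {0} \<and> (\<forall>U V. dsum2 sm act U V N \<longrightarrow> U = {0} \<or> V = {0})"

definition uniserial :: "('k \<Rightarrow> 'm::ab_group_add \<Rightarrow> 'm) \<Rightarrow> ('a \<Rightarrow> 'm \<Rightarrow> 'm) \<Rightarrow> 'm set \<Rightarrow> bool" where
  "uniserial sm act N \<longleftrightarrow> (\<forall>U V. submod sm act U \<and> U \<subseteq> N \<and> submod sm act V \<and> V \<subseteq> N
        \<longrightarrow> U \<subseteq> V \<or> V \<subseteq> U)"

definition mod_iso ::
  "('k \<Rightarrow> 'm::ab_group_add \<Rightarrow> 'm) \<Rightarrow> ('a \<Rightarrow> 'm \<Rightarrow> 'm) \<Rightarrow> 'm set \<Rightarrow>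
   ('k \<Rightarrow> 'n::ab_group_add \<Rightarrow> 'n) \<Rightarrow> ('a \<Rightarrow> 'n \<Rightarrow> 'n) \<Rightarrow> 'n set \<Rightarrow> bool" where
  "mod_iso sm act U sm' act' U' \<longleftrightarrow> (\<exists>f. bij_betw f U U' \<and>
     (\<forall>x\<in>U. \<forall>y\<in>U. f (x + y) = f x + f y) \<and> (\<forall>c. \<forall>x\<in>U. f (sm c x) = sm' c (f x)) \<and>
     (\<forall>a. \<forall>x\<in>U. f (act a x) = act' a (f x)))"

text \<open>Subquotients U/V (V a submodule of U), simplicity and isomorphism of subquotients.
  An isomorphism U/V \<cong> U'/V' is encoded by its graph
  {(u,u'). phi(u+V) = u'+V'}.\<close>
definition simple_sq :: "('k \<Rightarrow> 'm::ab_group_add \<Rightarrow> 'm) \<Rightarrow> ('a \<Rightarrow> 'm \<Rightarrow> 'm) \<Rightarrow> 'm set \<Rightarrow> 'm set \<Rightarrow> bool" where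
  "simple_sq sm act U V \<longleftrightarrow> submod sm act U \<and> submod sm act V \<and> V \<subset> U \<and>
     \<not> (\<exists>W. submod sm act W \<and> V \<subset> W \<and> W \<subset> U)"

definition sq_iso :: "('k \<Rightarrow> 'm::ab_group_add \<Rightarrow> 'm) \<Rightarrow> ('a \<Rightarrow> 'm \<Rightarrow> 'm) \<Rightarrow> 'm set \<times> 'm set \<Rightarrow> 'm set \<times> 'm set \<Rightarrow> bool" where
  "sq_iso sm act S T \<longleftrightarrow> (case S of (U, V) \<Rightarrow> case T of (U', V') \<Rightarrow>
     V \<subseteq> U \<and> V' \<subseteq> U' \<and>
     (\<exists>G. G \<subseteq> U \<times> U' \<and> (0, 0) \<in> G \<and>
        (\<forall>p\<in>G. \<forall>q\<in>G. (fst p + fst q, snd p + snd q) \<in> G \<and> (fst p - fst q, snd p - snd q) \<in> G) \<and>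
        (\<forall>c. \<forall>p\<in>G. (sm c (fst p), sm c (snd p)) \<in> G) \<and>
        (\<forall>a. \<forall>p\<in>G. (act a (fst p), act a (snd p)) \<in> G) \<and>
        fst ` G = U \<and> snd ` G = U' \<and>
        (\<forall>p\<in>G. fst p \<in> V \<longleftrightarrow> snd p \<in> V')))"

definition nakayama :: "('k::field \<Rightarrow> 'a::ring_1 \<Rightarrow> 'a) \<Rightarrow> bool" where
  "nakayama sa \<longleftrightarrow>
     (\<exists>Ps. int_dsum sa (\<lambda>a x. a * x) Ps UNIV \<and> (\<forall>P\<in>set Ps. uniserial sa (\<lambda>a x. a * x) P)) \<and>
     (\<exists>Qs. int_dsum sa (\<lambda>a x. x * a) Qs UNIV \<and> (\<forall>Q\<in>set Qs. uniserial sa (\<lambda>a x. x * a) Q))"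

definition basic_alg :: "('k::field \<Rightarrow> 'a::ring_1 \<Rightarrow> 'a) \<Rightarrow> bool" where
  "basic_alg sa \<longleftrightarrow> (\<exists>Ps. int_dsum sa (\<lambda>a x. a * x) Ps UNIV \<and>
     (\<forall>P\<in>set Ps. indecomp sa (\<lambda>a x. a * x) P) \<and>
     (\<forall>i<length Ps. \<forall>j<length Ps. i \<noteq> j \<longrightarrow>
         \<not> mod_iso sa (\<lambda>a x. a * x) (Ps ! i) sa (\<lambda>a x. a * x) (Ps ! j)))"

definition connected_alg :: "'a::ring_1 itself \<Rightarrow> bool" where
  "connected_alg _ \<longleftrightarrow> (0::'a) \<noteq> 1 \<and>
     (\<forall>e::'a. e * e = e \<and> (\<forall>x. e * x = x * e) \<longrightarrow> e = 0 \<or> e = 1)"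

definition jac :: "('k::field \<Rightarrow> 'a::ring_1 \<Rightarrow> 'a) \<Rightarrow> 'a set" where
  "jac sa = \<Inter>{L. submod sa (\<lambda>a x. a * x) L \<and> L \<noteq> UNIV \<and>
        \<not> (\<exists>L'. submod sa (\<lambda>a x. a * x) L' \<and> L \<subset> L' \<and> L' \<noteq> UNIV)}"

definition rad_mod :: "('k::field \<Rightarrow> 'a::ring_1 \<Rightarrow> 'a) \<Rightarrow> ('k \<Rightarrow> 'm::ab_group_add \<Rightarrow> 'm) \<Rightarrow> ('a \<Rightarrow> 'm \<Rightarrow> 'm) \<Rightarrow> 'm set \<Rightarrow> 'm set" where
  "rad_mod sa sm act N = gen sm act {act a x | a x. a \<in> jac sa \<and> x \<in> N}"

text \<open>Top(N) = N / J(N), as a subquotient.\<close>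
definition top_mod :: "('k::field \<Rightarrow> 'a::ring_1 \<Rightarrow> 'a) \<Rightarrow> ('k \<Rightarrow> 'm::ab_group_add \<Rightarrow> 'm) \<Rightarrow> ('a \<Rightarrow> 'm \<Rightarrow> 'm) \<Rightarrow> 'm set \<Rightarrow> 'm set \<times> 'm set" where
  "top_mod sa sm act N = (N, rad_mod sa sm act N)"

text \<open>Socle series: Soc^0 = 0, Soc^(l+1)/Soc^l = Soc(N/Soc^l).\<close>
fun soc_ser :: "('k \<Rightarrow> 'm::ab_group_add \<Rightarrow> 'm) \<Rightarrow> ('a \<Rightarrow> 'm \<Rightarrow> 'm) \<Rightarrow> 'm set \<Rightarrow> nat \<Rightarrow> 'm set" where
  "soc_ser sm act N 0 = {0}"
| "soc_ser sm act N (Suc l) =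
     gen sm act (soc_ser sm act N l \<union>
        \<Union>{U. U \<subseteq> N \<and> simple_sq sm act U (soc_ser sm act N l)})"

definition loewy_length :: "('k \<Rightarrow> 'm::ab_group_add \<Rightarrow> 'm) \<Rightarrow> ('a \<Rightarrow> 'm \<Rightarrow> 'm) \<Rightarrow> 'm set \<Rightarrow> nat" where
  "loewy_length sm act N = (LEAST l. soc_ser sm act N l = N)"

definition comp_series :: "('k \<Rightarrow> 'm::ab_group_add \<Rightarrow> 'm) \<Rightarrow> ('a \<Rightarrow> 'm \<Rightarrow> 'm) \<Rightarrow> 'm set \<Rightarrow> 'm set list \<Rightarrow> bool" where
  "comp_series sm act N cs \<longleftrightarrow> cs \<noteq> [] \<and> cs ! 0 = {0} \<and> last cs = N \<and>
     (\<forall>i. Suc i < length cs \<longrightarrow> simple_sq sm act (cs ! Suc i) (cs ! i))"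

text \<open>Multiplicity of the simple subquotient S in N: number of composition factors of N
  isomorphic to S (well defined by Jordan-Hoelder).\<close>
definition mult :: "('k \<Rightarrow> 'm::ab_group_add \<Rightarrow> 'm) \<Rightarrow> ('a \<Rightarrow> 'm \<Rightarrow> 'm) \<Rightarrow> 'm set \<times> 'm set \<Rightarrow> 'm set \<Rightarrow> nat" where
  "mult sm act S N = (let cs = (SOME cs. comp_series sm act N cs) in
     card {i. Suc i < length cs \<and> sq_iso sm act (cs ! Suc i, cs ! i) S})"

definition End_set :: "('k \<Rightarrow> 'm::ab_group_add \<Rightarrow> 'm) \<Rightarrow> ('a \<Rightarrow> 'm \<Rightarrow> 'm) \<Rightarrow> 'm set \<Rightarrow> ('m \<Rightarrow> 'm) set" where
  "End_set sm act M = {f. (\<forall>x\<in>M. f x \<in> M) \<and> (\<forall>x. x \<notin> M \<longrightarrow> f x = 0) \<and>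
      (\<forall>x\<in>M. \<forall>y\<in>M. f (x + y) = f x + f y) \<and> (\<forall>c. \<forall>x\<in>M. f (sm c x) = sm c (f x)) \<and>
      (\<forall>a. \<forall>x\<in>M. f (act a x) = act a (f x))}"

definition dual_set :: "('k::field \<Rightarrow> 'm::ab_group_add \<Rightarrow> 'm) \<Rightarrow> ('m \<Rightarrow> 'm) set \<Rightarrow> (('m \<Rightarrow> 'm) \<Rightarrow> 'k) set" where
  "dual_set sm E = {\<phi>. (\<forall>f. f \<notin> E \<longrightarrow> \<phi> f = 0) \<and>
      (\<forall>f\<in>E. \<forall>g\<in>E. \<phi> (\<lambda>x. f x + g x) = \<phi> f + \<phi> g) \<and>
      (\<forall>c. \<forall>f\<in>E. \<phi> (\<lambda>x. sm c (f x)) = c * \<phi> f)}"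

text \<open>End(M) is symmetric: isomorphic to its k-dual as an End(M)-bimodule,
  where (a.phi.b)(y) = phi(b y a).\<close>
definition end_symmetric :: "('k::field \<Rightarrow> 'm::ab_group_add \<Rightarrow> 'm) \<Rightarrow> ('a \<Rightarrow> 'm \<Rightarrow> 'm) \<Rightarrow> 'm set \<Rightarrow> bool" where
  "end_symmetric sm act M \<longleftrightarrow> (let E = End_set sm act M in
     \<exists>\<Phi>. bij_betw \<Phi> E (dual_set sm E) \<and>
       (\<forall>f\<in>E. \<forall>g\<in>E. \<Phi> (\<lambda>x. f x + g x) = (\<lambda>y. \<Phi> f y + \<Phi> g y)) \<and>
       (\<forall>c. \<forall>f\<in>E. \<Phi> (\<lambda>x. sm c (f x)) = (\<lambda>y. c * \<Phi> f y)) \<and>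
       (\<forall>a\<in>E. \<forall>f\<in>E. \<forall>b\<in>E.
          \<Phi> (a \<circ> f \<circ> b) = (\<lambda>y. if y \<in> E then \<Phi> f (b \<circ> y \<circ> a) else 0)))"

definition ind_summand :: "('k \<Rightarrow> 'm::ab_group_add \<Rightarrow> 'm) \<Rightarrow> ('a \<Rightarrow> 'm \<Rightarrow> 'm) \<Rightarrow> 'm set \<Rightarrow> 'm set \<Rightarrow> bool" where
  "ind_summand sm act M X \<longleftrightarrow> indecomp sm act X \<and> (\<exists>Y. dsum2 sm act X Y M)"

end

theory Submission
  imports Defs
begin

text \<open>
  Over an algebraically closed field a basic Nakayama algebra has a complete set of orthogonal
  primitive idempotents \<open>e i\<close> and a nilpotent element \<open>\<pi>\<close> generating its radical with
  \<open>\<pi> * e i = e (\<sigma> i) * \<pi>\<close> for a permutation \<open>\<sigma>\<close>, and it is spanned by the elements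
  \<open>\<pi> ^ t * e i\<close>. Hence a module is a graded vector space with a nilpotent operator of degree
  \<open>\<sigma>\<close>, and a finitely generated one is a direct sum of chains \<open>x, \<pi> x, \<dots>, \<pi> ^ (a - 1) x\<close>
  with \<open>x\<close> homogeneous of some degree \<open>h\<close>. Homomorphisms between two chains have a basis of shifts
  \<open>x \<mapsto> \<pi> ^ s y\<close>. Conditions (a) and (b) say that no shifts exist in either direction,
  respectively that the shifts in both directions are exchanged by \<open>s \<mapsto> m p - s\<close>, where \<open>p\<close> is
  the common period of the two degrees under \<open>\<sigma>\<close> and \<open>m p\<close> is the largest shift of either chain
  into itself. If \<open>End(M)\<close> is symmetric, pairing the largest shift between two chains under the
  symmetrizing form forces this; conversely the form that adds up the coefficients of the largest
  shifts of the chains into themselves is symmetrizing.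
\<close>

section \<open>Corners at primitive idempotents\<close>

text \<open>All that is known about a symmetrizing form is its trace property and its nondegeneracy.
  It is used for one conclusion only: a shift by \<open>s\<close> between two chains has a partner
  \<open>t\<close> in the opposite direction such that both composites, one on each chain, are
  nonzero, so that \<open>s + t\<close> is below both lengths. Applied to the largest shift in each
  direction, this confines both lengths to one period, and the outcomes besides the absence of
  shifts are (b) and isomorphic chains. In the converse direction \<open>M\<close> may contain a
  chain several times. Instead of passing to a basic module, the dual basis is written down for all
  pairs of chains at once; pairs of isomorphic chains are a second case in which shifts can be
  reversed. An arrow of the quiver may be zero, as at the end of a linear quiver, and its vertex
  then has no natural successor. Completing the successor map to a permutation
  \<open>\<sigma>\<close> lets degrees be cancelled and counted by residues in every case. Algebraic
  closedness enters through the corners: a root of an annihilating polynomial makes every element of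
  \<open>e \<Lambda> e\<close> a scalar multiple of \<open>e\<close> plus a nilpotent
  element.\<close>

lemma bezout_linear_power:
  fixes q :: "'k::field poly"
  assumes "poly q c \<noteq> 0"
  shows "\<exists>u v. [:- c, 1:] ^ m * u + q * v = 1"
proof -
  let ?l = "[:- c, 1:]"
  have "?l dvd q - [:poly q c:]"
    by (simp add: poly_eq_0_iff_dvd[symmetric])
  then obtain r where r: "q - [:poly q c:] = ?l * r" by blast
  define v where "v = [:inverse (poly q c):]"
  have "q * v - ?l * (r * v) = (q - ?l * r) * v"
    by (simp only: left_diff_distrib mult.assoc)
  also have "\<dots> = [:poly q c:] * v"
    by (simp only: r[symmetric]) simp
  also have "\<dots> = 1"
    using assms by (simp add: v_def one_pCons)
  finally have 1: "q * v - ?l * (r * v) = 1" .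
  define u where "u = - (r * v)"
  have lu: "?l * u + q * v = 1"
    using 1 unfolding u_def by (simp only: mult_minus_right diff_conv_add_uminus add.commute)
  show ?thesis
  proof (induction m)
    case 0
    show ?case by (rule exI[of _ 1], rule exI[of _ 0]) simp
  next
    case (Suc m)
    then obtain u' v' where *: "?l ^ m * u' + q * v' = 1" by blast
    have "1 = (?l ^ m * u') * (?l * u + q * v) + q * v'" using * lu by simp
    also have "\<dots> = ?l ^ Suc m * (u' * u) + q * (?l ^ m * u' * v + v')"
      by (simp add: algebra_simps del: mult_pCons_left mult_pCons_right)
    finally show ?case by metis
  qed
qed

lemma geometric_ring:
  fixes w :: "'a::ring_1"
  shows "(1 - w) * (\<Sum>k<m. w ^ k) = 1 - w ^ m" and "(\<Sum>k<m. w ^ k) * (1 - w) = 1 - w ^ m"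
proof -
  have c: "(\<Sum>k<m. w ^ k) * w = w * (\<Sum>k<m. w ^ k)"
    by (simp add: sum_distrib_left sum_distrib_right power_commutes)
  show "(1 - w) * (\<Sum>k<m. w ^ k) = 1 - w ^ m"
  proof (induction m)
    case (Suc m)
    have "(1 - w) * (\<Sum>k<Suc m. w ^ k) = (1 - w) * (\<Sum>k<m. w ^ k) + (1 - w) * w ^ m"
      by (simp add: distrib_left)
    then show ?case by (simp only: Suc) (simp add: left_diff_distrib)
  qed simp
  then show "(\<Sum>k<m. w ^ k) * (1 - w) = 1 - w ^ m"
    by (simp add: algebra_simps c)
qed

section \<open>Polynomials evaluated at an element of an algebra\<close>

locale kalgebra =
  fixes sa :: "'k::field \<Rightarrow> 'a::ring_1 \<Rightarrow> 'a"
  assumes kalg: "kalg sa"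
begin

sublocale vector_space sa
  using kalg by unfold_locales (auto simp: kalg_def)

lemma scale_mult_left: "sa c x * y = sa c (x * y)"
  and scale_mult_right: "x * sa c y = sa c (x * y)"
  using kalg unfolding kalg_def by metis+

lemmas scale_mult [simp] = scale_mult_left scale_mult_right

definition peval :: "'a \<Rightarrow> 'k poly \<Rightarrow> 'a" where
  "peval x p = fold_coeffs (\<lambda>a r. sa a 1 + x * r) p 0"

lemma peval_0 [simp]: "peval x 0 = 0"
  by (simp add: peval_def)

lemma peval_pCons [simp]: "peval x (pCons a p) = sa a 1 + x * peval x p"
  by (cases "p = 0 \<and> a = 0") (auto simp: peval_def)

lemma peval_1 [simp]: "peval x 1 = 1"
  by (simp add: one_pCons)

lemma peval_add [simp]: "peval x (p + q) = peval x p + peval x q"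
proof (induction p arbitrary: q)
  case (pCons a p)
  then show ?case by (cases q) (simp add: algebra_simps)
qed simp

lemma peval_smult [simp]: "peval x (smult c p) = sa c (peval x p)"
  by (induction p) (simp_all add: algebra_simps)

lemma peval_mult [simp]: "peval x (p * q) = peval x p * peval x q"
  by (induction p) (simp_all add: algebra_simps)

lemma peval_power [simp]: "peval x (p ^ n) = peval x p ^ n"
  by (induction n) simp_all

lemma peval_minus [simp]: "peval x (p - q) = peval x p - peval x q"
  using peval_add[of x "p - q" q] by (simp add: algebra_simps)

lemma peval_sum: "peval x (sum f A) = (\<Sum>i\<in>A. peval x (f i))"
  by (induction A rule: infinite_finite_induct) simp_all

lemma peval_monom: "peval x (monom c n) = sa c (x ^ n)"
  by (induction n) (simp_all add: monom_0 monom_Suc)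

lemma peval_commute: "y * x = x * y \<Longrightarrow> y * peval x p = peval x p * y"
proof (induction p)
  case (pCons a p)
  then have "y * (x * peval x p) = x * peval x p * y"
    by (metis mult.assoc)
  then show ?case by (simp add: distrib_left distrib_right)
qed simp

definition prim :: "'a \<Rightarrow> bool" where
  "prim e \<longleftrightarrow> e \<noteq> 0 \<and> e * e = e \<and> (\<forall>f. f * f = f \<and> e * f = f \<and> f * e = f \<longrightarrow> f = 0 \<or> f = e)"

end

locale fd_kalgebra = kalgebra sa for sa :: "'k::field \<Rightarrow> 'a::ring_1 \<Rightarrow> 'a" +
  assumes alg_closed: "alg_closed TYPE('k)"
    and findim: "findim sa"
begin

lemma finite_spanning: "\<exists>B. finite B \<and> span B = UNIV"
proof -
  from findim obtain B where B: "finite B" "\<And>x. \<exists>c. x = (\<Sum>b\<in>B. sa (c b) b)"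
    unfolding findim_def by blast
  then have "span B = UNIV"
    by (subst span_finite) auto
  with B show ?thesis by blast
qed

lemma finite_independent: "independent S \<Longrightarrow> finite S"
  using finite_spanning independent_span_bound by blast

lemma annihilating_poly: "\<exists>p. p \<noteq> 0 \<and> peval x p = 0"
proof -
  obtain B where B: "finite B" "span B = UNIV" using finite_spanning by blast
  show ?thesis
  proof (cases "inj_on (\<lambda>i. x ^ i) {..card B}")
    case False
    then obtain i j where ij: "i \<noteq> j" "x ^ i = x ^ j" by (auto simp: inj_on_def)
    have "monom (1::'k) i - monom 1 j \<noteq> 0"
      using ij(1) by (auto simp: poly_eq_iff)
    moreover have "peval x (monom 1 i - monom 1 j) = 0"
      using ij(2) by (simp add: peval_monom)
    ultimately show ?thesis by blast
  next
    case True
    let ?S = "(\<lambda>i. x ^ i) ` {..card B}"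
    have "card ?S = Suc (card B)" using True by (simp add: card_image)
    then have "dependent ?S"
      using independent_span_bound[OF B(1), of ?S] B(2) by auto
    then obtain u where u: "\<exists>v\<in>?S. u v \<noteq> 0" "(\<Sum>v\<in>?S. sa (u v) v) = 0"
      by (subst (asm) dependent_finite) auto
    define p where "p = (\<Sum>i\<le>card B. monom (u (x ^ i)) i)"
    have "peval x p = (\<Sum>i\<le>card B. sa (u (x ^ i)) (x ^ i))"
      by (simp add: p_def peval_sum peval_monom)
    also have "\<dots> = 0"
      using u(2) True by (simp add: sum.reindex)
    finally have 1: "peval x p = 0" .
    from u(1) obtain i where i: "i \<le> card B" "u (x ^ i) \<noteq> 0" by auto
    have "coeff p i = u (x ^ i)"
      using i by (simp add: p_def coeff_sum)
    with i have "p \<noteq> 0" by auto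
    with 1 show ?thesis by blast
  qed
qed

text \<open>The Chinese remainder theorem would split the corner: a polynomial annihilating
  \<open>x\<close> there factors as \<open>l ^ m * q\<close> with \<open>l\<close> linear and
  \<open>q\<close> prime to it, and the Bezout coefficients yield an idempotent below
  \<open>e\<close>. Primitivity leaves only one of the two factors, and minimality of the degree
  decides that it is \<open>l ^ m\<close>.\<close>

lemma corner_split:
  assumes e: "prim e" and x: "e * x = x" "x * e = x"
  shows "\<exists>c m. (x - sa c e) ^ m = 0"
proof -
  have ee: "e * e = e" and e0: "e \<noteq> 0" using e by (auto simp: prim_def)
  \<comment> \<open>\<open>peval\<close> uses the unit of the whole algebra, so vanishing in the
    corner is expressed by multiplying with \<open>e\<close>.\<close>
  define A where "A = {p. p \<noteq> 0 \<and> peval x p * e = 0}"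
  have "\<exists>p. p \<in> A" using annihilating_poly[of x] by (auto simp: A_def)
  then obtain p where p: "p \<in> A" "\<And>q. q \<in> A \<Longrightarrow> degree p \<le> degree q"
    using exists_least_lemma[of "\<lambda>n. \<exists>p\<in>A. degree p = n"]
      arg_min_natI[of "\<lambda>p. p \<in> A" _ degree] arg_min_nat_le[of "\<lambda>p. p \<in> A" _ degree]
    by metis
  have com: "e * peval x q = peval x q * e" for q
    using peval_commute[of e x q] x by simp
  have "degree p > 0"
  proof (rule ccontr)
    assume "\<not> degree p > 0"
    then obtain a where a: "p = [:a:]" by (metis degree_eq_zeroE gr0I)
    then have "a \<noteq> 0" "sa a e = 0" using p(1) by (auto simp: A_def)
    then show False using e0 by simp
  qed
  then obtain c where c: "poly p c = 0"
    using alg_closed by (auto simp: alg_closed_def)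
  have p0: "p \<noteq> 0" using p(1) by (auto simp: A_def)
  define m where "m = order c p"
  define l where "l = [:- c, 1:]"
  have m: "m \<noteq> 0" using c p0 by (simp add: m_def order_root)
  obtain q where q: "p = l ^ m * q" "\<not> l dvd q"
    using order_decomp[OF p0, of c] by (auto simp: m_def l_def)
  have q0: "q \<noteq> 0" using p0 q(1) by auto
  have "poly q c \<noteq> 0" using q(2) by (simp add: poly_eq_0_iff_dvd l_def)
  from bezout_linear_power[OF this, of m] obtain u v where uv: "l ^ m * u + q * v = 1"
    by (auto simp: l_def)
  have pe: "peval x p * e = 0" using p(1) by (simp add: A_def)
  have pq: "peval x (p * r) * e = 0" for r
  proof -
    have "peval x (p * r) * e = peval x r * (peval x p * e)"
      by (metis mult.assoc mult.commute peval_mult)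
    then show ?thesis by (simp add: pe)
  qed
  \<comment> \<open>The part of \<open>e\<close> on which \<open>l ^ m\<close> vanishes:
    \<open>q * v\<close> is 1 modulo \<open>l ^ m\<close> and 0 modulo \<open>q\<close>.\<close>
  define f where "f = peval x (q * v) * e"
  have fe: "f * e = f" "e * f = f"
    using com[of "q * v"] by (metis f_def mult.assoc ee)+
  have "f * f = peval x (q * v) * (e * f)" by (simp add: f_def mult.assoc)
  also have "\<dots> = peval x (q * v * (q * v)) * e"
    by (simp only: fe) (simp add: f_def mult.assoc)
  also have "q * v * (q * v) = q * v * (1 - l ^ m * u)"
    using uv by (metis add_diff_cancel_left')
  also have "\<dots> = q * v - p * (u * v)"
    by (simp add: q(1) algebra_simps)
  also have "peval x \<dots> * e = f"
    using pq[of "u * v"] by (simp add: f_def left_diff_distrib)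
  finally have "f * f = f" .
  with e fe consider "f = 0" | "f = e" by (auto simp: prim_def)
  then show ?thesis
  proof cases
    case 1
    have "peval x q * e = peval x (q * (l ^ m * u + q * v)) * e" using uv by simp
    also have "q * (l ^ m * u + q * v) = p * u + q * (q * v)"
      by (simp add: q(1) algebra_simps)
    also have "peval x \<dots> * e = peval x q * f"
      using pq[of u] by (simp add: distrib_right f_def mult.assoc)
    finally have "q \<in> A" using 1 q0 by (simp add: A_def)
    then have "degree p \<le> degree q" by (rule p(2))
    moreover have "degree p = m + degree q"
      using q(1) q0 by (simp add: degree_mult_eq degree_power_eq l_def)
    ultimately show ?thesis using m by simp
  next
    case 2
    have "peval x l ^ m * e = peval x (l ^ m) * f" using 2 by simp
    also have "\<dots> = peval x (l ^ m * q * v) * e" by (simp add: f_def mult.assoc)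
    also have "\<dots> = 0" using pq[of v] by (simp add: q(1) mult.assoc)
    finally have z: "peval x l ^ m * e = 0" .
    have pl: "peval x l * e = x - sa c e" using x by (simp add: l_def algebra_simps)
    \<comment> \<open>The exponent starts at 1 because a corner element to the power 0 is
      \<open>1\<close> and not \<open>e\<close>.\<close>
    have "(peval x l * e) ^ Suc k = peval x l ^ Suc k * e" for k
    proof (induction k)
      case (Suc k)
      have "(peval x l * e) ^ Suc (Suc k) = peval x l * e * (peval x l ^ Suc k * e)"
        using Suc by (metis power_Suc)
      also have "\<dots> = peval x l * (e * peval x (l ^ Suc k)) * e"
        by (simp only: mult.assoc peval_power)
      also have "\<dots> = peval x l * peval x (l ^ Suc k) * (e * e)"
        by (simp only: com mult.assoc)
      finally show ?case by (simp add: ee mult.assoc)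
    qed simp
    from this[of "m - 1"] z m pl show ?thesis by auto
  qed
qed

text \<open>Otherwise \<open>v ^ k * x ^ k\<close> would be \<open>e\<close> for every positive
  \<open>k\<close>.\<close>

lemma nilpotent_no_left_inverse:
  fixes x v e :: 'a
  assumes "e \<noteq> 0" "v * x = e" "e * x = x" "x ^ m = 0"
  shows False
proof -
  have "v ^ k * x ^ k = e \<or> k = 0" for k
  proof (induction k)
    case (Suc k)
    show ?case
    proof (cases "k = 0")
      case False
      then obtain j where j: "k = Suc j" by (cases k) auto
      have "v ^ Suc k * x ^ Suc k = v ^ k * (v * x) * x ^ k"
        by (simp only: power_Suc power_commutes mult.assoc)
          (simp only: power_commutes flip: mult.assoc power_Suc)
      also have "\<dots> = v ^ k * ((e * x) * x ^ j)" using assms(2) j by (simp add: mult.assoc)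
      also have "\<dots> = v ^ k * x ^ k" using assms(3) j by simp
      finally show ?thesis using Suc False by simp
    qed (use assms in simp)
  qed simp
  from this[of m] assms(4,1) have "m = 0" by auto
  then have "(1::'a) = 0" using assms(4) by simp
  then have "e = 0" by (metis mult_1 mult_zero_left)
  then show False using assms(1) by simp
qed

text \<open>Up to the scalar \<open>c\<close>, \<open>x\<close> is \<open>e - w\<close> with
  \<open>w\<close> nilpotent, so the geometric series inverts it. The series is summed with the unit
  of the algebra and then cut down by \<open>e\<close>.\<close>

lemma split_unit:
  assumes ee: "e * e = e" and x: "e * x = x" "x * e = x"
    and n: "(x - sa c e) ^ m = 0" and c: "c \<noteq> 0"
  shows "\<exists>v. e * v = v \<and> v * e = v \<and> v * x = e \<and> x * v = e"
proof -
  define w where "w = e - sa (inverse c) x"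
  have xw: "sa (inverse c) x = e - w" by (simp add: w_def)
  have we: "w * e = w" "e * w = w" using ee x by (simp_all add: w_def algebra_simps)
  have "w = sa (- inverse c) (x - sa c e)"
    using c by (simp add: w_def algebra_simps)
  then have wm: "w ^ m = 0"
  proof -
    have "sa d y ^ k = sa (d ^ k) (y ^ k)" for d y k by (induction k) simp_all
    then have "w ^ m = sa ((- inverse c) ^ m) ((x - sa c e) ^ m)"
      using \<open>w = sa (- inverse c) (x - sa c e)\<close> by metis
    then show ?thesis using n by simp
  qed
  define g where "g = (\<Sum>k<m. w ^ k)"
  have g: "(1 - w) * g = 1" "g * (1 - w) = 1"
    using geometric_ring[of w m] wm by (simp_all add: g_def)
  have "e * w ^ k = w ^ k * e" for k
    using we by (induction k) (simp_all, metis mult.assoc)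
  then have eg: "e * g = g * e" by (simp add: g_def sum_distrib_left sum_distrib_right)
  define v where "v = sa (inverse c) (e * g)"
  have "e * v = v" by (simp add: v_def ee flip: mult.assoc)
  moreover have "v * e = v" by (simp add: v_def eg mult.assoc ee)
  moreover have "v * x = e"
  proof -
    have "v * x = e * (g * (e - w))" by (simp add: v_def mult.assoc flip: xw)
    also have "e - w = (1 - w) * e" by (simp add: algebra_simps we)
    also have "e * (g * ((1 - w) * e)) = e * (g * (1 - w)) * e" by (simp only: mult.assoc)
    finally show ?thesis by (simp add: g ee)
  qed
  moreover have "x * v = e"
  proof -
    have "x * v = (e - w) * g * e" by (simp add: v_def eg mult.assoc flip: xw)
    also have "e - w = e * (1 - w)" by (simp add: algebra_simps we)
    also have "e * (1 - w) * g * e = e * ((1 - w) * g) * e" by (simp only: mult.assoc)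
    finally show ?thesis by (simp add: g ee)
  qed
  ultimately show ?thesis by blast
qed

text \<open>This is the locality of the corner at \<open>e\<close>: the eigenvalue \<open>c\<close>
  from \<open>corner_split\<close> is zero or not.\<close>

lemma nilpotent_or_unit:
  assumes e: "prim e" and x: "e * x = x" "x * e = x"
  shows "(\<exists>m. x ^ m = 0) \<or> (\<exists>v. e * v = v \<and> v * e = v \<and> v * x = e \<and> x * v = e)"
proof -
  obtain c m where c: "(x - sa c e) ^ m = 0" using corner_split[OF assms] by blast
  show ?thesis
  proof (cases "c = 0")
    case True
    then show ?thesis using c by auto
  next
    case False
    then show ?thesis using split_unit[OF _ x c] e by (auto simp: prim_def)
  qed
qed

text \<open>The product \<open>b * a\<close> is a nonzero idempotent below \<open>e\<close>, so
  primitivity leaves only \<open>e\<close> itself.\<close>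

lemma prim_inverse_flip:
  assumes e: "prim e" and "e' \<noteq> 0" "e' * a = a" "b * e' = b" "e * b = b" "a * e = a" "a * b = e'"
  shows "b * a = e"
proof -
  have "b * a * (b * a) = b * (a * b) * a" by (simp only: mult.assoc)
  also have "\<dots> = b * a" using assms by (simp add: mult.assoc)
  finally have 1: "b * a * (b * a) = b * a" .
  have 2: "e * (b * a) = b * a" "b * a * e = b * a" using assms by (simp_all add: mult.assoc flip: mult.assoc)
      (simp add: mult.assoc)
  have "b * a \<noteq> 0"
  proof
    assume "b * a = 0"
    then have "a * (b * a) * b = 0" by simp
    then have "(a * b) * (a * b) = 0" by (simp only: mult.assoc)
    then have "e' * e' = 0" using assms by simp
    moreover have "e' * e' = e'" using assms by (metis mult.assoc)
    ultimately show False using assms by simp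
  qed
  with 1 2 e show ?thesis by (auto simp: prim_def)
qed

text \<open>In a local ring a sum of nonunits is no unit. The summands are removed one at a time:
  taking away a nilpotent \<open>x i\<close> leaves a sum that still has a left inverse in the
  corner.\<close>

lemma corner_sum_unit:
  assumes e: "prim e" and "finite I" and "(\<Sum>i\<in>I. x i) = y" and "v * y = e"
    and "\<And>i. i \<in> I \<Longrightarrow> e * x i = x i \<and> x i * e = x i" and "e * v = v" "v * e = v"
  shows "\<exists>i\<in>I. \<exists>v. e * v = v \<and> v * e = v \<and> v * x i = e \<and> x i * v = e"
  using assms(2-)
proof (induction I arbitrary: y v rule: finite_induct)
  case empty
  then show ?case using e by (auto simp: prim_def)
next
  case (insert i I)
  have e': "e \<noteq> 0" "e * e = e" using e by (auto simp: prim_def)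
  have xi: "e * x i = x i" "x i * e = x i" using insert.prems by auto
  show ?case
  proof (cases "\<exists>m. x i ^ m = 0")
    case False
    then show ?thesis using nilpotent_or_unit[OF e xi] by auto
  next
    case True
    then obtain m where m: "x i ^ m = 0" by blast
    define w where "w = v * x i"
    define s where "s = (\<Sum>j\<in>I. x j)"
    have s: "e * s = s" "s * e = s"
      using insert.prems by (auto simp: s_def sum_distrib_left sum_distrib_right intro!: sum.cong)
    have y: "y = x i + s" using insert by (simp add: s_def)
    have we: "e * w = w" "w * e = w"
      using xi insert.prems by (simp_all add: w_def mult.assoc flip: mult.assoc)
        (simp add: mult.assoc)
    \<comment> \<open>A left inverse of \<open>w\<close> would give one of the nilpotent
      \<open>x i\<close>.\<close>
    have "\<exists>m. w ^ m = 0"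
    proof (rule ccontr)
      assume "\<not> ?thesis"
      then obtain z where "z * w = e" using nilpotent_or_unit[OF e we] by blast
      then have "(z * v) * x i = e" by (simp add: w_def mult.assoc)
      then show False using nilpotent_no_left_inverse[OF e'(1) _ xi(1) m] by blast
    qed
    then obtain k where k: "w ^ k = 0" by blast
    have vs: "v * s = e - w" using insert.prems y by (simp add: w_def algebra_simps)
    have "((e - w) - sa 1 e) ^ k = (- w) ^ k" by simp
    also have "\<dots> = 0" using k by (metis mult_zero_right power_minus)
    finally have zk: "((e - w) - sa 1 e) ^ k = 0" .
    have "e * (e - w) = e - w" "(e - w) * e = e - w"
      using we e' by (simp_all add: algebra_simps)
    from split_unit[OF e'(2) this zk] obtain z
      where z: "z * (e - w) = e" "e * z = z" "z * e = z" by auto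
    have "(z * v) * s = e" using z vs by (simp add: mult.assoc)
    moreover have "e * (z * v) = z * v" "z * v * e = z * v"
      using z insert.prems by (simp_all add: mult.assoc flip: mult.assoc) (simp add: mult.assoc)
    ultimately have "\<exists>i\<in>I. \<exists>v. e * v = v \<and> v * e = v \<and> v * x i = e \<and> x i * v = e"
      using insert.IH[OF s_def[symmetric], of "z * v"] insert.prems by auto
    then show ?thesis by blast
  qed
qed

end

section \<open>Basic Nakayama algebras\<close>

context kalgebra
begin

abbreviation (input) lmult :: "'a \<Rightarrow> 'a \<Rightarrow> 'a" where "lmult \<equiv> \<lambda>a x. a * x"
abbreviation (input) rmult :: "'a \<Rightarrow> 'a \<Rightarrow> 'a" where "rmult \<equiv> \<lambda>a x. x * a"

lemma submod_left_ideal: "submod sa lmult {x. x * e = x}"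
  by (simp add: submod_def distrib_right left_diff_distrib mult.assoc)

lemma submod_image_rmult: "submod sa lmult U \<Longrightarrow> submod sa lmult ((\<lambda>x. x * f) ` U)"
  unfolding submod_def
  by (auto simp: image_iff simp flip: distrib_right left_diff_distrib mult.assoc)
    (metis mult_zero_left, metis scale_mult_left)

lemma submod_image_lmult: "submod sa rmult U \<Longrightarrow> submod sa rmult ((\<lambda>x. f * x) ` U)"
  unfolding submod_def
  by (auto simp: image_iff mult.assoc simp flip: distrib_left right_diff_distrib)
    (metis mult_zero_right, metis scale_mult_right)

lemma submod_cyclic: "submod sa lmult (range (\<lambda>b. b * a))"
  by (rule submod_image_rmult) (simp add: submod_def)

lemma submod_cyclic_right: "submod sa rmult (range (\<lambda>b. a * b))"
  by (rule submod_image_lmult) (simp add: submod_def)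

lemma submod_subspace: "submod sa act U \<Longrightarrow> subspace U"
  by (auto simp: submod_def subspace_def)

end

lemma int_dsum_component:
  assumes "int_dsum sc ac Ns N" and "x \<in> N"
  shows "\<exists>g. (\<forall>i<length Ns. g i \<in> Ns ! i) \<and> (\<Sum>i<length Ns. g i) = x"
proof -
  from assms obtain xs where xs: "length xs = length Ns" "\<forall>i<length Ns. xs ! i \<in> Ns ! i"
      "sum_list xs = x"
    unfolding int_dsum_def by meson
  then have "(\<Sum>i<length Ns. xs ! i) = x"
    by (simp add: sum_list_sum_nth atLeast0LessThan)
  with xs show ?thesis by blast
qed

lemma int_dsum_unique:
  assumes "int_dsum sc ac Ns N" and "x \<in> N"
    and "\<And>i. i < length Ns \<Longrightarrow> g i \<in> Ns ! i" "(\<Sum>i<length Ns. g i) = x"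
    and "\<And>i. i < length Ns \<Longrightarrow> h i \<in> Ns ! i" "(\<Sum>i<length Ns. h i) = x"
    and "i < length Ns"
  shows "g i = h i"
proof -
  let ?P = "\<lambda>xs. length xs = length Ns \<and> (\<forall>i<length Ns. xs ! i \<in> Ns ! i) \<and> sum_list xs = x"
  have ex1: "\<exists>!xs. ?P xs" using assms(1,2) by (auto simp: int_dsum_def)
  have g: "?P (map g [0..<length Ns])"
    using assms by (simp add: interv_sum_list_conv_sum_set_nat atLeast0LessThan)
  have h: "?P (map h [0..<length Ns])"
    using assms by (simp add: interv_sum_list_conv_sum_set_nat atLeast0LessThan)
  have "\<And>xs ys. ?P xs \<Longrightarrow> ?P ys \<Longrightarrow> xs = ys" using ex1 by blast
  from this[OF g h] have "map g [0..<length Ns] = map h [0..<length Ns]" .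
  then show ?thesis using assms(7) by (metis nth_map_upt add_0 diff_zero)
qed

context fd_kalgebra
begin

text \<open>The idempotents are the components of 1. That the summands are pairwise non-isomorphic
  is recorded elementwise: no \<open>e i\<close> factors through another \<open>e j\<close>.\<close>

lemma basic_idempotents:
  assumes "basic_alg sa"
  shows "\<exists>(n::nat) e. (\<forall>i j. e i * e j = (if i = j then e i else 0)) \<and> (\<Sum>i<n. e i) = 1 \<and>
    (\<forall>i<n. prim (e i)) \<and> (\<forall>i\<ge>n. e i = 0) \<and>
    (\<forall>i<n. \<forall>j<n. \<forall>a b. e i * a = a \<and> a * e j = a \<and> e j * b = b \<and> b * e i = b \<and> a * b = e i \<longrightarrow> i = j)"
proof -
  from assms obtain Ps where Ps: "int_dsum sa lmult Ps UNIV"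
    and ind: "\<forall>P\<in>set Ps. indecomp sa lmult P"
    and noniso: "\<And>i j. i < length Ps \<Longrightarrow> j < length Ps \<Longrightarrow> i \<noteq> j \<Longrightarrow>
         \<not> mod_iso sa lmult (Ps ! i) sa lmult (Ps ! j)"
    unfolding basic_alg_def by blast
  define n where "n = length Ps"
  obtain g where g: "\<forall>i<n. g i \<in> Ps ! i" "(\<Sum>i<n. g i) = 1"
    using int_dsum_component[OF Ps, of 1] by (auto simp: n_def)
  \<comment> \<open>Zero beyond \<open>n\<close>, so that the orthogonality relation holds for all
    pairs of indices.\<close>
  define e where "e i = (if i < n then g i else 0)" for i
  have sub: "submod sa lmult (Ps ! i)" if "i < n" for i
    using Ps that by (auto simp: int_dsum_def n_def)
  have e: "e i \<in> Ps ! i" if "i < n" for i using g that by (simp add: e_def)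
  have es: "(\<Sum>i<n. e i) = 1" using g(2) by (simp add: e_def)
  \<comment> \<open>Both families decompose \<open>x\<close>: one because the \<open>e j\<close> add
    up to 1, the other because \<open>x\<close> lies in the \<open>i\<close>-th summand.\<close>
  have comp: "x * e j = (if j = i then x else 0)" if "i < n" "j < n" "x \<in> Ps ! i" for x i j
  proof (rule int_dsum_unique[OF Ps, of x "\<lambda>j. x * e j" "\<lambda>j. if j = i then x else 0"])
    show "(\<Sum>j<length Ps. x * e j) = x"
      using es by (simp add: n_def flip: sum_distrib_left)
    show "(\<Sum>j<length Ps. if j = i then x else 0) = x" using that by (simp add: n_def)
  next
    fix k assume "k < length Ps"
    then have k: "k < n" by (simp add: n_def)
    show "x * e k \<in> Ps ! k" "(if k = i then x else 0) \<in> Ps ! k"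
      using sub[OF k] e[OF k] that(3) by (simp_all add: submod_def)
  qed (use that(2) in \<open>simp_all add: n_def\<close>)
  have Pi: "Ps ! i = {x. x * e i = x}" if "i < n" for i
  proof
    show "Ps ! i \<subseteq> {x. x * e i = x}" using comp[OF that that] by auto
    have "x * e i \<in> Ps ! i" for x
      using sub[OF that] e[OF that] by (simp add: submod_def)
    then show "{x. x * e i = x} \<subseteq> Ps ! i"
      by (intro subsetI) (erule CollectE, erule subst)
  qed
  have ee: "e i * e j = (if i = j then e i else 0)" for i j
  proof (cases "i < n \<and> j < n")
    case True
    then show ?thesis using comp[OF _ _ e, of i j] by (simp add: eq_commute)
  qed (auto simp: e_def)
  have pr: "prim (e i)" if i: "i < n" for i
    unfolding prim_def
  proof (intro conjI allI impI)
    have id: "indecomp sa lmult (Ps ! i)" using ind i by (simp add: n_def)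
    show "e i \<noteq> 0" using id Pi[OF i] by (auto simp: indecomp_def)
    show "e i * e i = e i" by (simp add: ee)
    fix f assume f: "f * f = f \<and> e i * f = f \<and> f * e i = f"
    \<comment> \<open>The Peirce splitting of the summand at \<open>f\<close>; indecomposability
      makes one half zero.\<close>
    define U where "U = {x. x * f = x}"
    define V where "V = {x. x * (e i - f) = x}"
    have "dsum2 sa lmult U V (Ps ! i)"
      unfolding dsum2_def
    proof (intro conjI)
      show "submod sa lmult U" "submod sa lmult V"
        by (simp_all only: U_def V_def submod_left_ideal)
      have "a = 0" if "a * f = a" "a * (e i - f) = a" for a
      proof -
        have "a = a * ((e i - f) * f)" using that by (metis mult.assoc)
        then show "a = 0" using f by (simp add: left_diff_distrib)
      qed
      then show "U \<inter> V = {0}" by (auto simp: U_def V_def)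
      show "{u + v |u v. u \<in> U \<and> v \<in> V} = Ps ! i"
      proof (intro equalityI subsetI)
        fix x assume "x \<in> {u + v |u v. u \<in> U \<and> v \<in> V}"
        then obtain u v where "x = u + v" "u * f = u" "v * (e i - f) = v"
          by (auto simp: U_def V_def)
        moreover have "u * e i = u" using f \<open>u * f = u\<close> by (metis mult.assoc)
        moreover have "v * e i = v"
        proof -
          have "(e i - f) * e i = e i - f" using f ee by (simp add: left_diff_distrib)
          then show ?thesis using \<open>v * (e i - f) = v\<close> by (metis mult.assoc)
        qed
        ultimately show "x \<in> Ps ! i" using Pi[OF i] by (simp add: distrib_right)
      next
        fix x assume "x \<in> Ps ! i"
        then have "x = x * f + x * (e i - f)" using Pi[OF i] by (simp add: algebra_simps)
        moreover have "x * f \<in> U" using f by (simp add: U_def mult.assoc)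
        moreover have "x * (e i - f) \<in> V" using f ee by (simp add: V_def algebra_simps)
        ultimately show "x \<in> {u + v |u v. u \<in> U \<and> v \<in> V}" by blast
      qed
    qed
    then have "U = {0} \<or> V = {0}" using id by (auto simp: indecomp_def)
    moreover have "f \<in> U" using f by (simp add: U_def)
    moreover have "e i - f \<in> V" using f ee by (simp add: V_def algebra_simps)
    ultimately show "f = 0 \<or> f = e i" by auto
  qed
  have ni: "i = j"
    if i: "i < n" and j: "j < n"
      and ab: "e i * a = a" "a * e j = a" "e j * b = b" "b * e i = b" "a * b = e i" for i j a b
  proof (rule ccontr)
    assume "i \<noteq> j"
    have ei: "e i \<noteq> 0" using pr[OF i] by (simp add: prim_def)
    have ba: "b * a = e j"
      by (rule prim_inverse_flip[OF pr[OF j] ei ab(1,4,3,2,5)])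
    \<comment> \<open>Right multiplications by \<open>a\<close> and \<open>b\<close> are mutually
      inverse isomorphisms of the two summands.\<close>
    have "bij_betw (\<lambda>x. x * a) (Ps ! i) (Ps ! j)"
    proof (rule bij_betw_byWitness[where f' = "\<lambda>x. x * b"])
      show "\<forall>x\<in>Ps ! i. x * a * b = x" "\<forall>x\<in>Ps ! j. x * b * a = x"
        using ab(5) ba Pi[OF i] Pi[OF j] by (simp_all add: mult.assoc)
      show "(\<lambda>x. x * a) ` Ps ! i \<subseteq> Ps ! j" "(\<lambda>x. x * b) ` Ps ! j \<subseteq> Ps ! i"
        using ab(2,4) Pi[OF i] Pi[OF j] by (auto simp add: mult.assoc)
    qed
    then have "mod_iso sa lmult (Ps ! i) sa lmult (Ps ! j)"
      unfolding mod_iso_def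
      by (intro exI[of _ "\<lambda>x. x * a"]) (simp add: distrib_right mult.assoc)
    then show False using noniso[of i j] i j \<open>i \<noteq> j\<close> by (simp add: n_def)
  qed
  have "\<forall>i j. e i * e j = (if i = j then e i else 0)" using ee by blast
  moreover have "\<forall>i\<ge>n. e i = 0" by (simp add: e_def)
  moreover have "\<forall>i<n. prim (e i)" using pr by blast
  moreover have "\<forall>i<n. \<forall>j<n. \<forall>a b. e i * a = a \<and> a * e j = a \<and> e j * b = b \<and> b * e i = b \<and> a * b = e i \<longrightarrow> i = j"
    using ni by blast
  ultimately show ?thesis
    by (intro exI[of _ n] exI[of _ e] conjI es)
qed

lemma uniserial_embedding:
  assumes P: "uniserial sa act P" and inj: "inj_on h S" and hP: "h ` S \<subseteq> P"
    and sub: "\<And>U. submod sa act U \<Longrightarrow> submod sa act (h ` U)"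
  shows "uniserial sa act S"
  unfolding uniserial_def
proof (intro allI impI)
  fix U V assume UV: "submod sa act U \<and> U \<subseteq> S \<and> submod sa act V \<and> V \<subseteq> S"
  then have "h ` U \<subseteq> P" "h ` V \<subseteq> P" using hP by blast+
  then have "h ` U \<subseteq> h ` V \<or> h ` V \<subseteq> h ` U" using P sub UV unfolding uniserial_def by blast
  moreover have "A \<subseteq> B" if "h ` A \<subseteq> h ` B" "A \<subseteq> S" "B \<subseteq> S" for A B
    using that inj_on_image_mem_iff[OF inj _ that(3)] by blast
  ultimately show "U \<subseteq> V \<or> V \<subseteq> U" using UV by blast
qed

text \<open>\<open>e\<close> is the sum of its compressions \<open>e * f i * e\<close>, and in a
  local corner one of them must be a unit.\<close>

lemma prim_unit_component:
  assumes e: "prim e" and f: "(\<Sum>i\<in>I. f i) = 1" "finite I"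
  shows "\<exists>i\<in>I. \<exists>v. v * (e * f i * e) = e \<and> e * f i * e * v = e"
proof -
  have ee: "e * e = e" using e by (simp add: prim_def)
  have "(\<Sum>i\<in>I. e * f i * e) = e * (\<Sum>i\<in>I. f i) * e"
    by (simp add: sum_distrib_left sum_distrib_right)
  then have s: "(\<Sum>i\<in>I. e * f i * e) = e" by (simp add: f ee)
  have c: "e * (e * f i * e) = e * f i * e \<and> e * f i * e * e = e * f i * e" for i
    by (simp add: mult.assoc ee) (simp add: ee flip: mult.assoc)
  show ?thesis using corner_sum_unit[OF e f(2) s ee c ee ee] by blast
qed

text \<open>If the component \<open>e f e\<close> of \<open>e\<close> at a summand is a unit of the corner \<open>e\<Lambda>e\<close>, then multiplication
  by \<open>f\<close> embeds the ideal generated by \<open>e\<close> into that summand.\<close>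

lemma uniserial_left:
  assumes e: "prim e" and Ps: "int_dsum sa lmult Ps UNIV" "\<forall>P\<in>set Ps. uniserial sa lmult P"
  shows "uniserial sa lmult {x. x * e = x}"
proof -
  obtain f where f: "\<forall>i<length Ps. f i \<in> Ps ! i" "(\<Sum>i<length Ps. f i) = 1"
    using int_dsum_component[OF Ps(1), of 1] by auto
  obtain j v where j: "j < length Ps" "e * f j * e * v = e"
    using prim_unit_component[OF e f(2)] by auto
  have sub: "submod sa lmult (Ps ! j)" using Ps(1) j by (simp add: int_dsum_def)
  show ?thesis
  proof (rule uniserial_embedding)
    show "uniserial sa lmult (Ps ! j)" using Ps(2) j by simp
    show "inj_on (\<lambda>x. x * f j) {x. x * e = x}"
    proof (rule inj_on_inverseI)
      fix x assume "x \<in> {x. x * e = x}"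
      then have "x * f j * (e * v) = x * e * f j * (e * v)" by simp
      also have "\<dots> = x * (e * f j * e * v)" by (simp only: mult.assoc)
      finally show "x * f j * (e * v) = x" using j \<open>x \<in> _\<close> by simp
    qed
    show "(\<lambda>x. x * f j) ` {x. x * e = x} \<subseteq> Ps ! j" using sub f j by (auto simp: submod_def)
  qed (rule submod_image_rmult)
qed

lemma uniserial_right:
  assumes e: "prim e" and Ps: "int_dsum sa rmult Ps UNIV" "\<forall>P\<in>set Ps. uniserial sa rmult P"
  shows "uniserial sa rmult {x. e * x = x}"
proof -
  obtain f where f: "\<forall>i<length Ps. f i \<in> Ps ! i" "(\<Sum>i<length Ps. f i) = 1"
    using int_dsum_component[OF Ps(1), of 1] by auto
  obtain j v where j: "j < length Ps" "v * (e * f j * e) = e"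
    using prim_unit_component[OF e f(2)] by auto
  have sub: "submod sa rmult (Ps ! j)" using Ps(1) j by (simp add: int_dsum_def)
  show ?thesis
  proof (rule uniserial_embedding)
    show "uniserial sa rmult (Ps ! j)" using Ps(2) j by simp
    show "inj_on (\<lambda>x. f j * x) {x. e * x = x}"
    proof (rule inj_on_inverseI)
      fix x assume "x \<in> {x. e * x = x}"
      then have "v * e * (f j * x) = v * e * (f j * (e * x))" by simp
      also have "\<dots> = v * (e * f j * e) * x" by (simp only: mult.assoc)
      finally show "v * e * (f j * x) = x" using j \<open>x \<in> _\<close> by simp
    qed
    show "(\<lambda>x. f j * x) ` {x. e * x = x} \<subseteq> Ps ! j" using sub f j by (auto simp: submod_def)
  qed (rule submod_image_lmult)
qed

text \<open>For a nonzero idempotent \<open>e\<close> whose left ideal is uniserial, this is the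
  radical of that ideal.\<close>

definition max_sub :: "'a \<Rightarrow> 'a set" where
  "max_sub e = \<Union>{U. submod sa lmult U \<and> U \<subseteq> {x. x * e = x} \<and> e \<notin> U}"

lemma max_sub_iff:
  "x \<in> max_sub e \<longleftrightarrow> x * e = x \<and> (\<nexists>b. b * x = e)"
proof
  assume "x \<in> max_sub e"
  then obtain U where "submod sa lmult U" "U \<subseteq> {x. x * e = x}" "e \<notin> U" "x \<in> U"
    by (auto simp: max_sub_def)
  then show "x * e = x \<and> (\<nexists>b. b * x = e)" by (auto simp: submod_def)
next
  assume x: "x * e = x \<and> (\<nexists>b. b * x = e)"
  have "submod sa lmult (range (\<lambda>b. b * x))" by (rule submod_cyclic)
  moreover have "range (\<lambda>b. b * x) \<subseteq> {x. x * e = x}" using x by (auto simp: mult.assoc)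
  moreover have "e \<notin> range (\<lambda>b. b * x)" using x by auto
  moreover have "x \<in> range (\<lambda>b. b * x)" by (metis mult_1 rangeI)
  ultimately show "x \<in> max_sub e" unfolding max_sub_def by blast
qed

text \<open>Any two elements of the union lie in a common member, since submodules are comparable;
  this gives closure under addition.\<close>

lemma submod_max_sub:
  assumes u: "uniserial sa lmult {x. x * e = x}" and "e \<noteq> 0"
  shows "submod sa lmult (max_sub e)"
proof -
  let ?F = "{U. submod sa lmult U \<and> U \<subseteq> {x. x * e = x} \<and> e \<notin> U}"
  have "{0} \<in> ?F" using assms by (auto simp: submod_def)
  then have 0: "0 \<in> max_sub e" unfolding max_sub_def by blast
  have two: "\<exists>U\<in>?F. x \<in> U \<and> y \<in> U" if xy: "x \<in> max_sub e" "y \<in> max_sub e" for x y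
  proof -
    from xy obtain U V where "U \<in> ?F" "V \<in> ?F" "x \<in> U" "y \<in> V" unfolding max_sub_def by blast
    moreover then have "U \<subseteq> V \<or> V \<subseteq> U" using u unfolding uniserial_def by blast
    ultimately show ?thesis by blast
  qed
  show ?thesis unfolding submod_def
  proof (intro conjI ballI allI 0)
    fix x y assume "x \<in> max_sub e" "y \<in> max_sub e"
    then obtain U where "U \<in> ?F" "x \<in> U \<and> y \<in> U" using two by blast
    then have "U \<subseteq> max_sub e" "x + y \<in> U" "x - y \<in> U" by (auto simp: max_sub_def submod_def)
    then show "x + y \<in> max_sub e" "x - y \<in> max_sub e" by auto
  next
    fix x c r assume "x \<in> max_sub e"
    then obtain U where "U \<in> ?F" "x \<in> U" using two by blast
    then have "U \<subseteq> max_sub e" "sa c x \<in> U" "r * x \<in> U" by (auto simp: max_sub_def submod_def)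
    then show "sa c x \<in> max_sub e" "r * x \<in> max_sub e" by auto
  qed
qed

text \<open>Cyclic submodules of a uniserial module are totally ordered, so an element of a finite
  set with the largest cyclic submodule generates all the others.\<close>

lemma uniserial_chain_max:
  assumes u: "uniserial sa lmult {x. x * e = x}"
    and "finite B" "B \<noteq> {}" "B \<subseteq> {x. x * e = x}"
  shows "\<exists>a\<in>B. \<forall>b\<in>B. b \<in> range (\<lambda>r. r * a)"
  using assms(2-)
proof (induction B rule: finite_ne_induct)
  case (singleton x)
  have "x \<in> range (\<lambda>r. r * x)" by (rule range_eqI[of _ _ 1]) simp
  then show ?case by simp
next
  case (insert x B)
  then obtain a where a: "a \<in> B" "\<forall>b\<in>B. b \<in> range (\<lambda>r. r * a)" by blast
  have x: "x \<in> range (\<lambda>r. r * x)" by (rule range_eqI[of _ _ 1]) simp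
  have sub: "range (\<lambda>r. r * y) \<subseteq> {x. x * e = x}" if "y * e = y" for y
    using that by (auto simp: mult.assoc)
  have ax: "a * e = a" "x * e = x" using insert.prems a(1) by auto
  have "range (\<lambda>r. r * a) \<subseteq> range (\<lambda>r. r * x) \<or> range (\<lambda>r. r * x) \<subseteq> range (\<lambda>r. r * a)"
    using u submod_cyclic sub[OF ax(1)] sub[OF ax(2)] unfolding uniserial_def by meson
  then show ?case
  proof
    assume "range (\<lambda>r. r * a) \<subseteq> range (\<lambda>r. r * x)"
    then have "\<forall>b\<in>insert x B. b \<in> range (\<lambda>r. r * x)" using a(2) x by blast
    then show ?thesis by blast
  next
    assume "range (\<lambda>r. r * x) \<subseteq> range (\<lambda>r. r * a)"
    then have "\<forall>b\<in>insert x B. b \<in> range (\<lambda>r. r * a)" using a(2) x by blast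
    then show ?thesis using a(1) by blast
  qed
qed

text \<open>A basis of \<open>max_sub e\<close> is finite, and a nonempty one contains an element
  that generates all the others.\<close>

lemma max_sub_cyclic:
  assumes u: "uniserial sa lmult {x. x * e = x}" and e0: "e \<noteq> 0"
  shows "\<exists>a\<in>max_sub e. max_sub e = range (\<lambda>r. r * a)"
proof -
  note sub = submod_max_sub[OF assms]
  obtain B where B: "B \<subseteq> max_sub e" "independent B" "max_sub e \<subseteq> span B"
    using maximal_independent_subset by blast
  have fin: "finite B" using B(2) by (rule finite_independent)
  have "\<exists>a\<in>max_sub e. \<forall>b\<in>B. b \<in> range (\<lambda>r. r * a)"
  proof (cases "B = {}")
    case True
    then show ?thesis using sub by (auto simp: submod_def)
  next
    case False
    have "B \<subseteq> {x. x * e = x}" using B(1) max_sub_iff by auto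
    from uniserial_chain_max[OF u fin False this] B(1) show ?thesis by blast
  qed
  then obtain a where a: "a \<in> max_sub e" "\<forall>b\<in>B. b \<in> range (\<lambda>r. r * a)" by blast
  have "span B \<subseteq> range (\<lambda>r. r * a)"
    using a(2) by (intro span_minimal submod_subspace[OF submod_cyclic]) auto
  moreover have "range (\<lambda>r. r * a) \<subseteq> max_sub e" using a(1) sub by (auto simp: submod_def)
  ultimately show ?thesis using a(1) B(3) by blast
qed

end

text \<open>Domain and image have complements of equal size in \<open>{..<n}\<close>. From
  \<open>n\<close> on the extension is the identity, which makes it injective on all of
  \<open>nat\<close>, so that it can be cancelled without range conditions.\<close>

lemma extend_injection_to_permutation:
  assumes "D \<subseteq> {..<n}" "inj_on f D" "f ` D \<subseteq> {..<n::nat}"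
  shows "\<exists>g. inj g \<and> (\<forall>i<n. g i < n) \<and> (\<forall>i\<in>D. g i = f i)"
proof -
  have fin: "finite D" using assms(1) finite_subset by blast
  have "card ({..<n} - D) = card ({..<n} - f ` D)"
    using assms fin by (simp add: card_Diff_subset card_image)
  then obtain h where h: "bij_betw h ({..<n} - D) ({..<n} - f ` D)"
    using finite_same_card_bij by blast
  define g where "g i = (if i \<in> D then f i else if i < n then h i else i)" for i
  have "bij_betw g D (f ` D)"
    using assms(2) by (subst bij_betw_cong[of D g f]) (simp_all add: g_def inj_on_imp_bij_betw)
  moreover have "bij_betw g ({..<n} - D) ({..<n} - f ` D)"
    using h by (subst bij_betw_cong[of _ g h]) (simp_all add: g_def)
  ultimately have "bij_betw g (D \<union> ({..<n} - D)) (f ` D \<union> ({..<n} - f ` D))"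
    by (rule bij_betw_combine) blast
  moreover have "D \<union> ({..<n} - D) = {..<n}" "f ` D \<union> ({..<n} - f ` D) = {..<n}"
    using assms(1,3) by blast+
  ultimately have gn: "bij_betw g {..<n} {..<n}" by simp
  have "bij_betw g {n..} {n..}"
    using assms(1) by (subst bij_betw_cong[of _ g id]) (auto simp: g_def)
  then have "bij_betw g ({..<n} \<union> {n..}) ({..<n} \<union> {n..})"
    by (rule bij_betw_combine[OF gn]) auto
  moreover have "{..<n} \<union> {n..} = UNIV" by auto
  ultimately have "inj g" by (simp add: bij_betw_def)
  moreover have "\<forall>i<n. g i < n" using bij_betwE[OF gn] by blast
  moreover have "\<forall>i\<in>D. g i = f i" by (simp add: g_def)
  ultimately show ?thesis by blast
qed

text \<open>Two members of the orbit coincide by counting, and injectivity cancels the steps they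
  share.\<close>

lemma inj_finite_orbit_returns:
  assumes "inj f" "\<And>i. i < n \<Longrightarrow> f i < n" "i < (n::nat)"
  shows "\<exists>r>0. (f ^^ r) i = i"
proof -
  have lt: "(f ^^ t) i < n" for t by (induction t) (use assms in auto)
  have "\<not> inj_on (\<lambda>t. (f ^^ t) i) {..n}"
  proof
    assume "inj_on (\<lambda>t. (f ^^ t) i) {..n}"
    then have "card {..n} \<le> card {..<n}"
      by (rule card_inj_on_le) (use lt in auto)
    then show False by simp
  qed
  then obtain a b where ab: "a \<noteq> b" "(f ^^ a) i = (f ^^ b) i" by (auto simp: inj_on_def)
  define s t where "s = min a b" and "t = max a b"
  have st: "s < t" "(f ^^ s) i = (f ^^ t) i"
    using ab by (auto simp: s_def t_def min_def max_def)
  have "(f ^^ t) i = (f ^^ (s + (t - s))) i" using st(1) by simp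
  also have "\<dots> = (f ^^ s) ((f ^^ (t - s)) i)" by (simp only: funpow_add comp_apply)
  finally have "(f ^^ s) i = (f ^^ s) ((f ^^ (t - s)) i)" using st(2) by simp
  then have "(f ^^ (t - s)) i = i" using inj_fn[OF assms(1), of s] by (simp add: inj_eq)
  with st show ?thesis by (intro exI[of _ "t - s"]) auto
qed

text \<open>The underlying quiver is a union of oriented cycles and \<open>\<pi>\<close> is the sum
  of its arrows; a linear quiver is a cycle with one arrow set to zero. The spanning elements need
  not be independent: \<open>\<pi> ^ t * e i\<close> may vanish for some \<open>t\<close> below
  \<open>N\<close>.\<close>

locale serial_algebra = kalgebra sa for sa :: "'k::field \<Rightarrow> 'a::ring_1 \<Rightarrow> 'a" +
  fixes n :: nat and e :: "nat \<Rightarrow> 'a" and \<pi> :: 'a and \<sigma> :: "nat \<Rightarrow> nat" and N :: nat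
  assumes e_mult: "e i * e j = (if i = j then e i else 0)"
    and e_sum: "(\<Sum>i<n. e i) = 1"
    and e_nonzero: "i < n \<Longrightarrow> e i \<noteq> 0"
    and e_out: "i \<ge> n \<Longrightarrow> e i = 0"
    and pi_e: "\<pi> * e i = e (\<sigma> i) * \<pi>"
    and sigma_inj: "inj \<sigma>"
    and sigma_less: "i < n \<Longrightarrow> \<sigma> i < n"
    and pi_nilpotent: "\<pi> ^ N = 0"
    and spanning: "\<exists>c. r = (\<Sum>i<n. \<Sum>t<N. sa (c i t) (\<pi> ^ t * e i))"

theorem (in fd_kalgebra) nakayama_serial:
  assumes basic: "basic_alg sa" and nak: "nakayama sa"
  shows "\<exists>n e \<pi> \<sigma> N. serial_algebra sa n e \<pi> \<sigma> N"
proof -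
  obtain n :: nat and e where H: "\<forall>i j. e i * e j = (if i = j then e i else 0)"
    "(\<Sum>i<n. e i) = 1" "\<forall>i<n. prim (e i)" "\<forall>i\<ge>n. e i = 0"
    "\<forall>i<n. \<forall>j<n. \<forall>a b. e i * a = a \<and> a * e j = a \<and> e j * b = b \<and> b * e i = b \<and>
      a * b = e i \<longrightarrow> i = j"
    using basic_idempotents[OF basic] by (elim exE conjE) (rule that)
  have ee: "e i * e j = (if i = j then e i else 0)" for i j using H(1) by blast
  note es = H(2)
  have pr: "prim (e i)" if "i < n" for i using H(3) that by blast
  have eo: "e i = 0" if "i \<ge> n" for i using H(4) that by blast
  have ni: "i = j" if "i < n" "j < n" "e i * a = a" "a * e j = a" "e j * b = b"
      "b * e i = b" "a * b = e i" for i j a b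
    using H(5) that by blast
  have ul: "uniserial sa lmult {x. x * e i = x}" and ur: "uniserial sa rmult {x. e i * x = x}"
    if "i < n" for i
    using nak uniserial_left[OF pr[OF that]] uniserial_right[OF pr[OF that]]
    unfolding nakayama_def by blast+
  have e0: "e i \<noteq> 0" if "i < n" for i using pr[OF that] by (simp add: prim_def)
  let ?R = "\<lambda>i. max_sub (e i)"
  have dec: "x = (\<Sum>l<n. e l * x)" for x
    using es by (simp flip: sum_distrib_right)
  \<comment> \<open>The radical of each indecomposable projective is generated by a single arrow:
    the components \<open>e l * a\<close> of a generator \<open>a\<close> are comparable, so one of
    them already generates.\<close>
  have "\<exists>a s. s < n \<and> e s * a = a \<and> a \<in> ?R i \<and> ?R i = range (\<lambda>r. r * a)" if i: "i < n" for i
  proof -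
    obtain a where a: "a \<in> ?R i" "?R i = range (\<lambda>r. r * a)"
      using max_sub_cyclic[OF ul[OF i] e0[OF i]] by blast
    let ?B = "(\<lambda>l. e l * a) ` {..<n}"
    have ae: "a * e i = a" using a(1) by (simp add: max_sub_iff)
    have "\<exists>c\<in>?B. \<forall>b\<in>?B. b \<in> range (\<lambda>r. r * c)"
      by (rule uniserial_chain_max[OF ul[OF i]]) (use i ae in \<open>auto simp: mult.assoc\<close>)
    then obtain s where s: "s < n" "\<forall>l<n. e l * a \<in> range (\<lambda>r. r * (e s * a))" by blast
    then have "\<forall>l<n. \<exists>r. e l * a = r * (e s * a)" by blast
    then obtain r where r: "\<forall>l<n. e l * a = r l * (e s * a)" by metis
    have "a = (\<Sum>l<n. e l * a)" by (rule dec)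
    also have "\<dots> = (\<Sum>l<n. r l) * (e s * a)" using r by (simp add: sum_distrib_right)
    finally obtain q where q: "a = q * (e s * a)" by blast
    have "b * a \<in> range (\<lambda>r. r * (e s * a))" for b
      by (rule range_eqI[of _ _ "b * q"]) (simp only: mult.assoc q[symmetric])
    moreover have "b * (e s * a) \<in> range (\<lambda>r. r * a)" for b
      by (rule range_eqI[of _ _ "b * e s"]) (simp only: mult.assoc)
    ultimately have R: "?R i = range (\<lambda>r. r * (e s * a))" unfolding a(2) by blast
    have "e s * a \<in> ?R i" unfolding R by (rule range_eqI[of _ _ 1]) simp
    moreover have "e s * (e s * a) = e s * a" using ee[of s s] by (simp flip: mult.assoc)
    ultimately show ?thesis using R s(1) by (intro exI[of _ "e s * a"] exI[of _ s]) simp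
  qed
  then obtain \<alpha>' s where a': "\<And>i. i < n \<Longrightarrow> s i < n \<and> e (s i) * \<alpha>' i = \<alpha>' i \<and> \<alpha>' i \<in> ?R i \<and>
      ?R i = range (\<lambda>r. r * \<alpha>' i)" by metis
  define \<alpha> where "\<alpha> i = (if i < n then \<alpha>' i else 0)" for i
  have sn: "s i < n" and ea: "e (s i) * \<alpha> i = \<alpha> i" and ae: "\<alpha> i * e i = \<alpha> i"
    and Ra: "?R i = range (\<lambda>r. r * \<alpha> i)" and aR: "\<alpha> i \<in> ?R i" if "i < n" for i
    using a'[OF that] that by (auto simp: \<alpha>_def max_sub_iff)
  \<comment> \<open>Outside the radical, \<open>x\<close> would let \<open>e i\<close> factor
    through \<open>e l\<close>, which basicness excludes.\<close>
  have offdiag: "x \<in> ?R i" if "i < n" "l < n" "l \<noteq> i" "e l * x = x" "x * e i = x" for i l x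
    unfolding max_sub_iff
  proof (intro conjI notI)
    show "x * e i = x" by fact
    assume "\<exists>b. b * x = e i"
    then obtain b where "b * x = e i" by blast
    then have "(e i * b * e l) * x = e i" using that ee by (simp add: mult.assoc)
    moreover have "e i * (e i * b * e l) = e i * b * e l" "e i * b * e l * e l = e i * b * e l"
      using ee by (simp_all add: mult.assoc) (simp flip: mult.assoc)
    ultimately have "i = l" using ni[of i l "e i * b * e l" x] that by blast
    then show False using that by simp
  qed
  have diag: "x \<in> ?R i" if "i < n" "e i * x = x" "x * e i = x" "x ^ m = 0" for i x m
    unfolding max_sub_iff
    using that nilpotent_no_left_inverse[OF e0[OF that(1)] _ that(2,4)] by blast
  \<comment> \<open>Modulo its radical, the left ideal of \<open>e i\<close> is the line spanned by
    \<open>e i\<close>: the diagonal component of \<open>x\<close> is a scalar plus a nilpotent, and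
    the other components lie in the radical.\<close>
  have split: "\<exists>c r. x = sa c (e i) + r * \<alpha> i" if i: "i < n" and x: "x * e i = x" for i x
  proof -
    have "e i * (e i * x) = e i * x" "e i * x * e i = e i * x"
      using ee x by (simp_all add: mult.assoc) (simp flip: mult.assoc)
    from corner_split[OF pr[OF i] this] obtain c m where c: "(e i * x - sa c (e i)) ^ m = 0"
      by blast
    have sub: "subspace (?R i)"
      using submod_subspace[OF submod_max_sub[OF ul[OF i] e0[OF i]]] .
    have "x - sa c (e i) = (\<Sum>l<n. e l * (x - sa c (e i)))" by (rule dec)
    moreover have "\<dots> \<in> ?R i"
    proof (rule subspace_sum[OF sub])
      fix l assume "l \<in> {..<n}"
      then have l: "l < n" by simp
      let ?y = "e l * (x - sa c (e i))"
      have y: "e l * ?y = ?y" "?y * e i = ?y"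
        using ee x by (simp_all add: mult.assoc left_diff_distrib) (simp flip: mult.assoc)
      show "?y \<in> ?R i"
      proof (cases "l = i")
        case True
        have "?y = e i * x - sa c (e i)" using True ee by (simp add: right_diff_distrib)
        then show ?thesis using diag[OF i _ y(2), of m] y(1) c True by simp
      qed (use offdiag[OF i l _ y] in simp)
    qed
    ultimately obtain r where "x - sa c (e i) = r * \<alpha> i" using Ra[OF i] by auto
    then show ?thesis by (intro exI[of _ c] exI[of _ r]) (simp add: algebra_simps)
  qed
  \<comment> \<open>Arrows with the same target are comparable as right ideals; a proper factorization
    \<open>\<alpha> i = \<alpha> j * y\<close> with \<open>y\<close> in the radical gives \<open>\<alpha> i = w * \<alpha> i\<close> with \<open>w\<close> nilpotent.\<close>
  have inj: "i = j" if i: "i < n" and j: "j < n" and ij: "s i = s j" "\<alpha> i \<noteq> 0" "\<alpha> j \<noteq> 0"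
    for i j
  proof (rule ccontr)
    assume "i \<noteq> j"
    have bad: False if i: "i < n" and j: "j < n" and ne: "i \<noteq> j" and sij: "s i = s j"
        and nz: "\<alpha> i \<noteq> 0" and sub: "range (\<lambda>b. \<alpha> i * b) \<subseteq> range (\<lambda>b. \<alpha> j * b)" for i j
    proof -
      have "\<alpha> i \<in> range (\<lambda>b. \<alpha> j * b)" using sub by (metis mult_1_right rangeI subsetD)
      then obtain y' where "\<alpha> i = \<alpha> j * y'" by blast
      then have y: "\<alpha> i = \<alpha> j * (e j * y' * e i)" using ae[OF i] ae[OF j] by (metis mult.assoc)
      have "e j * y' * e i \<in> ?R i"
        using ee by (intro offdiag[OF i j]) (use ne in \<open>simp_all add: mult.assoc\<close>,
            simp flip: mult.assoc)
      then obtain z where z: "e j * y' * e i = z * \<alpha> i" using Ra[OF i] by auto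
      define q where "q = e (s i)"
      have q: "prim q" "q * q = q" "q \<noteq> 0" using pr[OF sn[OF i]] by (auto simp: q_def prim_def)
      have qa: "q * \<alpha> i = \<alpha> i" "q * \<alpha> j = \<alpha> j" using ea[OF i] ea[OF j] sij by (simp_all add: q_def)
      define w where "w = \<alpha> j * z * q"
      have w: "q * w = w" "w * q = w" "w * \<alpha> i = \<alpha> i"
        using y z qa q by (simp_all add: w_def mult.assoc flip: mult.assoc)
          (simp_all add: mult.assoc)
      \<comment> \<open>As \<open>w\<close> fixes a nonzero element, it cannot be nilpotent.
        Locality makes it a unit, so \<open>\<alpha> j\<close> is right invertible and then, by
        primitivity, left invertible, which no element of the radical is.\<close>
      have "w ^ k * \<alpha> i = \<alpha> i" for k by (induction k) (simp_all add: mult.assoc w)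
      then have "w ^ k \<noteq> 0" for k using nz by (metis mult_zero_left)
      then obtain v where v: "q * v = v" "v * q = v" "w * v = q"
        using nilpotent_or_unit[OF q(1) w(1,2)] by blast
      define b where "b = e j * (z * q * v)"
      have "\<alpha> j * b = q" using v ae[OF j] by (simp add: b_def w_def flip: mult.assoc)
      then have "b * \<alpha> j = e j"
        using prim_inverse_flip[OF pr[OF j] q(3) qa(2), of b] ae[OF j] v ee
        by (simp add: b_def mult.assoc) (simp flip: mult.assoc)
      then show False using aR[OF j] by (auto simp: max_sub_iff)
    qed
    have "uniserial sa rmult {x. e (s i) * x = x}" using ur sn i by blast
    moreover have "range (\<lambda>b. \<alpha> i * b) \<subseteq> {x. e (s i) * x = x}"
      using ea[OF i] by (auto simp flip: mult.assoc)
    moreover have "range (\<lambda>b. \<alpha> j * b) \<subseteq> {x. e (s i) * x = x}"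
      using ea[OF j] ij by (auto simp flip: mult.assoc)
    ultimately have "range (\<lambda>b. \<alpha> i * b) \<subseteq> range (\<lambda>b. \<alpha> j * b) \<or>
        range (\<lambda>b. \<alpha> j * b) \<subseteq> range (\<lambda>b. \<alpha> i * b)"
      using submod_cyclic_right unfolding uniserial_def by blast
    then show False using bad[of i j] bad[of j i] i j ij \<open>i \<noteq> j\<close> by auto
  qed
  have "inj_on s {i. i < n \<and> \<alpha> i \<noteq> 0}"
  proof (rule inj_onI)
    fix i j assume "i \<in> {i. i < n \<and> \<alpha> i \<noteq> 0}" "j \<in> {i. i < n \<and> \<alpha> i \<noteq> 0}" "s i = s j"
    then show "i = j" by (elim CollectE conjE) (rule inj)
  qed
  moreover have "s ` {i. i < n \<and> \<alpha> i \<noteq> 0} \<subseteq> {..<n}" using sn by blast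
  ultimately obtain \<sigma> where sg0: "inj \<sigma>" "\<forall>i<n. \<sigma> i < n"
      "\<forall>i\<in>{i. i < n \<and> \<alpha> i \<noteq> 0}. \<sigma> i = s i"
    using extend_injection_to_permutation[of "{i. i < n \<and> \<alpha> i \<noteq> 0}" n s] by blast
  have sg: "inj \<sigma>" "\<And>i. i < n \<Longrightarrow> \<sigma> i < n"
      "\<And>i. i < n \<Longrightarrow> \<alpha> i \<noteq> 0 \<Longrightarrow> \<sigma> i = s i"
    using sg0 by blast+
  define \<pi> where "\<pi> = (\<Sum>i<n. \<alpha> i)"
  have ae0: "\<alpha> i * e j = (if i = j then \<alpha> i else 0)" for i j
  proof (cases "i < n")
    case True
    then have "\<alpha> i * e j = \<alpha> i * (e i * e j)" using ae by (simp flip: mult.assoc)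
    then show ?thesis using ee ae[OF True] by auto
  qed (simp add: \<alpha>_def)
  have ea0: "e (\<sigma> j) * \<alpha> i = (if i = j then \<alpha> i else 0)" for i j
  proof (cases "\<alpha> i = 0")
    case False
    then have i: "i < n" by (auto simp: \<alpha>_def split: if_splits)
    then have "e (\<sigma> j) * \<alpha> i = e (\<sigma> j) * e (\<sigma> i) * \<alpha> i"
      using ea[OF i] sg(3)[OF i False] by (simp add: mult.assoc)
    also have "\<dots> = (if i = j then e (\<sigma> i) * \<alpha> i else 0)"
      using ee sg(1) by (auto simp: inj_def)
    also have "e (\<sigma> i) * \<alpha> i = \<alpha> i" using ea[OF i] sg(3)[OF i False] by simp
    finally show ?thesis .
  qed auto
  have a0: "\<alpha> i = 0" if "\<not> i < n" for i using that by (simp add: \<alpha>_def)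
  have pe: "\<pi> * e i = \<alpha> i" for i
    by (cases "i < n") (simp_all add: \<pi>_def sum_distrib_right ae0 a0)
  have ep: "e (\<sigma> i) * \<pi> = \<alpha> i" for i
    by (cases "i < n") (simp_all add: \<pi>_def sum_distrib_left ea0 a0)
  have pie: "\<pi> ^ m * e i = e ((\<sigma> ^^ m) i) * \<pi> ^ m" for m i
  proof (induction m)
    case (Suc m)
    have "\<pi> ^ Suc m * e i = \<pi> * (\<pi> ^ m * e i)" by (simp add: mult.assoc)
    also have "\<dots> = e (\<sigma> ((\<sigma> ^^ m) i)) * \<pi> * \<pi> ^ m"
      using Suc pe ep by (simp flip: mult.assoc)
    finally show ?case by (simp add: mult.assoc)
  qed simp
  have sgm: "(\<sigma> ^^ m) i < n" if "i < n" for m i by (induction m) (use sg(2) that in auto)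
  have "\<exists>k. \<pi> ^ k * e i = 0" for i
  proof (cases "i < n")
    case i: True
    obtain r where r: "r > 0" "(\<sigma> ^^ r) i = i"
      using inj_finite_orbit_returns[OF sg(1,2) i] by blast
    \<comment> \<open>One turn around the cycle of \<open>i\<close> is a closed path. It lies in the
      local corner at \<open>e i\<close> and in the radical, hence it is nilpotent.\<close>
    define x where "x = \<pi> ^ r * e i"
    have "x = e i * \<pi> ^ r" using pie[of r i] r(2) by (simp add: x_def)
    moreover have "e i * (e i * \<pi> ^ r) = e i * \<pi> ^ r" using ee[of i i] by (simp flip: mult.assoc)
    ultimately have x: "e i * x = x" "x * e i = x" using ee[of i i]
      by (simp, simp add: x_def mult.assoc)
    obtain r' where r': "r = Suc r'" using r(1) by (cases r) auto
    have "x = \<pi> ^ r' * \<alpha> i" by (simp only: x_def r' power_Suc2 mult.assoc pe)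
    then have "x \<in> ?R i" using Ra[OF i] by simp
    then obtain m where m: "x ^ m = 0"
      using nilpotent_or_unit[OF pr[OF i] x] by (auto simp: max_sub_iff)
    have "x ^ k * e i = \<pi> ^ (r * k) * e i" for k
    proof (induction k)
      case (Suc k)
      have "x ^ Suc k * e i = x * (\<pi> ^ (r * k) * e i)" using Suc by (simp add: mult.assoc)
      also have "\<dots> = \<pi> ^ r * (e i * (x ^ k * e i))" using Suc by (simp add: x_def mult.assoc)
      also have "e i * (x ^ k * e i) = x ^ k * e i"
        using x(1) ee[of i i] by (cases k) (simp_all flip: mult.assoc)
      finally show ?case using Suc by (simp add: power_add flip: mult.assoc)
    qed simp
    then have "\<pi> ^ (r * m) * e i = 0" using m by (metis mult_zero_left)
    then show ?thesis by blast
  qed (use eo in auto)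
  then obtain k where k: "\<And>i. \<pi> ^ k i * e i = 0" by metis
  \<comment> \<open>Any common upper bound of the exponents \<open>k i\<close> would do.\<close>
  define N where "N = (\<Sum>i<n. k i)"
  have "\<pi> ^ N * e i = 0" for i
  proof (cases "i < n")
    case True
    then have "k i \<le> N" unfolding N_def by (intro member_le_sum) auto
    then have "\<pi> ^ N = \<pi> ^ (N - k i) * \<pi> ^ k i" by (simp flip: power_add)
    then show ?thesis using k by (simp add: mult.assoc)
  qed (use eo in auto)
  then have "\<pi> ^ N * (\<Sum>i<n. e i) = 0" by (simp only: sum_distrib_left) simp
  then have nil: "\<pi> ^ N = 0" using es by simp
  \<comment> \<open>The remainder divisible by \<open>\<pi> ^ m\<close> passes through the vertex
    \<open>(\<sigma> ^^ m) i\<close>; splitting off the scalar there raises the exponent by one. At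
    \<open>m = N\<close> the remainder is zero.\<close>
  have expand: "\<exists>c r. x = (\<Sum>t<m. sa (c t) (\<pi> ^ t * e i)) + r * \<pi> ^ m * e i"
    if i: "i < n" and x: "x * e i = x" for x i m
  proof (induction m)
    case 0
    show ?case using x by (intro exI[of _ "\<lambda>_. 0"] exI[of _ x]) simp
  next
    case (Suc m)
    then obtain c r where cr: "x = (\<Sum>t<m. sa (c t) (\<pi> ^ t * e i)) + r * \<pi> ^ m * e i" by blast
    let ?j = "(\<sigma> ^^ m) i"
    have "r * e ?j * e ?j = r * e ?j" using ee by (simp add: mult.assoc)
    from split[OF sgm[OF i] this] obtain d r'
      where d: "r * e ?j = sa d (e ?j) + r' * \<alpha> ?j" by blast
    have "r * \<pi> ^ m * e i = r * e ?j * \<pi> ^ m" by (simp add: pie mult.assoc)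
    also have "\<dots> = sa d (e ?j * \<pi> ^ m) + r' * (\<pi> * e ?j * \<pi> ^ m)"
      by (simp add: d distrib_right pe mult.assoc)
    also have "\<dots> = sa d (\<pi> ^ m * e i) + r' * \<pi> ^ Suc m * e i"
      by (simp add: pie mult.assoc)
    finally have "x = (\<Sum>t<Suc m. sa ((c(m := d)) t) (\<pi> ^ t * e i)) + r' * \<pi> ^ Suc m * e i"
      using cr by (simp add: add.assoc)
    then show ?case by blast
  qed
  have span: "\<exists>c. r = (\<Sum>i<n. \<Sum>t<N. sa (c i t) (\<pi> ^ t * e i))" for r
  proof -
    have "\<exists>c. r * e i = (\<Sum>t<N. sa (c t) (\<pi> ^ t * e i))" if "i < n" for i
      using expand[OF that, of "r * e i" N] ee nil by (auto simp: mult.assoc)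
    then obtain c where "\<And>i. i < n \<Longrightarrow> r * e i = (\<Sum>t<N. sa (c i t) (\<pi> ^ t * e i))" by metis
    moreover have "r = (\<Sum>i<n. r * e i)" using es by (simp flip: sum_distrib_left)
    ultimately show ?thesis by (intro exI[of _ c]) simp
  qed
  have "serial_algebra sa n e \<pi> \<sigma> N"
    by unfold_locales (use ee es e0 eo sg nil span pe ep in auto)
  then show ?thesis by blast
qed

section \<open>Chains and their submodules\<close>

lemma gen_least: "submod sm act L \<Longrightarrow> S \<subseteq> L \<Longrightarrow> gen sm act S \<subseteq> L"
  by (auto simp: gen_def)

lemma subset_gen: "S \<subseteq> gen sm act S"
  by (auto simp: gen_def)

lemma submod_gen: "submod sm act (gen sm act S)"
  unfolding submod_def gen_def by simp

lemma gen_submod: "submod sm act L \<Longrightarrow> gen sm act L = L"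
  using gen_least[of sm act L L] subset_gen[of L sm act] by simp

locale serial_module = serial_algebra sa n e \<pi> \<sigma> N
  for sa :: "'k::field \<Rightarrow> 'a::ring_1 \<Rightarrow> 'a" and n e \<pi> \<sigma> N +
  fixes sm :: "'k \<Rightarrow> 'm::ab_group_add \<Rightarrow> 'm" and act :: "'a \<Rightarrow> 'm \<Rightarrow> 'm" and M :: "'m set"
  assumes ismod: "is_module sa sm act M"
begin

lemma zero_in [simp]: "0 \<in> M"
  and add_in [simp]: "x \<in> M \<Longrightarrow> y \<in> M \<Longrightarrow> x + y \<in> M"
  and sm_in [simp]: "x \<in> M \<Longrightarrow> sm c x \<in> M"
  and act_in [simp]: "x \<in> M \<Longrightarrow> act a x \<in> M"
  and sm_add: "x \<in> M \<Longrightarrow> y \<in> M \<Longrightarrow> sm c (x + y) = sm c x + sm c y"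
  and sm_add_left: "x \<in> M \<Longrightarrow> sm (c + d) x = sm c x + sm d x"
  and sm_sm: "x \<in> M \<Longrightarrow> sm c (sm d x) = sm (c * d) x"
  and sm_1 [simp]: "x \<in> M \<Longrightarrow> sm 1 x = x"
  and act_add: "x \<in> M \<Longrightarrow> y \<in> M \<Longrightarrow> act a (x + y) = act a x + act a y"
  and act_add_left: "x \<in> M \<Longrightarrow> act (a + b) x = act a x + act b x"
  and act_mult: "x \<in> M \<Longrightarrow> act (a * b) x = act a (act b x)"
  and act_1 [simp]: "x \<in> M \<Longrightarrow> act 1 x = x"
  and act_sa: "x \<in> M \<Longrightarrow> act (sa c a) x = sm c (act a x)"
  and act_sm: "x \<in> M \<Longrightarrow> act a (sm c x) = sm c (act a x)"
  using ismod by (simp_all add: is_module_def)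

lemma sm_0_left [simp]: "x \<in> M \<Longrightarrow> sm 0 x = 0"
  using sm_add_left[of x 0 0] by simp

lemma sm_0 [simp]: "sm c 0 = 0"
  using sm_add[of 0 0 c] by simp

lemma act_0_left [simp]: "x \<in> M \<Longrightarrow> act 0 x = 0"
  using act_add_left[of x 0 0] by simp

lemma act_0 [simp]: "act a 0 = 0"
  using act_add[of 0 0 a] by simp

lemma sm_minus_1: "x \<in> M \<Longrightarrow> sm (- 1) x = - x"
  using sm_add_left[of x 1 "- 1"] by (simp add: minus_unique)

lemma sum_in [simp]: "(\<And>i. i \<in> I \<Longrightarrow> f i \<in> M) \<Longrightarrow> sum f I \<in> M"
  by (induction I rule: infinite_finite_induct) auto

lemma sm_sum: "(\<And>i. i \<in> I \<Longrightarrow> f i \<in> M) \<Longrightarrow> sm c (sum f I) = (\<Sum>i\<in>I. sm c (f i))"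
  by (induction I rule: infinite_finite_induct) (auto simp: sm_add)

lemma act_sum: "(\<And>i. i \<in> I \<Longrightarrow> f i \<in> M) \<Longrightarrow> act a (sum f I) = (\<Sum>i\<in>I. act a (f i))"
  by (induction I rule: infinite_finite_induct) (auto simp: act_add)

lemma act_sum_left: "x \<in> M \<Longrightarrow> act (sum c I) x = (\<Sum>i\<in>I. act (c i) x)"
  by (induction I rule: infinite_finite_induct) (auto simp: act_add_left)

lemma sm_eq_0: "x \<in> M \<Longrightarrow> sm c x = 0 \<Longrightarrow> c = 0 \<or> x = 0"
  using sm_sm[of x "inverse c" c] by (cases "c = 0") auto

section \<open>Powers of \<open>\<pi>\<close> and homogeneous elements\<close>

definition pw :: "nat \<Rightarrow> 'm \<Rightarrow> 'm" where
  "pw k x = act (\<pi> ^ k) x"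

lemma pw_in [simp]: "x \<in> M \<Longrightarrow> pw k x \<in> M"
  and pw_0 [simp]: "x \<in> M \<Longrightarrow> pw 0 x = x"
  and pw_zero [simp]: "pw k 0 = 0"
  and pw_add: "x \<in> M \<Longrightarrow> y \<in> M \<Longrightarrow> pw k (x + y) = pw k x + pw k y"
  and pw_sm: "x \<in> M \<Longrightarrow> pw k (sm c x) = sm c (pw k x)"
  and pw_sum: "(\<And>i. i \<in> I \<Longrightarrow> f i \<in> M) \<Longrightarrow> pw k (sum f I) = (\<Sum>i\<in>I. pw k (f i))"
  and pw_pw: "x \<in> M \<Longrightarrow> pw k (pw l x) = pw (k + l) x"
  by (simp_all add: pw_def act_add act_sm act_sum power_add act_mult)

lemma pw_nilpotent: "x \<in> M \<Longrightarrow> k \<ge> N \<Longrightarrow> pw k x = 0"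
  by (metis act_0_left le_add_diff_inverse mult_zero_left pi_nilpotent power_add pw_def)

lemma pi_power_e: "\<pi> ^ k * e i = e ((\<sigma> ^^ k) i) * \<pi> ^ k"
proof (induction k)
  case (Suc k)
  have "\<pi> ^ Suc k * e i = \<pi> * e ((\<sigma> ^^ k) i) * \<pi> ^ k"
    using Suc by (simp add: mult.assoc)
  then show ?case by (simp add: pi_e mult.assoc)
qed simp

lemma e_pw: "x \<in> M \<Longrightarrow> act (e ((\<sigma> ^^ k) i)) (pw k x) = pw k (act (e i) x)"
  by (simp add: pw_def pi_power_e flip: act_mult)

lemma e_e: "x \<in> M \<Longrightarrow> act (e i) (act (e j) x) = (if i = j then act (e i) x else 0)"
  by (simp add: e_mult flip: act_mult)

lemma sum_e: "x \<in> M \<Longrightarrow> (\<Sum>i<n. act (e i) x) = x"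
  by (simp add: e_sum flip: act_sum_left)

lemma sigma_power_inj: "(\<sigma> ^^ k) i = (\<sigma> ^^ k) j \<longleftrightarrow> i = j"
  using inj_fn[OF sigma_inj, of k] by (simp add: inj_eq)

text \<open>Homogeneity, not a homomorphism: \<open>x\<close> has degree \<open>h\<close> in the
  grading by the idempotents, and zero has every degree.\<close>

definition hom :: "nat \<Rightarrow> 'm \<Rightarrow> bool" where
  "hom h x \<longleftrightarrow> x \<in> M \<and> act (e h) x = x"

lemma hom_in [simp]: "hom h x \<Longrightarrow> x \<in> M"
  by (simp add: hom_def)

lemma hom_e: "hom h x \<Longrightarrow> act (e i) x = (if i = h then x else 0)"
  using e_e[of x i h] by (auto simp: hom_def)

lemma hom_pw: "hom h x \<Longrightarrow> hom ((\<sigma> ^^ k) h) (pw k x)"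
  by (simp add: hom_def e_pw)

lemma hom_act_e: "x \<in> M \<Longrightarrow> hom h (act (e h) x)"
  by (simp add: hom_def e_e)

text \<open>The coefficients depend on \<open>r\<close> only. One expansion therefore serves several
  elements at once, as is needed for graphs of isomorphisms and for endomorphisms.\<close>

lemma act_expand:
  "\<exists>c. \<forall>x\<in>M. act r x = (\<Sum>i<n. \<Sum>t<N. sm (c i t) (pw t (act (e i) x)))"
proof -
  obtain c where c: "r = (\<Sum>i<n. \<Sum>t<N. sa (c i t) (\<pi> ^ t * e i))" using spanning by blast
  have "act r x = (\<Sum>i<n. \<Sum>t<N. sm (c i t) (pw t (act (e i) x)))" if "x \<in> M" for x
    using that by (simp add: c act_sum_left act_sa act_mult pw_def)
  then show ?thesis by blast
qed

lemma sub_sum: "submod sm act L \<Longrightarrow> (\<And>i. i \<in> I \<Longrightarrow> f i \<in> L) \<Longrightarrow> sum f I \<in> L"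
  by (induction I rule: infinite_finite_induct) (auto simp: submod_def)

lemma sub_pw: "submod sm act L \<Longrightarrow> x \<in> L \<Longrightarrow> pw k x \<in> L"
  by (simp add: submod_def pw_def)

lemma sub_sm: "submod sm act L \<Longrightarrow> x \<in> L \<Longrightarrow> sm c x \<in> L"
  and sub_act: "submod sm act L \<Longrightarrow> x \<in> L \<Longrightarrow> act r x \<in> L"
  and sub_add: "submod sm act L \<Longrightarrow> x \<in> L \<Longrightarrow> y \<in> L \<Longrightarrow> x + y \<in> L"
  and sub_diff: "submod sm act L \<Longrightarrow> x \<in> L \<Longrightarrow> y \<in> L \<Longrightarrow> x - y \<in> L"
  and sub_0: "submod sm act L \<Longrightarrow> 0 \<in> L"
  by (simp_all add: submod_def)

lemma submodI:
  assumes L: "L \<subseteq> M" and "0 \<in> L" and add: "\<And>x y. x \<in> L \<Longrightarrow> y \<in> L \<Longrightarrow> x + y \<in> L"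
    and smL: "\<And>c x. x \<in> L \<Longrightarrow> sm c x \<in> L" and "\<And>k x. x \<in> L \<Longrightarrow> pw k x \<in> L"
    and "\<And>i x. x \<in> L \<Longrightarrow> act (e i) x \<in> L"
  shows "submod sm act L"
  unfolding submod_def
proof (intro conjI ballI allI)
  fix x y assume xy: "x \<in> L" "y \<in> L"
  then show "x + y \<in> L" by (rule add)
  have "- y \<in> L" using smL[OF xy(2), of "- 1"] xy L by (auto simp: sm_minus_1)
  then show "x - y \<in> L" using add[OF xy(1)] by fastforce
next
  fix r x assume x: "x \<in> L"
  have sum: "sum f I \<in> L" if "\<And>i. i \<in> I \<Longrightarrow> f i \<in> L" for f :: "nat \<Rightarrow> 'm" and I
    using that by (induction I rule: infinite_finite_induct) (auto simp: assms(2) add)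
  obtain c where "\<forall>x\<in>M. act r x = (\<Sum>i<n. \<Sum>t<N. sm (c i t) (pw t (act (e i) x)))"
    using act_expand by blast
  then have eq: "act r x = (\<Sum>i<n. \<Sum>t<N. sm (c i t) (pw t (act (e i) x)))" using x L by blast
  show "act r x \<in> L" unfolding eq by (intro sum smL assms x)
qed (use assms in auto)

section \<open>Linear combinations along a chain\<close>

definition lc :: "'m \<Rightarrow> nat \<Rightarrow> (nat \<Rightarrow> 'k) \<Rightarrow> 'm" where
  "lc x a c = (\<Sum>t<a. sm (c t) (pw t x))"

lemma lc_in [simp]: "x \<in> M \<Longrightarrow> lc x a c \<in> M"
  by (simp add: lc_def)

lemma lc_cong: "(\<And>t. t < a \<Longrightarrow> c t = d t) \<Longrightarrow> lc x a c = lc x a d"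
  by (simp add: lc_def)

lemma lc_add: "x \<in> M \<Longrightarrow> lc x a c + lc x a d = lc x a (\<lambda>t. c t + d t)"
  by (simp add: lc_def sm_add_left sum.distrib)

lemma lc_sm: "x \<in> M \<Longrightarrow> sm b (lc x a c) = lc x a (\<lambda>t. b * c t)"
  by (simp add: lc_def sm_sum sm_sm)

lemma lc_zero [simp]: "x \<in> M \<Longrightarrow> lc x a (\<lambda>t. 0) = 0"
  by (simp add: lc_def)

lemma lc_single: "x \<in> M \<Longrightarrow> k < a \<Longrightarrow> lc x a (\<lambda>t. if t = k then b else 0) = sm b (pw k x)"
  unfolding lc_def by (subst sum.remove[of _ k]) (auto intro!: sum.neutral)

lemma lc_e: "hom h x \<Longrightarrow> act (e i) (lc x a c) = lc x a (\<lambda>t. if (\<sigma> ^^ t) h = i then c t else 0)"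
  unfolding lc_def by (subst act_sum) (auto simp: act_sm hom_e[OF hom_pw] intro!: sum.cong)

lemma lc_diff: "x \<in> M \<Longrightarrow> lc x a c - lc x a d = lc x a (\<lambda>t. c t - d t)"
  using lc_add[of x a "\<lambda>t. c t - d t" d] by (simp add: algebra_simps)

definition chain :: "'m \<Rightarrow> nat \<Rightarrow> nat \<Rightarrow> bool" where
  "chain x h a \<longleftrightarrow> hom h x \<and> (\<forall>k. pw k x = 0 \<longleftrightarrow> a \<le> k)"

lemma chain_hom [simp]: "chain x h a \<Longrightarrow> hom h x"
  and chain_in [simp]: "chain x h a \<Longrightarrow> x \<in> M"
  and chain_pw: "chain x h a \<Longrightarrow> pw k x = 0 \<longleftrightarrow> a \<le> k"
  and chain_pw_0: "chain x h a \<Longrightarrow> a \<le> k \<Longrightarrow> pw k x = 0"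
  by (auto simp: chain_def)

lemma chain_exists: "hom h x \<Longrightarrow> \<exists>a. chain x h a"
proof -
  assume x: "hom h x"
  define a where "a = (LEAST k. pw k x = 0)"
  have a: "pw a x = 0" unfolding a_def
    by (rule LeastI[of _ N]) (use x in \<open>simp add: pw_nilpotent\<close>)
  have "pw k x = 0 \<longleftrightarrow> a \<le> k" for k
  proof
    assume "a \<le> k"
    then have "pw k x = pw (k - a) (pw a x)" using x by (simp add: pw_pw)
    then show "pw k x = 0" using a by simp
  qed (simp add: a_def Least_le)
  then show ?thesis using x by (auto simp: chain_def)
qed

lemma lc_pw:
  assumes "chain x h a"
  shows "pw k (lc x a c) = lc x a (\<lambda>t. if t < k then 0 else c (t - k))"
proof -
  have x: "x \<in> M" using assms by simp
  have "pw k (lc x a c) = (\<Sum>t<a. sm (c t) (pw (k + t) x))"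
    using x by (simp add: lc_def pw_sum pw_sm pw_pw)
  also have "\<dots> = (\<Sum>t\<in>{t. t < a \<and> k + t < a}. sm (c t) (pw (k + t) x))"
  proof (rule sum.mono_neutral_right)
    show "\<forall>t\<in>{..<a} - {t. t < a \<and> k + t < a}. sm (c t) (pw (k + t) x) = 0"
    proof
      fix t assume "t \<in> {..<a} - {t. t < a \<and> k + t < a}"
      then have "a \<le> k + t" by auto
      then show "sm (c t) (pw (k + t) x) = 0" by (simp add: chain_pw_0[OF assms])
    qed
  qed auto
  also have "\<dots> = (\<Sum>t\<in>{k..<a}. sm (c (t - k)) (pw t x))"
    by (rule sum.reindex_bij_witness[of _ "\<lambda>t. t - k" "\<lambda>t. k + t"]) auto
  also have "\<dots> = (\<Sum>t\<in>{k..<a}. sm (if t < k then 0 else c (t - k)) (pw t x))"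
    by (rule sum.cong) auto
  also have "\<dots> = (\<Sum>t<a. sm (if t < k then 0 else c (t - k)) (pw t x))"
    by (rule sum.mono_neutral_left) (use x in auto)
  finally show ?thesis by (simp add: lc_def)
qed

text \<open>Applying \<open>\<pi>\<close> to the power \<open>a - 1 - k\<close> moves the lowest
  term onto the socle element and pushes all higher ones past the end.\<close>

lemma lc_top:
  assumes "chain x h a" "k < a" "\<And>t. t < k \<Longrightarrow> c t = 0"
  shows "pw (a - 1 - k) (lc x a c) = sm (c k) (pw (a - 1) x)"
proof -
  have "pw (a - 1 - k) (lc x a c) = lc x a (\<lambda>t. if t = a - 1 then c k else 0)"
    unfolding lc_pw[OF assms(1)]
  proof (rule lc_cong)
    fix t assume "t < a"
    then consider "t < a - 1 - k" | "t \<ge> a - 1 - k" "t < a - 1" | "t = a - 1" by linarith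
    then show "(if t < a - 1 - k then 0 else c (t - (a - 1 - k))) = (if t = a - 1 then c k else 0)"
    proof cases
      case 2
      then have "t - (a - 1 - k) < k" by linarith
      with 2 show ?thesis using assms(3) by simp
    next
      case 3
      then have "t - (a - 1 - k) = k" using assms(2) by linarith
      with 3 show ?thesis by simp
    qed simp
  qed
  then show ?thesis using lc_single[of x "a - 1" a "c k"] assms by simp
qed

text \<open>The lowest nonzero coefficient, moved to the socle by \<open>lc_top\<close>, would give
  a nonzero multiple of a nonzero element.\<close>

lemma lc_eq_0:
  assumes "chain x h a" "lc x a c = 0" "t < a"
  shows "c t = 0"
proof (rule ccontr)
  assume "c t \<noteq> 0"
  define k where "k = (LEAST t. c t \<noteq> 0)"
  have k: "c k \<noteq> 0" unfolding k_def by (rule LeastI[of _ t]) fact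
  have "k \<le> t" unfolding k_def by (rule Least_le) fact
  then have "k < a" using assms by simp
  have "c s = 0" if "s < k" for s
    using not_less_Least[of s "\<lambda>t. c t \<noteq> 0"] that by (simp add: k_def)
  then have "sm (c k) (pw (a - 1) x) = pw (a - 1 - k) (lc x a c)"
    using lc_top[OF assms(1) \<open>k < a\<close>, of c] by simp
  then have "sm (c k) (pw (a - 1) x) = 0" using assms(2) by simp
  then have "pw (a - 1) x = 0" using sm_eq_0[of "pw (a - 1) x" "c k"] k assms(1) by auto
  then show False using chain_pw[OF assms(1)] \<open>k < a\<close> by simp
qed

lemma lc_eq_iff:
  assumes "chain x h a"
  shows "lc x a c = lc x a d \<longleftrightarrow> (\<forall>t<a. c t = d t)"
proof
  assume "lc x a c = lc x a d"
  then have "lc x a (\<lambda>t. c t - d t) = 0" using assms by (simp flip: lc_diff)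
  then have "c t - d t = 0" if "t < a" for t by (rule lc_eq_0[OF assms]) fact
  then show "\<forall>t<a. c t = d t" by simp
qed (rule lc_cong, blast)

text \<open>For a chain this is the submodule generated by \<open>pw k x\<close>: everything for
  \<open>k = 0\<close>, zero for \<open>k = a\<close>. Describing it by coefficients makes
  membership a condition on them.\<close>

definition W :: "'m \<Rightarrow> nat \<Rightarrow> nat \<Rightarrow> 'm set" where
  "W x a k = {lc x a c |c. \<forall>t<k. c t = 0}"

lemma W_I: "(\<And>t. t < k \<Longrightarrow> c t = 0) \<Longrightarrow> lc x a c \<in> W x a k"
  by (auto simp: W_def)

lemma lc_in_W_iff:
  assumes "chain x h a" "k \<le> a"
  shows "lc x a c \<in> W x a k \<longleftrightarrow> (\<forall>t<k. c t = 0)"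
proof
  assume "lc x a c \<in> W x a k"
  then obtain d where d: "lc x a c = lc x a d" "\<forall>t<k. d t = 0" by (auto simp: W_def)
  have "\<forall>t<a. c t = d t" using d(1) lc_eq_iff[OF assms(1)] by blast
  then show "\<forall>t<k. c t = 0" using d(2) assms(2) by simp
qed (rule W_I, blast)

lemma W_subset: "chain x h a \<Longrightarrow> W x a k \<subseteq> M"
  by (auto simp: W_def)

lemma submod_W:
  assumes ch: "chain x h a"
  shows "submod sm act (W x a k)"
proof (rule submodI[OF W_subset[OF ch]])
  have x: "x \<in> M" using ch by simp
  have "lc x a (\<lambda>t. 0) \<in> W x a k" by (rule W_I) simp
  then show "0 \<in> W x a k" using x by simp
  fix u assume "u \<in> W x a k"
  then obtain c where c: "u = lc x a c" "\<forall>t<k. c t = 0" by (auto simp: W_def)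
  show "sm b u \<in> W x a k" for b using x c by (auto simp: lc_sm intro!: W_I)
  show "pw l u \<in> W x a k" for l using c by (auto simp: lc_pw[OF ch] intro!: W_I)
  show "act (e i) u \<in> W x a k" for i using c ch by (auto simp: lc_e[of h] intro!: W_I)
  fix v assume "v \<in> W x a k"
  then obtain d where d: "v = lc x a d" "\<forall>t<k. d t = 0" by (auto simp: W_def)
  show "u + v \<in> W x a k" using x c d by (auto simp: lc_add intro!: W_I)
qed

lemma pw_in_W:
  assumes "chain x h a" "k \<le> t"
  shows "pw t x \<in> W x a k"
proof (cases "t < a")
  case True
  then have "pw t x = lc x a (\<lambda>s. if s = t then 1 else 0)" using assms by (simp add: lc_single)
  then show ?thesis using assms by (auto intro!: W_I)
next
  case False
  then show ?thesis using chain_pw_0[OF assms(1), of t] sub_0[OF submod_W[OF assms(1)]] by simp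
qed

text \<open>Powers of \<open>\<pi>\<close> shift the leading term of the given element to every
  position from \<open>k\<close> on. By induction from the end of the chain, the tail behind the
  shifted leading term is already in \<open>L\<close> and can be subtracted.\<close>

lemma W_least:
  assumes ch: "chain x h a" and L: "submod sm act L" and c: "lc x a c \<in> L" "k < a" "c k \<noteq> 0"
    "\<And>t. t < k \<Longrightarrow> c t = 0"
  shows "W x a k \<subseteq> L"
proof -
  have x: "x \<in> M" using ch by simp
  have pwL: "pw t x \<in> L" if "t \<ge> k" for t
    using that
  proof (induction "a - t" arbitrary: t rule: less_induct)
    case less
    show ?case
    proof (cases "t < a")
      case False
      then show ?thesis using chain_pw_0[OF ch, of t] sub_0[OF L] by simp
    next
      case True
      let ?d = "\<lambda>s. if s < t - k then 0 else c (s - (t - k))"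
      have d0: "?d s = 0" if "s < t" for s using that c(4) less.prems by auto
      have dt: "?d t = c k" using less.prems by auto
      have "pw (t - k) (lc x a c) \<in> L" using sub_pw[OF L c(1)] .
      then have 1: "lc x a ?d \<in> L" by (simp only: lc_pw[OF ch])
      have "lc x a ?d = sm (?d t) (pw t x) + (\<Sum>s\<in>{..<a} - {t}. sm (?d s) (pw s x))"
        unfolding lc_def using True by (subst sum.remove[of _ t]) auto
      moreover have "(\<Sum>s\<in>{..<a} - {t}. sm (?d s) (pw s x)) \<in> L"
      proof (rule sub_sum[OF L])
        fix s assume s: "s \<in> {..<a} - {t}"
        show "sm (?d s) (pw s x) \<in> L"
        proof (cases "s < t")
          case True
          then show ?thesis using d0[OF True] x sub_0[OF L] by simp
        next
          case False
          then have "pw s x \<in> L" using less s by auto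
          then show ?thesis by (rule sub_sm[OF L])
        qed
      qed
      ultimately have "sm (c k) (pw t x) \<in> L" using 1 sub_diff[OF L 1] dt by fastforce
      then have "sm (inverse (c k)) (sm (c k) (pw t x)) \<in> L" by (rule sub_sm[OF L])
      then show ?thesis using c(3) x by (simp add: sm_sm)
    qed
  qed
  show ?thesis
  proof
    fix u assume "u \<in> W x a k"
    then obtain d where d: "u = lc x a d" "\<forall>t<k. d t = 0" by (auto simp: W_def)
    have "sm (d t) (pw t x) \<in> L" for t
      using d(2) pwL[of t] sub_sm[OF L] sub_0[OF L] x by (cases "t < k") auto
    then show "u \<in> L" unfolding d(1) lc_def by (intro sub_sum[OF L])
  qed
qed

lemma W_length [simp]: "chain x h a \<Longrightarrow> W x a a = {0}"
proof -
  assume ch: "chain x h a"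
  have "u = 0" if u: "u \<in> W x a a" for u
  proof -
    obtain c where "u = lc x a c" "\<forall>t<a. c t = 0" using u by (auto simp: W_def)
    then show ?thesis using ch by (simp add: lc_def)
  qed
  then show "W x a a = {0}" using sub_0[OF submod_W[OF ch]] by blast
qed

lemma W_antimono: "k \<le> l \<Longrightarrow> W x a l \<subseteq> W x a k"
  by (auto simp: W_def)

lemma W_subset_iff:
  assumes "chain x h a" "k \<le> a" "l \<le> a"
  shows "W x a l \<subseteq> W x a k \<longleftrightarrow> k \<le> l"
proof
  assume s: "W x a l \<subseteq> W x a k"
  show "k \<le> l"
  proof (rule ccontr)
    assume "\<not> k \<le> l"
    then have l: "l < k" by simp
    have "lc x a (\<lambda>t. if t = l then 1 else 0) \<in> W x a l" by (rule W_I) simp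
    then have "lc x a (\<lambda>t. if t = l then 1 else 0) \<in> W x a k" using s by blast
    then show False using lc_in_W_iff[OF assms(1,2)] l by fastforce
  qed
qed (rule W_antimono)

lemma W_eq_iff: "chain x h a \<Longrightarrow> k \<le> a \<Longrightarrow> l \<le> a \<Longrightarrow> W x a l = W x a k \<longleftrightarrow> k = l"
  by (metis W_subset_iff order_antisym order_refl)

text \<open>Chains are uniserial: a submodule is determined by the lowest position at which one of
  its elements has a nonzero coefficient.\<close>

lemma submod_chain_cases:
  assumes ch: "chain x h a" and L: "submod sm act L" "L \<subseteq> W x a 0"
  shows "\<exists>k\<le>a. L = W x a k"
proof (cases "\<exists>k<a. \<exists>c. lc x a c \<in> L \<and> c k \<noteq> 0")
  case False
  have "u = 0" if u: "u \<in> L" for u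
  proof -
    obtain c where c: "u = lc x a c" using L(2) u by (auto simp: W_def)
    with False u have "\<forall>t<a. c t = 0" by blast
    then have "lc x a c = lc x a (\<lambda>t. 0)" by (intro lc_cong) simp
    then show ?thesis using c ch by simp
  qed
  then have "L = {0}" using sub_0[OF L(1)] by blast
  then show ?thesis using ch by (intro exI[of _ a]) simp
next
  case True
  define Q where "Q k \<longleftrightarrow> k < a \<and> (\<exists>c. lc x a c \<in> L \<and> c k \<noteq> 0)" for k
  define k where "k = (LEAST k. Q k)"
  have "\<exists>k. Q k" using True by (auto simp: Q_def)
  then have "Q k" unfolding k_def by (rule LeastI_ex)
  then obtain c where k: "k < a" and c: "lc x a c \<in> L" "c k \<noteq> 0" by (auto simp: Q_def)
  have z: "d t = 0" if "lc x a d \<in> L" "t < k" for d t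
    using not_less_Least[of t Q] that k by (auto simp: k_def Q_def)
  have "W x a k \<subseteq> L" using W_least[OF ch L(1) c(1) k c(2)] z[OF c(1)] by blast
  moreover have "L \<subseteq> W x a k"
  proof
    fix u assume "u \<in> L"
    moreover obtain d where "u = lc x a d" using L(2) \<open>u \<in> L\<close> by (auto simp: W_def)
    ultimately show "u \<in> W x a k" using z by (auto intro!: W_I)
  qed
  ultimately show ?thesis using k by (intro exI[of _ k]) auto
qed

end

section \<open>Radical, socle series and composition factors of chains\<close>

context serial_algebra
begin

text \<open>\<open>\<pi>\<close> moves past every idempotent at the cost of applying
  \<open>\<sigma>\<close>. Hence its left multiples form a two-sided ideal, which inherits
  nilpotency from \<open>\<pi>\<close>.\<close>

lemma pi_mult: "\<exists>r'. \<pi> * r = r' * \<pi>"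
proof -
  obtain c where c: "r = (\<Sum>i<n. \<Sum>t<N. sa (c i t) (\<pi> ^ t * e i))" using spanning by blast
  have "\<pi> * (\<pi> ^ t * e i) = \<pi> ^ t * e (\<sigma> i) * \<pi>" for t i
  proof -
    have "\<pi> * (\<pi> ^ t * e i) = \<pi> ^ t * (\<pi> * e i)"
      by (simp only: mult.assoc[symmetric] power_commutes)
    then show ?thesis by (simp only: pi_e mult.assoc)
  qed
  then have "\<pi> * r = (\<Sum>i<n. \<Sum>t<N. sa (c i t) (\<pi> ^ t * e (\<sigma> i))) * \<pi>"
    by (simp add: c sum_distrib_left sum_distrib_right)
  then show ?thesis by blast
qed

lemma pi_power_mult: "\<exists>r'. \<pi> ^ k * r = r' * \<pi> ^ k"
proof (induction k arbitrary: r)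
  case 0
  show ?case by (intro exI[of _ r]) simp
next
  case (Suc k)
  obtain r1 where "\<pi> * r = r1 * \<pi>" using pi_mult by blast
  moreover obtain r2 where "\<pi> ^ k * r1 = r2 * \<pi> ^ k" using Suc by blast
  ultimately have "\<pi> ^ Suc k * r = r2 * \<pi> ^ Suc k"
    by (metis mult.assoc power_Suc2)
  then show ?case by blast
qed

lemma pi_ideal_power: "\<exists>r'. (r * \<pi>) ^ k = r' * \<pi> ^ k"
proof (induction k)
  case 0
  show ?case by (intro exI[of _ 1]) simp
next
  case (Suc k)
  then obtain r1 where r1: "(r * \<pi>) ^ k = r1 * \<pi> ^ k" by blast
  obtain r2 where r2: "\<pi> ^ k * r = r2 * \<pi> ^ k" using pi_power_mult by blast
  have "(r * \<pi>) ^ Suc k = r1 * (\<pi> ^ k * r) * \<pi>" by (simp only: power_Suc2 r1 mult.assoc)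
  also have "\<dots> = (r1 * r2) * \<pi> ^ Suc k" by (simp only: r2 power_Suc2 mult.assoc)
  finally show ?case by blast
qed

lemma pi_ideal_nilpotent: "(r * \<pi>) ^ N = 0"
  using pi_ideal_power[of r N] pi_nilpotent by auto

lemma e_not_in_pi_ideal: "i < n \<Longrightarrow> e i \<noteq> r * \<pi>"
proof
  assume "i < n" "e i = r * \<pi>"
  have "e i ^ Suc k = e i" for k by (induction k) (simp_all add: e_mult)
  moreover have "e i ^ Suc N = 0"
    using pi_ideal_nilpotent[of r] \<open>e i = r * \<pi>\<close> by simp
  ultimately show False using e_nonzero \<open>i < n\<close> by simp
qed

lemma sum_in_pi_ideal:
  "(\<And>i. i \<in> I \<Longrightarrow> \<exists>r. f i = r * \<pi>) \<Longrightarrow> \<exists>r. sum f I = r * \<pi>"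
proof (induction I rule: infinite_finite_induct)
  case (insert i I)
  obtain r where "f i = r * \<pi>" using insert.prems[of i] by blast
  moreover obtain s where "sum f I = s * \<pi>" using insert.IH insert.prems by blast
  ultimately show ?case using insert by (intro exI[of _ "r + s"]) (simp add: distrib_right)
qed (auto intro: exI[of _ 0])

lemma mod_pi_ideal:
  assumes "i < n"
  shows "\<exists>c s. r * e i = sa c (e i) + s * \<pi>"
proof -
  obtain c where c: "r = (\<Sum>j<n. \<Sum>t<N. sa (c j t) (\<pi> ^ t * e j))" using spanning by blast
  have inner: "(\<Sum>t<N. sa (c j t) (\<pi> ^ t * e j)) * e i =
      (if j = i then \<Sum>t<N. sa (c j t) (\<pi> ^ t * e j) else 0)" for j
    by (simp add: sum_distrib_right mult.assoc e_mult)
  have "r * e i = (\<Sum>j<n. if j = i then \<Sum>t<N. sa (c j t) (\<pi> ^ t * e j) else 0)"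
    unfolding c by (subst sum_distrib_right) (rule sum.cong[OF refl inner])
  also have "\<dots> = (\<Sum>t<N. sa (c i t) (\<pi> ^ t * e i))" using assms by simp
  finally have r: "r * e i = (\<Sum>t<N. sa (c i t) (\<pi> ^ t * e i))" .
  have pos: "\<exists>s. sa (c i t) (\<pi> ^ t * e i) = s * \<pi>" if t0: "t \<noteq> 0" for t
  proof -
    obtain u where u: "t = Suc u" using t0 by (cases t) auto
    have "\<pi> ^ t * e i = \<pi> ^ u * e (\<sigma> i) * \<pi>" by (simp only: u power_Suc2 mult.assoc pi_e)
    then show ?thesis by (intro exI[of _ "sa (c i t) (\<pi> ^ u * e (\<sigma> i))"]) simp
  qed
  show ?thesis
  proof (cases N)
    \<comment> \<open>Exponent zero would make the algebra trivial; excluding it guarantees that the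
      term with \<open>t = 0\<close> is present.\<close>
    case 0
    then have "(1::'a) = 0" using pi_nilpotent by simp
    then have "e i = 0" by (metis mult_1 mult_zero_left)
    then show ?thesis using e_nonzero assms by simp
  next
    case (Suc N')
    have "\<exists>s. (\<Sum>t\<in>{..<N} - {0}. sa (c i t) (\<pi> ^ t * e i)) = s * \<pi>"
      by (rule sum_in_pi_ideal) (use pos in auto)
    then obtain s where "(\<Sum>t\<in>{..<N} - {0}. sa (c i t) (\<pi> ^ t * e i)) = s * \<pi>" by blast
    then have "r * e i = sa (c i 0) (e i) + s * \<pi>"
      unfolding r using Suc by (subst sum.remove[of _ 0]) auto
    then show ?thesis by blast
  qed
qed

theorem jac_eq: "jac sa = range (\<lambda>r. r * \<pi>)"
proof
  show "jac sa \<subseteq> range (\<lambda>r. r * \<pi>)"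
  proof
    fix x assume x: "x \<in> jac sa"
    have "\<exists>r. x * e i = r * \<pi>" if i: "i < n" for i
    proof -
      \<comment> \<open>The maximal left ideal belonging to the vertex \<open>i\<close>. The
        intersection of these ideals over all vertices already consists of left multiples of
        \<open>\<pi>\<close>.\<close>
      define L where "L = {r. \<exists>s. r * e i = s * \<pi>}"
      have LI: "r \<in> L" if "r * e i = s * \<pi>" for r s using that unfolding L_def by blast
      have L: "submod sa lmult L"
        unfolding submod_def
      proof (intro conjI ballI allI)
        show "0 \<in> L" by (rule LI[of _ 0]) simp
        fix u assume "u \<in> L"
        then obtain s where u: "u * e i = s * \<pi>" unfolding L_def by blast
        show "sa c u \<in> L" for c by (rule LI[of _ "sa c s"]) (simp add: u)
        show "a * u \<in> L" for a by (rule LI[of _ "a * s"]) (simp add: u mult.assoc)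
        fix v assume "v \<in> L"
        then obtain t where v: "v * e i = t * \<pi>" unfolding L_def by blast
        show "u + v \<in> L" by (rule LI[of _ "s + t"]) (simp add: u v distrib_right)
        show "u - v \<in> L" by (rule LI[of _ "s - t"]) (simp add: u v left_diff_distrib)
      qed
      have eL: "e i \<notin> L" using e_not_in_pi_ideal[OF i] by (auto simp: L_def e_mult)
      then have "L \<noteq> UNIV" by blast
      moreover have "\<not> (\<exists>L'. submod sa lmult L' \<and> L \<subset> L' \<and> L' \<noteq> UNIV)"
      proof
        assume "\<exists>L'. submod sa lmult L' \<and> L \<subset> L' \<and> L' \<noteq> UNIV"
        then obtain L' where L': "submod sa lmult L'" "L \<subseteq> L'" "L' \<noteq> UNIV"
          and "\<exists>r. r \<in> L' \<and> r \<notin> L" by blast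
        then obtain r where r: "r \<in> L'" "r \<notin> L" by blast
        have "(1 - e i) * e i = 0 * \<pi>" by (simp add: left_diff_distrib e_mult)
        then have 1: "1 - e i \<in> L'" using L'(2) unfolding L_def by blast
        have "r - r * (1 - e i) \<in> L'" using L'(1) r(1) 1 unfolding submod_def by blast
        moreover have "r - r * (1 - e i) = r * e i" by (simp add: right_diff_distrib)
        ultimately have re: "r * e i \<in> L'" by simp
        obtain c s where cs: "r * e i = sa c (e i) + s * \<pi>" using mod_pi_ideal[OF i] by blast
        have c: "c \<noteq> 0"
        proof
          assume "c = 0"
          then have "r \<in> L" using cs by (auto simp: L_def)
          then show False using r by simp
        qed
        have "s * \<pi> * e i = (s * e (\<sigma> i)) * \<pi>" by (simp add: mult.assoc pi_e)
        then have "s * \<pi> \<in> L'" using L'(2) unfolding L_def by blast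
        then have "r * e i - s * \<pi> \<in> L'" using L'(1) re unfolding submod_def by blast
        then have "sa c (e i) \<in> L'" using cs by simp
        then have "sa (inverse c) (sa c (e i)) \<in> L'" using L'(1) unfolding submod_def by blast
        then have "e i \<in> L'" using c by simp
        then have "e i + (1 - e i) \<in> L'" using L'(1) 1 unfolding submod_def by blast
        then have "1 \<in> L'" by simp
        then have "r * 1 \<in> L'" for r using L'(1) unfolding submod_def by blast
        then show False using L'(3) by auto
      qed
      ultimately have "x \<in> L" using x L unfolding jac_def by blast
      then show ?thesis unfolding L_def by blast
    qed
    then have "\<exists>r. (\<Sum>i<n. x * e i) = r * \<pi>" by (intro sum_in_pi_ideal) auto
    moreover have "(\<Sum>i<n. x * e i) = x" using e_sum by (simp flip: sum_distrib_left)
    ultimately show "x \<in> range (\<lambda>r. r * \<pi>)" by auto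
  qed
next
  show "range (\<lambda>r. r * \<pi>) \<subseteq> jac sa"
  proof -
    have "\<pi> \<in> L" if L: "submod sa lmult L" and ne: "L \<noteq> UNIV"
      and mx: "\<not> (\<exists>L'. submod sa lmult L' \<and> L \<subset> L' \<and> L' \<noteq> UNIV)" for L
    proof (rule ccontr)
      assume nin: "\<pi> \<notin> L"
      \<comment> \<open>Adding the multiples of \<open>\<pi>\<close> to a maximal left ideal without
        \<open>\<pi>\<close> gives everything. The ideal then contains some
        \<open>1 - r * \<pi>\<close>, which is invertible because \<open>r * \<pi>\<close> is
        nilpotent.\<close>
      define L' where "L' = {l + r * \<pi> |l r. l \<in> L}"
      have in': "l + r * \<pi> \<in> L'" if "l \<in> L" for l r using that by (auto simp: L'_def)
      have L0: "0 \<in> L" and Ladd: "\<And>x y. x \<in> L \<Longrightarrow> y \<in> L \<Longrightarrow> x + y \<in> L \<and> x - y \<in> L"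
        and Lsa: "\<And>c x. x \<in> L \<Longrightarrow> sa c x \<in> L" and Lm: "\<And>a x. x \<in> L \<Longrightarrow> a * x \<in> L"
        using L by (auto simp: submod_def)
      have "submod sa lmult L'"
        unfolding submod_def
      proof (intro conjI ballI allI)
        show "0 \<in> L'" using in'[OF L0, of 0] by simp
        fix u assume "u \<in> L'"
        then obtain l r where u: "u = l + r * \<pi>" "l \<in> L" by (auto simp: L'_def)
        show "sa c u \<in> L'" for c
          using in'[OF Lsa[OF u(2), of c], of "sa c r"] u by (simp add: scale_right_distrib)
        show "a * u \<in> L'" for a
          using in'[OF Lm[OF u(2), of a], of "a * r"] u by (simp add: distrib_left mult.assoc)
        fix v assume "v \<in> L'"
        then obtain l' r' where v: "v = l' + r' * \<pi>" "l' \<in> L" by (auto simp: L'_def)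
        show "u + v \<in> L'"
          using in'[of "l + l'" "r + r'"] Ladd[OF u(2) v(2)] u v by (simp add: algebra_simps)
        show "u - v \<in> L'"
          using in'[of "l - l'" "r - r'"] Ladd[OF u(2) v(2)] u v by (simp add: algebra_simps)
      qed
      moreover have "L \<subseteq> L'" using in'[of _ 0] by auto
      moreover have "\<pi> \<in> L'" using in'[OF L0, of 1] by simp
      ultimately have "L' = UNIV" using mx nin by blast
      then have "1 \<in> L'" by simp
      then obtain l r where lr: "1 = l + r * \<pi>" "l \<in> L" by (auto simp: L'_def)
      have "1 - r * \<pi> = l" unfolding lr(1) by simp
      then have "1 - r * \<pi> \<in> L" using lr(2) by simp
      then have "(\<Sum>k<N. (r * \<pi>) ^ k) * (1 - r * \<pi>) \<in> L" by (rule Lm)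
      then have "1 \<in> L" by (simp only: geometric_ring pi_ideal_nilpotent diff_zero)
      then have "x * 1 \<in> L" for x by (rule Lm)
      then show False using ne by auto
    qed
    then have "r * \<pi> \<in> L" if "submod sa lmult L" "L \<noteq> UNIV"
      "\<not> (\<exists>L'. submod sa lmult L' \<and> L \<subset> L' \<and> L' \<noteq> UNIV)" for L r
      using that unfolding submod_def by blast
    then show ?thesis unfolding jac_def by blast
  qed
qed

end

section \<open>Layers of a chain\<close>

context serial_module
begin

lemma W_psubset_iff:
  assumes "chain x h a" "k \<le> a" "l \<le> a"
  shows "W x a l \<subset> W x a k \<longleftrightarrow> k < l"
  using W_subset_iff[OF assms] W_eq_iff[OF assms] by (auto simp: psubset_eq)

lemma simple_sq_chain:
  assumes ch: "chain x h a" and U: "U \<subseteq> W x a 0"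
  shows "simple_sq sm act U V \<longleftrightarrow> (\<exists>k<a. U = W x a k \<and> V = W x a (Suc k))"
proof
  assume s: "simple_sq sm act U V"
  have sU: "submod sm act U" and sV: "submod sm act V" and VU: "V \<subset> U"
    and between: "\<And>L. submod sm act L \<Longrightarrow> V \<subset> L \<Longrightarrow> L \<subset> U \<Longrightarrow> False"
    using s unfolding simple_sq_def by blast+
  obtain k where k: "k \<le> a" "U = W x a k"
    using submod_chain_cases[OF ch sU U] by blast
  have "V \<subseteq> W x a 0" using VU U by blast
  then obtain l where l: "l \<le> a" "V = W x a l"
    using submod_chain_cases[OF ch sV] by blast
  have kl: "k < l" using VU W_psubset_iff[OF ch k(1) l(1)] unfolding k(2) l(2) by blast
  have "l = Suc k"
  proof (rule ccontr)
    assume "l \<noteq> Suc k"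
    then have "V \<subset> W x a (Suc k)" "W x a (Suc k) \<subset> U"
      unfolding k(2) l(2) using W_psubset_iff[OF ch] k(1) l(1) kl by simp_all
    then show False by (rule between[OF submod_W[OF ch]])
  qed
  then show "\<exists>k<a. U = W x a k \<and> V = W x a (Suc k)" using k l by (intro exI[of _ k]) auto
next
  assume "\<exists>k<a. U = W x a k \<and> V = W x a (Suc k)"
  then obtain k where k: "k < a" "U = W x a k" "V = W x a (Suc k)" by blast
  have "\<not> (V \<subset> L \<and> L \<subset> U)" if L: "submod sm act L" for L
  proof
    assume VLU: "V \<subset> L \<and> L \<subset> U"
    then have "L \<subseteq> W x a 0" using U by blast
    then obtain j where j: "j \<le> a" "L = W x a j" using submod_chain_cases[OF ch L] by blast
    have "j < Suc k" using VLU W_psubset_iff[OF ch j(1), of "Suc k"] k(1) unfolding j(2) k(3) by simp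
    moreover have "k < j" using VLU W_psubset_iff[OF ch _ j(1), of k] k(1) unfolding j(2) k(2) by simp
    ultimately show False by simp
  qed
  then show "simple_sq sm act U V"
    using k W_psubset_iff[OF ch, of k "Suc k"] submod_W[OF ch] unfolding simple_sq_def by auto
qed

text \<open>Each step adds one position, counted from the end of the chain. Truncated subtraction
  lets the formula cover the indices beyond the length, where the series is stationary.\<close>

lemma soc_ser_chain:
  assumes ch: "chain x h a"
  shows "soc_ser sm act (W x a 0) l = W x a (a - l)"
proof (induction l)
  case (Suc l)
  let ?F = "{U. U \<subseteq> W x a 0 \<and> simple_sq sm act U (W x a (a - l))}"
  have step: "soc_ser sm act (W x a 0) (Suc l) = gen sm act (W x a (a - l) \<union> \<Union>?F)"
    by (simp only: soc_ser.simps Suc)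
  show ?case
  proof (cases "a - l")
    case 0
    have F: "?F = {}"
    proof -
      have False if U: "U \<subseteq> W x a 0" and s: "simple_sq sm act U (W x a (a - l))" for U
      proof -
        obtain k where "k < a" "W x a (a - l) = W x a (Suc k)"
          using simple_sq_chain[OF ch U] s by blast
        then show False using W_eq_iff[OF ch, of "Suc k" 0] 0 by simp
      qed
      then show ?thesis by blast
    qed
    have "a - Suc l = 0" using 0 by simp
    then show ?thesis unfolding step F using 0 gen_submod[OF submod_W[OF ch]] by simp
  next
    case (Suc k)
    have ka: "k < a" using Suc by linarith
    have F: "?F = {W x a k}"
    proof (rule set_eqI)
      fix U
      show "U \<in> ?F \<longleftrightarrow> U \<in> {W x a k}"
      proof
        assume U: "U \<in> ?F"
        then obtain j where j: "j < a" "U = W x a j" "W x a (a - l) = W x a (Suc j)"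
          using simple_sq_chain[OF ch] by blast
        then have "j = k" using W_eq_iff[OF ch, of "Suc j" "Suc k"] Suc ka by simp
        then show "U \<in> {W x a k}" using j by simp
      next
        assume "U \<in> {W x a k}"
        then show "U \<in> ?F"
          using simple_sq_chain[OF ch, of U "W x a (a - l)"] ka Suc W_antimono[of 0 k x a] by auto
      qed
    qed
    have "W x a (a - l) \<union> W x a k = W x a k" using W_antimono[of k "a - l"] Suc by auto
    moreover have "a - Suc l = k" using Suc by simp
    ultimately show ?thesis unfolding step F using gen_submod[OF submod_W[OF ch]] by simp
  qed
qed (use ch in simp)

lemma loewy_chain:
  assumes ch: "chain x h a"
  shows "loewy_length sm act (W x a 0) = a"
proof -
  have "soc_ser sm act (W x a 0) l = W x a 0 \<longleftrightarrow> a \<le> l" for l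
    using W_eq_iff[OF ch, of 0 "a - l"] by (simp add: soc_ser_chain[OF ch])
  then show ?thesis unfolding loewy_length_def by (simp add: Least_equality)
qed

text \<open>A chain has only one composition series, even as a list, so the arbitrary choice in
  \<open>mult\<close> is determined.\<close>

lemma comp_series_chain:
  assumes ch: "chain x h a" and k: "k \<le> a"
  shows "comp_series sm act (W x a k) cs \<longleftrightarrow> cs = map (\<lambda>i. W x a (a - i)) [0..<Suc (a - k)]"
proof
  assume cs: "comp_series sm act (W x a k) cs"
  then have ne: "cs \<noteq> []" and c0: "cs ! 0 = {0}" and cl: "last cs = W x a k"
    and step: "\<And>i. Suc i < length cs \<Longrightarrow> simple_sq sm act (cs ! Suc i) (cs ! i)"
    by (auto simp: comp_series_def)
  have mono: "cs ! i \<subseteq> cs ! (i + d)" if "i + d < length cs" for i d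
    using that
  proof (induction d)
    case (Suc d)
    then have "cs ! i \<subseteq> cs ! (i + d)" by simp
    also have "\<dots> \<subseteq> cs ! (i + Suc d)"
      using step[of "i + d"] Suc.prems by (auto simp: simple_sq_def)
    finally show ?case .
  qed simp
  have sub: "cs ! i \<subseteq> W x a 0" if "i < length cs" for i
  proof -
    have "cs ! i \<subseteq> cs ! (i + (length cs - 1 - i))" using that by (intro mono) simp
    also have "\<dots> = W x a k" using cl ne that by (simp add: last_conv_nth)
    also have "\<dots> \<subseteq> W x a 0" by (rule W_antimono) simp
    finally show ?thesis .
  qed
  have nth: "i \<le> a \<and> cs ! i = W x a (a - i)" if "i < length cs" for i
    using that
  proof (induction i)
    case 0
    then show ?case using c0 ch by simp
  next
    case (Suc i)
    then have IH: "i \<le> a" "cs ! i = W x a (a - i)" by auto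
    obtain j where j: "j < a" "cs ! Suc i = W x a j" "cs ! i = W x a (Suc j)"
      using step[OF Suc.prems] simple_sq_chain[OF ch sub[OF Suc.prems]] by blast
    then have "Suc j = a - i" using W_eq_iff[OF ch, of "Suc j" "a - i"] IH by simp
    then have "j = a - Suc i" "Suc i \<le> a" by auto
    then show ?case using j by simp
  qed
  have l: "length cs - 1 < length cs" using ne by simp
  have "W x a (a - (length cs - 1)) = W x a k"
    using nth[OF l] cl ne by (simp add: last_conv_nth)
  then have "a - (length cs - 1) = k" using W_eq_iff[OF ch, of k "a - (length cs - 1)"] k by simp
  then have len: "length cs = Suc (a - k)" using nth[OF l] l k by linarith
  show "cs = map (\<lambda>i. W x a (a - i)) [0..<Suc (a - k)]"
  proof (rule nth_equalityI)
    show "length cs = length (map (\<lambda>i. W x a (a - i)) [0..<Suc (a - k)])" by (simp add: len)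
    fix i assume i: "i < length cs"
    then have "i < Suc (a - k)" by (simp add: len)
    then have "map (\<lambda>i. W x a (a - i)) [0..<Suc (a - k)] ! i = W x a (a - i)"
      by (subst nth_map) (simp_all del: upt_Suc)
    then show "cs ! i = map (\<lambda>i. W x a (a - i)) [0..<Suc (a - k)] ! i" using nth[OF i] by simp
  qed
next
  assume cs: "cs = map (\<lambda>i. W x a (a - i)) [0..<Suc (a - k)]"
  have len: "length cs = Suc (a - k)" by (simp add: cs)
  have nth: "cs ! i = W x a (a - i)" if "i < Suc (a - k)" for i
    unfolding cs using that by (subst nth_map) (simp_all del: upt_Suc)
  have ne: "cs \<noteq> []" using len by auto
  show "comp_series sm act (W x a k) cs"
    unfolding comp_series_def
  proof (intro conjI allI impI)
    show "cs ! 0 = {0}" using nth[of 0] ch by simp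
    show "last cs = W x a k" using ne len nth[of "a - k"] k by (simp add: last_conv_nth)
    fix i assume "Suc i < length cs"
    then have i: "Suc i < Suc (a - k)" by (simp add: len)
    have ai: "a - i = Suc (a - Suc i)" "a - Suc i < a" using i by linarith+
    have "W x a (a - Suc i) \<subseteq> W x a 0" by (rule W_antimono) simp
    then have "simple_sq sm act (W x a (a - Suc i)) (W x a (Suc (a - Suc i)))"
      using simple_sq_chain[OF ch] ai(2) by blast
    then show "simple_sq sm act (cs ! Suc i) (cs ! i)"
      using nth[of i] nth[of "Suc i"] i ai(1) by simp
  qed (rule ne)
qed

lemma mult_chain:
  assumes ch: "chain x h a" and k: "k \<le> a"
  shows "mult sm act S (W x a k) =
    card {t. k \<le> t \<and> t < a \<and> sq_iso sm act (W x a t, W x a (Suc t)) S}"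
proof -
  let ?cs = "map (\<lambda>i. W x a (a - i)) [0..<Suc (a - k)]"
  have nth: "?cs ! i = W x a (a - i)" if "i < Suc (a - k)" for i
    using that by (subst nth_map) (simp_all del: upt_Suc)
  have "mult sm act S (W x a k) =
      card {i. Suc i < length ?cs \<and> sq_iso sm act (?cs ! Suc i, ?cs ! i) S}"
    by (simp only: mult_def comp_series_chain[OF assms] some_eq_trivial Let_def)
  also have "{i. Suc i < length ?cs \<and> sq_iso sm act (?cs ! Suc i, ?cs ! i) S} =
      {i. Suc i < Suc (a - k) \<and> sq_iso sm act (W x a (a - Suc i), W x a (a - i)) S}"
    using nth by (auto simp del: upt_Suc)
  also have "card \<dots> = card {t. k \<le> t \<and> t < a \<and> sq_iso sm act (W x a t, W x a (Suc t)) S}"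
  proof (rule bij_betw_same_card[of "\<lambda>i. a - Suc i"], rule bij_betw_byWitness[where f' = "\<lambda>t. a - Suc t"])
    let ?A = "{i. Suc i < Suc (a - k) \<and> sq_iso sm act (W x a (a - Suc i), W x a (a - i)) S}"
    let ?B = "{t. k \<le> t \<and> t < a \<and> sq_iso sm act (W x a t, W x a (Suc t)) S}"
    show "\<forall>i\<in>?A. a - Suc (a - Suc i) = i" "\<forall>i\<in>?B. a - Suc (a - Suc i) = i" by auto
    have "Suc (a - Suc i) = a - i" if "i < a - k" for i using that by linarith
    then show "(\<lambda>i. a - Suc i) ` ?A \<subseteq> ?B" by auto
    have "a - (a - Suc t) = Suc t" "a - Suc (a - Suc t) = t" if "t < a" for t using that by linarith+
    then show "(\<lambda>t. a - Suc t) ` ?B \<subseteq> ?A" by auto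
  qed
  finally show ?thesis .
qed

lemma rad_mod_chain:
  assumes ch: "chain x h a" and a: "a > 0"
  shows "rad_mod sa sm act (W x a 0) = W x a 1"
proof
  have x: "x \<in> M" using ch by simp
  let ?S = "{act r u |r u. r \<in> jac sa \<and> u \<in> W x a 0}"
  show "rad_mod sa sm act (W x a 0) \<subseteq> W x a 1"
    unfolding rad_mod_def
  proof (rule gen_least[OF submod_W[OF ch]], clarify)
    fix r u assume r: "r \<in> jac sa" and u: "u \<in> W x a 0"
    obtain s where s: "r = s * \<pi>" using r by (auto simp: jac_eq)
    obtain c where c: "u = lc x a c" using u by (auto simp: W_def)
    have "act r u = act s (pw 1 u)" using c x by (simp add: s act_mult pw_def)
    moreover have "pw 1 u \<in> W x a 1" unfolding c lc_pw[OF ch] by (rule W_I) simp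
    ultimately show "act r u \<in> W x a 1" using sub_act[OF submod_W[OF ch]] by simp
  qed
  have "\<pi> \<in> jac sa" unfolding jac_eq by (rule range_eqI[of _ _ 1]) simp
  moreover have "x \<in> W x a 0" using pw_in_W[OF ch, of 0 0] x by simp
  ultimately have "act \<pi> x \<in> ?S" by blast
  then have p: "pw 1 x \<in> gen sm act ?S" using subset_gen[of ?S sm act] by (auto simp: pw_def)
  show "W x a 1 \<subseteq> rad_mod sa sm act (W x a 0)"
  proof (cases "a = 1")
    case True
    then show ?thesis using ch sub_0[OF submod_gen] by (auto simp: rad_mod_def)
  next
    case False
    let ?c = "\<lambda>t. if t = 1 then 1 else (0::'k)"
    have "lc x a ?c = pw 1 x" using lc_single[OF x, of 1 a 1] False a x by simp
    then have "lc x a ?c \<in> gen sm act ?S" using p by simp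
    then show ?thesis unfolding rad_mod_def
      by (rule W_least[OF ch submod_gen]) (use False a in auto)
  qed
qed

text \<open>The counterpart of \<open>submodI\<close> for graphs of maps. It relies on
  \<open>act_expand\<close> giving both components the same coefficients.\<close>

lemma pair_act_closed:
  assumes G: "G \<subseteq> M \<times> M" "(0, 0) \<in> G"
    and add: "\<And>u v u' v'. (u, v) \<in> G \<Longrightarrow> (u', v') \<in> G \<Longrightarrow> (u + u', v + v') \<in> G"
    and sm: "\<And>c u v. (u, v) \<in> G \<Longrightarrow> (sm c u, sm c v) \<in> G"
    and pw: "\<And>k u v. (u, v) \<in> G \<Longrightarrow> (pw k u, pw k v) \<in> G"
    and e: "\<And>i u v. (u, v) \<in> G \<Longrightarrow> (act (e i) u, act (e i) v) \<in> G"
    and uv: "(u, v) \<in> G"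
  shows "(act r u, act r v) \<in> G"
proof -
  have sum: "(sum f I, sum g I) \<in> G" if "\<And>i. i \<in> I \<Longrightarrow> (f i, g i) \<in> G" for f g :: "nat \<Rightarrow> 'm" and I
    using that by (induction I rule: infinite_finite_induct) (simp_all add: G add)
  obtain c where c: "\<forall>x\<in>M. act r x = (\<Sum>i<n. \<Sum>t<N. sm (c i t) (pw t (act (e i) x)))"
    using act_expand by blast
  have M: "u \<in> M" "v \<in> M" using G uv by auto
  have eq: "act r u = (\<Sum>i<n. \<Sum>t<N. sm (c i t) (pw t (act (e i) u)))"
    "act r v = (\<Sum>i<n. \<Sum>t<N. sm (c i t) (pw t (act (e i) v)))"
    using c M by blast+
  show ?thesis unfolding eq
    by (rule sum, rule sum, rule sm, rule pw, rule e, rule uv)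
qed

text \<open>A factor of a chain is one-dimensional, killed by \<open>\<pi>\<close>, and concentrated
  in the degree of its leading element, which is \<open>(\<sigma> ^^ k) h\<close> at position
  \<open>k\<close>. Only this degree distinguishes it from other factors.\<close>

lemma sq_iso_chain:
  assumes x: "chain x h a" and k: "k < a" and y: "chain y h' b" and b: "b > 0"
  shows "sq_iso sm act (W x a k, W x a (Suc k)) (W y b 0, W y b 1) \<longleftrightarrow> (\<sigma> ^^ k) h = h'"
proof
  have xM: "x \<in> M" "y \<in> M" using x y by simp_all
  assume "sq_iso sm act (W x a k, W x a (Suc k)) (W y b 0, W y b 1)"
  then obtain G where G: "\<forall>r. \<forall>p\<in>G. (act r (fst p), act r (snd p)) \<in> G" "fst ` G = W x a k"
      "snd ` G = W y b 0" "\<forall>p\<in>G. fst p \<in> W x a (Suc k) \<longleftrightarrow> snd p \<in> W y b 1"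
    by (auto simp: sq_iso_def)
  have "pw k x \<in> fst ` G" unfolding G(2) using x by (rule pw_in_W) simp
  then obtain v where v: "(pw k x, v) \<in> G" by auto
  let ?j = "(\<sigma> ^^ k) h"
  have ex: "act (e ?j) (pw k x) = pw k x" using x by (simp add: hom_e[OF hom_pw[of h]])
  have Gv: "(act (e ?j) (pw k x), act (e ?j) v) \<in> G" using bspec[OF spec[OF G(1), of "e ?j"] v] by simp
  have "pw k x = lc x a (\<lambda>t. if t = k then 1 else 0)" using k xM by (simp add: lc_single)
  then have "pw k x \<notin> W x a (Suc k)" using lc_in_W_iff[OF x, of "Suc k"] k by simp
  then have nv: "act (e ?j) v \<notin> W y b 1" using bspec[OF G(4) Gv] ex by simp
  have "v \<in> W y b 0" using v G(3) by force
  then obtain d where d: "v = lc y b d" by (auto simp: W_def)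
  have ev: "act (e ?j) v = lc y b (\<lambda>t. if (\<sigma> ^^ t) h' = ?j then d t else 0)"
    unfolding d using y by (intro lc_e) simp
  show "?j = h'"
  proof (rule ccontr)
    assume "?j \<noteq> h'"
    then have "act (e ?j) v \<in> W y b 1" unfolding ev by (intro W_I) auto
    then show False using nv by simp
  qed
next
  have xM: "x \<in> M" "y \<in> M" using x y by simp_all
  assume j: "(\<sigma> ^^ k) h = h'"
  \<comment> \<open>The graph matches the leading coefficients and leaves all later ones
    arbitrary.\<close>
  define G where "G = {(lc x a c, lc y b d) |c d. (\<forall>t<k. c t = 0) \<and> c k = d 0}"
  have GI: "(lc x a c, lc y b d) \<in> G" if "\<And>t. t < k \<Longrightarrow> c t = 0" "c k = d 0" for c d
    using that by (auto simp: G_def)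
  have GE: "\<exists>c d. u = lc x a c \<and> v = lc y b d \<and> (\<forall>t<k. c t = 0) \<and> c k = d 0" if "(u, v) \<in> G" for u v
    using that by (auto simp: G_def)
  have GM: "G \<subseteq> M \<times> M" using xM by (auto simp: G_def)
  have G0: "(0, 0) \<in> G" using GI[of "\<lambda>t. 0" "\<lambda>t. 0"] xM by simp
  have Gadd: "(u + u', v + v') \<in> G" if uv: "(u, v) \<in> G" "(u', v') \<in> G" for u v u' v'
  proof -
    obtain c d where "u = lc x a c" "v = lc y b d" "\<forall>t<k. c t = 0" "c k = d 0" using GE[OF uv(1)] by blast
    moreover obtain c' d' where "u' = lc x a c'" "v' = lc y b d'" "\<forall>t<k. c' t = 0" "c' k = d' 0"
      using GE[OF uv(2)] by blast
    ultimately show ?thesis using xM by (simp add: lc_add GI)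
  qed
  have Gsm: "(sm s u, sm s v) \<in> G" if uv: "(u, v) \<in> G" for s u v
  proof -
    obtain c d where "u = lc x a c" "v = lc y b d" "\<forall>t<k. c t = 0" "c k = d 0" using GE[OF uv] by blast
    then show ?thesis using xM by (simp add: lc_sm GI)
  qed
  have Gpw: "(pw l u, pw l v) \<in> G" if uv: "(u, v) \<in> G" for l u v
  proof -
    obtain c d where cd: "u = lc x a c" "v = lc y b d" "\<forall>t<k. c t = 0" "c k = d 0" using GE[OF uv] by blast
    show ?thesis
    proof (cases l)
      case 0
      then show ?thesis using cd uv xM by simp
    next
      case (Suc l')
      show ?thesis unfolding cd lc_pw[OF x] lc_pw[OF y]
        by (rule GI) (use cd(3) Suc in auto)
    qed
  qed
  have Ge: "(act (e i) u, act (e i) v) \<in> G" if uv: "(u, v) \<in> G" for i u v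
  proof -
    obtain c d where cd: "u = lc x a c" "v = lc y b d" "\<forall>t<k. c t = 0" "c k = d 0" using GE[OF uv] by blast
    show ?thesis unfolding cd lc_e[OF chain_hom[OF x]] lc_e[OF chain_hom[OF y]]
      by (rule GI) (use cd j in auto)
  qed
  have Gact: "(act r u, act r v) \<in> G" if "(u, v) \<in> G" for r u v
    by (rule pair_act_closed[OF GM G0 Gadd Gsm Gpw Ge that])
  have Gdiff: "(u - u', v - v') \<in> G" if uv: "(u, v) \<in> G" "(u', v') \<in> G" for u v u' v'
  proof -
    have "u' \<in> M" "v' \<in> M" using GM uv by auto
    then show ?thesis using Gadd[OF uv(1) Gsm[OF uv(2), of "- 1"]] by (simp add: sm_minus_1)
  qed
  have f: "fst ` G = W x a k"
  proof
    show "fst ` G \<subseteq> W x a k" by (auto simp: G_def W_def)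
    show "W x a k \<subseteq> fst ` G"
    proof
      fix u assume "u \<in> W x a k"
      then obtain c where c: "u = lc x a c" "\<forall>t<k. c t = 0" by (auto simp: W_def)
      then have "(lc x a c, lc y b (\<lambda>t. c k)) \<in> G" by (intro GI) auto
      then show "u \<in> fst ` G" using c by force
    qed
  qed
  have s: "snd ` G = W y b 0"
  proof
    show "snd ` G \<subseteq> W y b 0" by (auto simp: G_def W_def)
    show "W y b 0 \<subseteq> snd ` G"
    proof
      fix u assume "u \<in> W y b 0"
      then obtain d where d: "u = lc y b d" by (auto simp: W_def)
      have "(lc x a (\<lambda>t. if t = k then d 0 else 0), lc y b d) \<in> G" by (intro GI) auto
      then show "u \<in> snd ` G" using d by force
    qed
  qed
  have m: "\<forall>p\<in>G. fst p \<in> W x a (Suc k) \<longleftrightarrow> snd p \<in> W y b 1"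
  proof
    fix p assume "p \<in> G"
    then obtain c d where p: "p = (lc x a c, lc y b d)" "\<forall>t<k. c t = 0" "c k = d 0"
      by (auto simp: G_def)
    have "fst p \<in> W x a (Suc k) \<longleftrightarrow> c k = 0"
      using lc_in_W_iff[OF x, of "Suc k" c] k p by (auto simp: less_Suc_eq)
    moreover have "snd p \<in> W y b 1 \<longleftrightarrow> d 0 = 0"
      using lc_in_W_iff[OF y, of 1 d] b p by auto
    ultimately show "fst p \<in> W x a (Suc k) \<longleftrightarrow> snd p \<in> W y b 1" using p by simp
  qed
  have sub: "W x a (Suc k) \<subseteq> W x a k" "W y b 1 \<subseteq> W y b 0" by (simp_all add: W_antimono)
  have "G \<subseteq> W x a k \<times> W y b 0" unfolding f[symmetric] s[symmetric] by force
  then show "sq_iso sm act (W x a k, W x a (Suc k)) (W y b 0, W y b 1)"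
    unfolding sq_iso_def prod.case
    using sub G0 f s m Gadd Gdiff Gsm Gact by (intro conjI exI[of _ G]) auto
qed

lemma top_mod_chain: "chain x h a \<Longrightarrow> a > 0 \<Longrightarrow> top_mod sa sm act (W x a 0) = (W x a 0, W x a 1)"
  by (simp add: top_mod_def rad_mod_chain)

lemma mult_top_chain:
  assumes x: "chain x h a" and k: "k \<le> a" and y: "chain y h' b" and b: "b > 0"
  shows "mult sm act (top_mod sa sm act (W y b 0)) (W x a k) =
    card {t. k \<le> t \<and> t < a \<and> (\<sigma> ^^ t) h = h'}"
proof -
  have "{t. k \<le> t \<and> t < a \<and> sq_iso sm act (W x a t, W x a (Suc t)) (W y b 0, W y b 1)} =
      {t. k \<le> t \<and> t < a \<and> (\<sigma> ^^ t) h = h'}"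
    using sq_iso_chain[OF x _ y b] by blast
  then show ?thesis by (simp only: top_mod_chain[OF y b] mult_chain[OF x k])
qed

lemma top_iso_chain:
  assumes "chain x h a" "a > 0" "chain y h' b" "b > 0"
  shows "sq_iso sm act (top_mod sa sm act (W x a 0)) (top_mod sa sm act (W y b 0)) \<longleftrightarrow> h = h'"
  using sq_iso_chain[of x h a 0 y h' b] assms by (simp add: top_mod_chain)

lemma lc_sum: "x \<in> M \<Longrightarrow> (\<Sum>i\<in>I. lc x a (c i)) = lc x a (\<lambda>t. \<Sum>i\<in>I. c i t)"
  by (induction I rule: infinite_finite_induct) (simp_all add: lc_add)

text \<open>The new coefficients depend on degree and length but not on the generator, so matching
  the coefficients of two chains of the same type respects the action.\<close>

lemma act_lc: "\<exists>d. \<forall>x. chain x h a \<longrightarrow> act r (lc x a c) = lc x a d"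
proof -
  obtain b where b: "\<forall>x\<in>M. act r x = (\<Sum>i<n. \<Sum>t<N. sm (b i t) (pw t (act (e i) x)))"
    using act_expand by blast
  have "act r (lc x a c) = lc x a (\<lambda>s. \<Sum>i<n. \<Sum>t<N. b i t *
      (if s < t then 0 else if (\<sigma> ^^ (s - t)) h = i then c (s - t) else 0))"
    if x: "chain x h a" for x
  proof -
    have xM: "x \<in> M" using x by simp
    show ?thesis
      using b xM by (simp add: lc_e[OF chain_hom[OF x]] lc_pw[OF x] lc_sm lc_sum)
  qed
  then show ?thesis by blast
qed

lemma mod_iso_chain:
  assumes x: "chain x h a" and y: "chain y h' b" and a: "a > 0"
  shows "mod_iso sm act (W x a 0) sm act (W y b 0) \<longleftrightarrow> h = h' \<and> a = b"
proof
  have xM: "x \<in> M" "y \<in> M" using x y by simp_all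
  have x0: "x \<in> W x a 0" using pw_in_W[OF x, of 0 0] xM by simp
  assume "mod_iso sm act (W x a 0) sm act (W y b 0)"
  then obtain f where f: "bij_betw f (W x a 0) (W y b 0)"
    and fa: "\<forall>r. \<forall>u\<in>W x a 0. f (act r u) = act r (f u)"
    and fadd: "\<forall>u\<in>W x a 0. \<forall>v\<in>W x a 0. f (u + v) = f u + f v"
    unfolding mod_iso_def by blast
  have fpw: "f (pw k u) = pw k (f u)" if "u \<in> W x a 0" for k u using fa that by (simp add: pw_def)
  have z0: "0 \<in> W x a 0" by (rule sub_0[OF submod_W[OF x]])
  have "f (0 + 0) = f 0 + f 0" using fadd z0 by blast
  then have f0: "f 0 = 0" by simp
  have fz: "f u = 0 \<longleftrightarrow> u = 0" if "u \<in> W x a 0" for u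
    using f0 inj_on_eq_iff[OF bij_betw_imp_inj_on[OF f] that z0] by simp
  obtain d where d: "f x = lc y b d" using bij_betwE[OF f] x0 by (auto simp: W_def)
  \<comment> \<open>An isomorphism preserves annihilation by powers of \<open>\<pi>\<close>, which
    gives the lengths; the leading coefficient of the image of \<open>x\<close> then gives the
    degree.\<close>
  have kill: "pw k (f x) = 0 \<longleftrightarrow> a \<le> k" for k
    using fpw[OF x0, of k] fz[OF sub_pw[OF submod_W[OF x] x0], of k] chain_pw[OF x, of k] by simp
  have ab: "a \<le> b"
  proof -
    have "pw b (f x) = 0" unfolding d lc_pw[OF y] using xM
      by (subst lc_cong[of b _ "\<lambda>t. 0"]) auto
    then show ?thesis using kill by simp
  qed
  have b0: "b > 0" using ab a by simp
  have d0: "pw (b - 1) (f x) = sm (d 0) (pw (b - 1) y)"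
    using lc_top[OF y b0, of d] by (simp add: d)
  obtain z where z: "z \<in> W x a 0" "f z = y"
    using f pw_in_W[OF y, of 0 0] xM unfolding bij_betw_def by (metis imageE le_refl pw_0)
  have "a = b"
  proof (rule ccontr)
    assume "a \<noteq> b"
    obtain c where c: "z = lc x a c" using z by (auto simp: W_def)
    have "pw a z = 0" unfolding c lc_pw[OF x] using xM
      by (subst lc_cong[of a _ "\<lambda>t. 0"]) auto
    then have "pw a y = 0" using fpw[OF z(1), of a] z f0 by simp
    then show False using chain_pw[OF y] ab \<open>a \<noteq> b\<close> by simp
  qed
  moreover have "d 0 \<noteq> 0"
  proof
    assume "d 0 = 0"
    then have "pw (b - 1) (f x) = 0" using d0 xM by simp
    then show False using kill \<open>a = b\<close> b0 by simp
  qed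
  moreover have "act (e h) (f x) = f x" using fa x0 chain_hom[OF x] by (metis hom_def)
  then have "lc y b (\<lambda>t. if (\<sigma> ^^ t) h' = h then d t else 0) = lc y b d"
    unfolding d lc_e[OF chain_hom[OF y]] .
  then have "\<forall>t<b. (if (\<sigma> ^^ t) h' = h then d t else 0) = d t" by (simp only: lc_eq_iff[OF y])
  then have "(if (\<sigma> ^^ 0) h' = h then d 0 else 0) = d 0" using b0 by blast
  ultimately show "h = h' \<and> a = b" by (auto split: if_splits)
next
  assume eq: "h = h' \<and> a = b"
  have xM: "x \<in> M" "y \<in> M" using x y by simp_all
  have y': "chain y h a" using y eq by simp
  \<comment> \<open>Coefficients are unique below the length and \<open>lc\<close> ignores all
    others, so the choice does not matter.\<close>
  define f where "f u = lc y a (SOME c. u = lc x a c)" for u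
  have f: "f (lc x a c) = lc y a c" for c
  proof -
    have "lc x a c = lc x a (SOME d. lc x a c = lc x a d)" by (rule someI[of _ c]) simp
    then have "\<forall>t<a. c t = (SOME d. lc x a c = lc x a d) t" using lc_eq_iff[OF x] by blast
    then show ?thesis unfolding f_def lc_eq_iff[OF y'] by simp
  qed
  have W0: "W z a 0 = range (lc z a)" for z by (auto simp: W_def)
  have "bij_betw f (W x a 0) (W y a 0)"
    unfolding W0 bij_betw_def
  proof
    show "inj_on f (range (lc x a))"
      by (intro inj_onI) (auto simp: f lc_eq_iff[OF x] lc_eq_iff[OF y'])
    show "f ` range (lc x a) = range (lc y a)" by (auto simp: f image_image)
  qed
  moreover have "f (act r (lc x a c)) = act r (f (lc x a c))" for r c
  proof -
    obtain d where "\<forall>x. chain x h a \<longrightarrow> act r (lc x a c) = lc x a d" using act_lc by blast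
    then show ?thesis using x y' f by simp
  qed
  ultimately have "mod_iso sm act (W x a 0) sm act (W y a 0)"
    unfolding mod_iso_def W0 using xM
    by (intro exI[of _ f]) (auto simp: f lc_add lc_sm)
  then show "mod_iso sm act (W x a 0) sm act (W y b 0)" using eq by simp
qed

end

section \<open>Decomposition into chains\<close>

context serial_module
begin

text \<open>An index is a pair of a generator and a degree. Keeping the degree in the index lets
  \<open>snd\<close> serve as the degree function of every decomposition below.\<close>

lemma fin_gen_homogeneous:
  assumes "fin_gen sm act L" "L \<subseteq> M"
  shows "\<exists>(I::('m \<times> nat) set) x. finite I \<and> (\<forall>p\<in>I. hom (snd p) (x p)) \<and> gen sm act (x ` I) = L"
proof -
  obtain S where S: "finite S" "S \<subseteq> L" "gen sm act S = L" using assms(1) by (auto simp: fin_gen_def)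
  define I where "I = S \<times> {..<n}"
  define x where "x p = act (e (snd p)) (fst p)" for p :: "'m \<times> nat"
  have L: "submod sm act L" using S(3) submod_gen[of sm act S] by simp
  have "x ` I \<subseteq> L" using S(2) sub_act[OF L] by (auto simp: I_def x_def)
  then have "gen sm act (x ` I) \<subseteq> L" by (rule gen_least[OF L])
  moreover have "S \<subseteq> gen sm act (x ` I)"
  proof
    fix s assume s: "s \<in> S"
    have "act (e i) s \<in> gen sm act (x ` I)" if "i < n" for i
    proof -
      have "x (s, i) \<in> x ` I" using s that by (intro imageI) (simp add: I_def)
      then show ?thesis using subset_gen[of "x ` I" sm act] by (auto simp: x_def)
    qed
    then have "(\<Sum>i<n. act (e i) s) \<in> gen sm act (x ` I)" by (intro sub_sum[OF submod_gen]) auto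
    moreover have "s \<in> M" using s S assms by blast
    ultimately show "s \<in> gen sm act (x ` I)" by (simp add: sum_e)
  qed
  then have "L \<subseteq> gen sm act (x ` I)" using gen_least[OF submod_gen, of S sm act "x ` I"] S(3) by simp
  moreover have "hom (snd p) (x p)" if "p \<in> I" for p
    using that S(2) assms(2) by (auto simp: I_def x_def intro!: hom_act_e)
  moreover have "finite I" using S(1) by (simp add: I_def)
  ultimately show ?thesis by blast
qed

definition combs :: "'i set \<Rightarrow> ('i \<Rightarrow> 'm) \<Rightarrow> ('i \<Rightarrow> nat) \<Rightarrow> 'm set" where
  "combs I x a = range (\<lambda>c. \<Sum>p\<in>I. lc (x p) (a p) (c p))"

lemma combsI: "(\<Sum>p\<in>I. lc (x p) (a p) (c p)) \<in> combs I x a"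
  by (simp add: combs_def)

lemma submod_combs:
  assumes ch: "\<And>p. p \<in> I \<Longrightarrow> chain (x p) (h p) (a p)"
  shows "submod sm act (combs I x a)"
proof (rule submodI)
  have xM: "x p \<in> M" if "p \<in> I" for p using ch[OF that] by simp
  show "combs I x a \<subseteq> M" using xM by (auto simp: combs_def)
  have "(\<Sum>p\<in>I. lc (x p) (a p) (\<lambda>t. 0)) \<in> combs I x a" by (rule combsI)
  then show "0 \<in> combs I x a" using xM by simp
  fix u assume "u \<in> combs I x a"
  then obtain c where u: "u = (\<Sum>p\<in>I. lc (x p) (a p) (c p))" by (auto simp: combs_def)
  have "sm s u = (\<Sum>p\<in>I. lc (x p) (a p) (\<lambda>t. s * c p t))" for s
    unfolding u using xM by (simp add: sm_sum lc_sm)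
  then show "sm s u \<in> combs I x a" for s by (simp only: combsI)
  have "pw k u = (\<Sum>p\<in>I. lc (x p) (a p) (\<lambda>t. if t < k then 0 else c p (t - k)))" for k
    unfolding u using xM lc_pw[OF ch] by (simp add: pw_sum)
  then show "pw k u \<in> combs I x a" for k by (simp only: combsI)
  have "act (e i) u = (\<Sum>p\<in>I. lc (x p) (a p) (\<lambda>t. if (\<sigma> ^^ t) (h p) = i then c p t else 0))" for i
    unfolding u using xM lc_e[OF chain_hom[OF ch]] by (simp add: act_sum)
  then show "act (e i) u \<in> combs I x a" for i by (simp only: combsI)
  fix v assume "v \<in> combs I x a"
  then obtain d where v: "v = (\<Sum>p\<in>I. lc (x p) (a p) (d p))" by (auto simp: combs_def)
  have "u + v = (\<Sum>p\<in>I. lc (x p) (a p) (\<lambda>t. c p t + d p t))"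
    unfolding u v using xM by (simp add: lc_add flip: sum.distrib)
  then show "u + v \<in> combs I x a" by (simp only: combsI)
qed

definition chain_decomp ::
  "('m \<times> nat) set \<Rightarrow> ('m \<times> nat \<Rightarrow> 'm) \<Rightarrow> ('m \<times> nat \<Rightarrow> nat) \<Rightarrow> 'm set \<Rightarrow> bool" where
  "chain_decomp I x a L \<longleftrightarrow> finite I \<and> (\<forall>p\<in>I. chain (x p) (snd p) (a p) \<and> a p > 0) \<and>
     L = combs I x a \<and>
     (\<forall>c. (\<Sum>p\<in>I. lc (x p) (a p) (c p)) = 0 \<longrightarrow> (\<forall>p\<in>I. \<forall>t<a p. c p t = 0))"

lemma sub_lc: "submod sm act L \<Longrightarrow> x \<in> L \<Longrightarrow> lc x a c \<in> L"
  unfolding lc_def by (intro sub_sum sub_sm sub_pw)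

definition len :: "'m \<Rightarrow> nat" where
  "len x = (LEAST k. pw k x = 0)"

lemma chain_len: "hom h x \<Longrightarrow> chain x h (len x)"
proof -
  assume x: "hom h x"
  obtain a where a: "chain x h a" using chain_exists[OF x] by blast
  then have "len x = a" unfolding len_def using chain_pw[OF a] by (intro Least_equality) auto
  then show ?thesis using a by simp
qed

text \<open>A relation between homogeneous generators, divided by the largest possible power of \<open>\<pi>\<close>,
  lets one of them be replaced by a generator of strictly smaller length. Hence generators of
  minimal total length are independent.\<close>

lemma shorten_generators:
  fixes I :: "'i set"
  assumes fin: "finite I" and hm: "\<And>p. p \<in> I \<Longrightarrow> hom (h p) (x p)"
    and rel: "(\<Sum>p\<in>I. lc (x p) (len (x p)) (c p)) = 0"
    and nz: "p0 \<in> I" "t0 < len (x p0)" "c p0 t0 \<noteq> 0"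
  shows "\<exists>p1\<in>I. \<exists>y. hom (h p1) y \<and> len y < len (x p1) \<and>
    gen sm act (x(p1 := y) ` I) = gen sm act (x ` I)"
proof -
  have ch: "chain (x p) (h p) (len (x p))" if "p \<in> I" for p using chain_len[OF hm[OF that]] .
  have xM: "x p \<in> M" if "p \<in> I" for p using hm[OF that] by simp
  define Q where "Q s \<longleftrightarrow> (\<exists>p\<in>I. s < len (x p) \<and> c p s \<noteq> 0)" for s
  define s where "s = (LEAST s. Q s)"
  have "Q t0" using nz by (auto simp: Q_def)
  then have "Q s" unfolding s_def by (rule LeastI)
  then obtain p1 where p1: "p1 \<in> I" "s < len (x p1)" "c p1 s \<noteq> 0" by (auto simp: Q_def)
  have small: "c p t = 0" if "p \<in> I" "t < len (x p)" "t < s" for p t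
    using not_less_Least[of t Q] that by (auto simp: s_def Q_def)
  define d where "d p t = (if t + s < len (x p) then c p (t + s) else 0)" for p t
  \<comment> \<open>The relation divided by \<open>\<pi> ^ s\<close>: not zero in general, but
    killed by that power.\<close>
  define y0 where "y0 = (\<Sum>p\<in>I. lc (x p) (len (x p)) (d p))"
  have y0M: "y0 \<in> M" unfolding y0_def using xM by simp
  have "pw s y0 = (\<Sum>p\<in>I. lc (x p) (len (x p)) (\<lambda>t. if t < s then 0 else d p (t - s)))"
    unfolding y0_def using xM lc_pw[OF ch] by (simp add: pw_sum)
  also have "\<dots> = (\<Sum>p\<in>I. lc (x p) (len (x p)) (c p))"
    by (intro sum.cong refl lc_cong) (auto simp: d_def small)
  finally have ps: "pw s y0 = 0" using rel by simp
  let ?h = "h p1"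
  \<comment> \<open>Only one homogeneous component is kept. Its coefficient at \<open>x p1\<close>
    itself is the nonzero \<open>c p1 s\<close>, so it can replace \<open>x p1\<close> without
    changing the generated submodule.\<close>
  define y where "y = act (e ?h) y0"
  have hy: "hom ?h y" unfolding y_def by (rule hom_act_e[OF y0M])
  have "pw s y = 0" unfolding y_def using e_pw[OF y0M, of s ?h] ps by simp
  then have "len y \<le> s" unfolding len_def by (rule Least_le)
  then have ly: "len y < len (x p1)" using p1 by simp
  let ?x = "x(p1 := y)"
  let ?G = "gen sm act (?x ` I)" and ?L = "gen sm act (x ` I)"
  have xL: "x p \<in> ?L" if "p \<in> I" for p using subset_gen[of "x ` I" sm act] that by blast
  have "y0 \<in> ?L" unfolding y0_def by (intro sub_sum[OF submod_gen] sub_lc[OF submod_gen] xL)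
  then have "y \<in> ?L" unfolding y_def by (intro sub_act[OF submod_gen])
  then have "?x ` I \<subseteq> ?L" using xL by auto
  then have GL: "?G \<subseteq> ?L" by (rule gen_least[OF submod_gen])
  have xG: "x p \<in> ?G" if "p \<in> I" "p \<noteq> p1" for p
  proof -
    have "?x p \<in> ?x ` I" using that by blast
    then show ?thesis using subset_gen[of "?x ` I" sm act] that by auto
  qed
  have yG: "y \<in> ?G"
  proof -
    have "?x p1 \<in> ?x ` I" using p1 by blast
    then show ?thesis using subset_gen[of "?x ` I" sm act] by auto
  qed
  let ?u = "act (e ?h) (lc (x p1) (len (x p1)) (d p1))"
  let ?v = "\<Sum>p\<in>I - {p1}. act (e ?h) (lc (x p) (len (x p)) (d p))"
  have "y = (\<Sum>p\<in>I. act (e ?h) (lc (x p) (len (x p)) (d p)))"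
    unfolding y_def y0_def using xM by (intro act_sum) simp
  also have "\<dots> = ?u + ?v" by (rule sum.remove[OF fin p1(1)])
  finally have yuv: "y = ?u + ?v" .
  have "?v \<in> ?G"
    by (intro sub_sum[OF submod_gen] sub_act[OF submod_gen] sub_lc[OF submod_gen] xG) auto
  then have "y - ?v \<in> ?G" by (rule sub_diff[OF submod_gen yG])
  then have "?u \<in> ?G" using yuv by simp
  then have u: "lc (x p1) (len (x p1)) (\<lambda>t. if (\<sigma> ^^ t) ?h = ?h then d p1 t else 0) \<in> ?G"
    using lc_e[OF hm[OF p1(1)]] by simp
  have "W (x p1) (len (x p1)) 0 \<subseteq> ?G"
    by (rule W_least[OF ch[OF p1(1)] submod_gen u]) (use p1 in \<open>auto simp: d_def\<close>)
  moreover have "x p1 \<in> W (x p1) (len (x p1)) 0"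
    using pw_in_W[OF ch[OF p1(1)], of 0 0] xM[OF p1(1)] by simp
  ultimately have "x p1 \<in> ?G" by blast
  then have "x ` I \<subseteq> ?G" using xG by blast
  then have "?L \<subseteq> ?G" by (rule gen_least[OF submod_gen])
  then have "?G = ?L" using GL by blast
  then show ?thesis using p1(1) hy ly by blast
qed

lemma generator_in_combs:
  assumes fin: "finite J" and xM: "\<And>q. q \<in> J \<Longrightarrow> x q \<in> M" and p: "p \<in> J" "a p > 0"
  shows "x p \<in> combs J x a"
proof -
  let ?c = "\<lambda>q t. if q = p \<and> t = (0::nat) then 1 else (0::'k)"
  have "(\<Sum>q\<in>J. lc (x q) (a q) (?c q)) = lc (x p) (a p) (?c p) + (\<Sum>q\<in>J - {p}. lc (x q) (a q) (?c q))"
    by (rule sum.remove[OF fin p(1)])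
  also have "lc (x p) (a p) (?c p) = x p"
    using lc_single[of "x p" 0 "a p" 1] p xM[OF p(1)] by simp
  also have "(\<Sum>q\<in>J - {p}. lc (x q) (a q) (?c q)) = 0"
    using xM by (intro sum.neutral) (auto simp: lc_def)
  finally show ?thesis using combsI[of x a ?c J] by simp
qed

theorem chain_decomposition:
  assumes fg: "fin_gen sm act L" and LM: "L \<subseteq> M"
  shows "\<exists>I x a. chain_decomp I x a L"
proof -
  obtain I :: "('m \<times> nat) set" and x0 where I: "finite I"
    and x0: "\<forall>p\<in>I. hom (snd p) (x0 p)" "gen sm act (x0 ` I) = L"
    using fin_gen_homogeneous[OF assms] by blast
  define Fam where "Fam x \<longleftrightarrow> (\<forall>p\<in>I. hom (snd p) (x p)) \<and> gen sm act (x ` I) = L" for x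
  have "Fam x0" using x0 by (simp add: Fam_def)
  then obtain x where x: "Fam x" and least: "\<And>y. Fam y \<Longrightarrow> (\<Sum>p\<in>I. len (x p)) \<le> (\<Sum>p\<in>I. len (y p))"
    using ex_has_least_nat[of Fam x0 "\<lambda>x. \<Sum>p\<in>I. len (x p)"] by blast
  have hm: "hom (snd p) (x p)" if "p \<in> I" for p using x that by (simp add: Fam_def)
  have gL: "gen sm act (x ` I) = L" using x by (simp add: Fam_def)
  define a where "a p = len (x p)" for p
  have ch: "chain (x p) (snd p) (a p)" if "p \<in> I" for p using chain_len[OF hm[OF that]] by (simp add: a_def)
  have indep: "c p0 t0 = 0" if rel: "(\<Sum>p\<in>I. lc (x p) (a p) (c p)) = 0" and p0: "p0 \<in> I" "t0 < a p0"
    for c p0 t0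
  proof (rule ccontr)
    assume "c p0 t0 \<noteq> 0"
    then obtain p1 y where p1: "p1 \<in> I" "hom (snd p1) y" "len y < len (x p1)"
      "gen sm act (x(p1 := y) ` I) = gen sm act (x ` I)"
      using shorten_generators[of I snd x c p0 t0] I hm rel p0 unfolding a_def by blast
    have "Fam (x(p1 := y))" using p1 hm gL by (simp add: Fam_def)
    then have "(\<Sum>p\<in>I. len (x p)) \<le> (\<Sum>p\<in>I. len ((x(p1 := y)) p))" by (rule least)
    moreover have "(\<Sum>p\<in>I. len ((x(p1 := y)) p)) < (\<Sum>p\<in>I. len (x p))"
      by (rule sum_strict_mono_ex1[OF I]) (use p1 in auto)
    ultimately show False by simp
  qed
  \<comment> \<open>A family of minimal total length may contain zero generators, of length 0, which
    a decomposition does not admit.\<close>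
  define J where "J = {p \<in> I. a p > 0}"
  have IJ: "(\<Sum>p\<in>I. lc (x p) (a p) (c p)) = (\<Sum>p\<in>J. lc (x p) (a p) (c p))" for c
    using I by (intro sum.mono_neutral_right) (auto simp: J_def lc_def)
  have sc: "submod sm act (combs J x a)" by (rule submod_combs[of J x snd a]) (use ch in \<open>auto simp: J_def\<close>)
  have "x p \<in> combs J x a" if p: "p \<in> I" for p
  proof (cases "a p = 0")
    case True
    then have "pw 0 (x p) = 0" using chain_pw_0[OF ch[OF p], of 0] by simp
    then show ?thesis using hm[OF p] sub_0[OF sc] by simp
  next
    case False
    then show ?thesis using p I hom_in[OF hm] by (intro generator_in_combs) (simp_all add: J_def)
  qed
  then have "L \<subseteq> combs J x a" using gen_least[OF sc, of "x ` I"] gL by blast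
  moreover have "combs J x a \<subseteq> L"
  proof -
    have "x p \<in> L" if "p \<in> J" for p using that gL subset_gen[of "x ` I" sm act] by (auto simp: J_def)
    moreover have "submod sm act L" using gL submod_gen by blast
    ultimately show ?thesis by (auto simp: combs_def intro!: sub_sum sub_lc)
  qed
  ultimately have "L = combs J x a" by blast
  moreover have "\<forall>c. (\<Sum>p\<in>J. lc (x p) (a p) (c p)) = 0 \<longrightarrow> (\<forall>p\<in>J. \<forall>t<a p. c p t = 0)"
    using indep unfolding IJ by (auto simp: J_def)
  ultimately have "chain_decomp J x a L" using I ch by (auto simp: chain_decomp_def J_def)
  then show ?thesis by blast
qed

section \<open>Chains as the indecomposable summands\<close>

lemma chain_decomp_unique:
  assumes d: "chain_decomp I x a L" and p: "p \<in> I" "t < a p"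
    and eq: "(\<Sum>p\<in>I. lc (x p) (a p) (c p)) = (\<Sum>p\<in>I. lc (x p) (a p) (c' p))"
  shows "c p t = c' p t"
proof -
  have "x q \<in> M" if "q \<in> I" for q using d that by (auto simp: chain_decomp_def)
  then have "(\<Sum>q\<in>I. lc (x q) (a q) (\<lambda>t. c q t - c' q t)) =
      (\<Sum>q\<in>I. lc (x q) (a q) (c q)) - (\<Sum>q\<in>I. lc (x q) (a q) (c' q))"
    by (simp add: sum_subtractf flip: lc_diff)
  then have z: "(\<Sum>q\<in>I. lc (x q) (a q) ((\<lambda>q t. c q t - c' q t) q)) = 0" using eq by simp
  have "\<And>c. (\<Sum>p\<in>I. lc (x p) (a p) (c p)) = 0 \<Longrightarrow> \<forall>p\<in>I. \<forall>t<a p. c p t = 0"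
    using d by (simp add: chain_decomp_def)
  from this[OF z] show ?thesis using p by simp
qed

lemma chain_decomp_dsum2:
  assumes d: "chain_decomp I x a L" and p: "p \<in> I"
  shows "dsum2 sm act (W (x p) (a p) 0) (combs (I - {p}) x a) L"
proof -
  have fin: "finite I" and ch: "\<And>q. q \<in> I \<Longrightarrow> chain (x q) (snd q) (a q)" and L: "L = combs I x a"
    using d by (auto simp: chain_decomp_def)
  have xM: "x q \<in> M" if "q \<in> I" for q using ch[OF that] by simp
  have split: "(\<Sum>q\<in>I. lc (x q) (a q) (c q)) = lc (x p) (a p) (c p) + (\<Sum>q\<in>I - {p}. lc (x q) (a q) (c q))" for c
    by (rule sum.remove[OF fin p])
  have U: "submod sm act (W (x p) (a p) 0)" by (rule submod_W[OF ch[OF p]])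
  have V: "submod sm act (combs (I - {p}) x a)" by (rule submod_combs[of _ x snd a]) (use ch in auto)
  have "u = 0" if u: "u \<in> W (x p) (a p) 0" "u \<in> combs (I - {p}) x a" for u
  proof -
    obtain c0 where c0: "u = lc (x p) (a p) c0" using u by (auto simp: W_def)
    obtain c where c: "u = (\<Sum>q\<in>I - {p}. lc (x q) (a q) (c q))" using u by (auto simp: combs_def)
    let ?c = "\<lambda>q. if q = p then c0 else (\<lambda>t. 0)" and ?c' = "\<lambda>q. if q = p then (\<lambda>t. 0) else c q"
    have "(\<Sum>q\<in>I. lc (x q) (a q) (?c q)) = u"
      unfolding split using c0 xM by (simp add: sum.neutral)
    moreover have "(\<Sum>q\<in>I. lc (x q) (a q) (?c' q)) = u"
    proof -
      have "(\<Sum>q\<in>I - {p}. lc (x q) (a q) (?c' q)) = u" unfolding c by (rule sum.cong) auto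
      then show ?thesis unfolding split using xM[OF p] by simp
    qed
    ultimately have "?c p t = ?c' p t" if "t < a p" for t
      using chain_decomp_unique[OF d p that, of ?c ?c'] by simp
    then have "\<forall>t<a p. c0 t = 0" by simp
    then have "lc (x p) (a p) c0 = lc (x p) (a p) (\<lambda>t. 0)" by (intro lc_cong) simp
    then show "u = 0" using c0 xM[OF p] by simp
  qed
  then have "W (x p) (a p) 0 \<inter> combs (I - {p}) x a = {0}" using sub_0[OF U] sub_0[OF V] by blast
  moreover have "{u + v |u v. u \<in> W (x p) (a p) 0 \<and> v \<in> combs (I - {p}) x a} = L"
  proof (intro equalityI subsetI)
    fix z assume "z \<in> {u + v |u v. u \<in> W (x p) (a p) 0 \<and> v \<in> combs (I - {p}) x a}"
    then obtain c0 c where z: "z = lc (x p) (a p) c0 + (\<Sum>q\<in>I - {p}. lc (x q) (a q) (c q))"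
      by (auto simp: W_def combs_def)
    let ?c = "\<lambda>q. if q = p then c0 else c q"
    have "(\<Sum>q\<in>I - {p}. lc (x q) (a q) (?c q)) = (\<Sum>q\<in>I - {p}. lc (x q) (a q) (c q))"
      by (rule sum.cong) auto
    then have "(\<Sum>q\<in>I. lc (x q) (a q) (?c q)) = z" unfolding split z by simp
    then show "z \<in> L" unfolding L using combsI[of x a ?c I] by simp
  next
    fix z assume "z \<in> L"
    then obtain c where "z = (\<Sum>q\<in>I. lc (x q) (a q) (c q))" unfolding L by (auto simp: combs_def)
    then show "z \<in> {u + v |u v. u \<in> W (x p) (a p) 0 \<and> v \<in> combs (I - {p}) x a}"
      unfolding split using W_I[of 0 "c p" "x p" "a p"] combsI by blast
  qed
  ultimately show ?thesis using U V by (simp add: dsum2_def)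
qed

lemma chain_nonzero: "chain x h a \<Longrightarrow> a > 0 \<Longrightarrow> W x a 0 \<noteq> {0}"
  using W_eq_iff[of x h a 0 a] by auto

lemma indecomp_chain_decomp:
  assumes d: "chain_decomp I x a L" and ind: "indecomp sm act L"
  shows "\<exists>p\<in>I. L = W (x p) (a p) 0"
proof -
  have "I \<noteq> {}"
  proof
    assume "I = {}"
    then have "L = {0}" using d by (auto simp: chain_decomp_def combs_def)
    then show False using ind by (simp add: indecomp_def)
  qed
  then obtain p where p: "p \<in> I" by blast
  have ch: "chain (x p) (snd p) (a p)" "a p > 0" using d p by (auto simp: chain_decomp_def)
  note ds = chain_decomp_dsum2[OF d p]
  then have "combs (I - {p}) x a = {0}"
    using ind chain_nonzero[OF ch] unfolding indecomp_def by blast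
  then have "{u + v |u v. u \<in> W (x p) (a p) 0 \<and> v \<in> {0}} = L" using ds by (simp add: dsum2_def)
  then have "L = W (x p) (a p) 0" by auto
  then show ?thesis using p by blast
qed

lemma dsum2_subset: "dsum2 sm act X Y L \<Longrightarrow> X \<subseteq> L"
proof
  fix u assume d: "dsum2 sm act X Y L" and u: "u \<in> X"
  have L: "{u + v |u v. u \<in> X \<and> v \<in> Y} = L" using d by (simp add: dsum2_def)
  have "0 \<in> Y" using d sub_0[of Y] by (simp add: dsum2_def)
  then have "u + 0 \<in> {u + v |u v. u \<in> X \<and> v \<in> Y}" using u by blast
  then show "u \<in> L" unfolding L by simp
qed

text \<open>The components in \<open>X\<close> of the generators of \<open>M\<close> generate
  \<open>X\<close>. Instead of a projection, the sum of what they generate with \<open>Y\<close> is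
  used: it is a submodule that contains all generators, hence all of \<open>M\<close>.\<close>

lemma summand_fin_gen:
  assumes d: "dsum2 sm act X Y M" and fg: "fin_gen sm act M"
  shows "fin_gen sm act X"
proof -
  obtain S where S: "finite S" "S \<subseteq> M" "gen sm act S = M" using fg by (auto simp: fin_gen_def)
  have X: "submod sm act X" and Y: "submod sm act Y" and XY: "X \<inter> Y = {0}"
    and sum: "{u + v |u v. u \<in> X \<and> v \<in> Y} = M" using d by (auto simp: dsum2_def)
  have "\<exists>u v. s = u + v \<and> u \<in> X \<and> v \<in> Y" if "s \<in> S" for s using that S(2) sum by blast
  then obtain u v where uv: "\<And>s. s \<in> S \<Longrightarrow> s = u s + v s \<and> u s \<in> X \<and> v s \<in> Y" by metis
  let ?G = "gen sm act (u ` S)"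
  have GX: "?G \<subseteq> X" by (rule gen_least[OF X]) (use uv in auto)
  have XM: "X \<subseteq> M" and YM: "Y \<subseteq> M"
  proof -
    show "X \<subseteq> M" by (rule dsum2_subset[OF d])
    show "Y \<subseteq> M"
    proof
      fix w assume w: "w \<in> Y"
      have "0 + w \<in> {u + v |u v. u \<in> X \<and> v \<in> Y}" using w sub_0[OF X] by blast
      then show "w \<in> M" using sum by simp
    qed
  qed
  define H where "H = {g + w |g w. g \<in> ?G \<and> w \<in> Y}"
  have G: "submod sm act ?G" by (rule submod_gen)
  have HI: "g + w \<in> H" if "g \<in> ?G" "w \<in> Y" for g w using that by (auto simp: H_def)
  have "submod sm act H"
  proof (rule submodI)
    have "?G \<subseteq> M" using GX XM by blast
    then show "H \<subseteq> M" using YM by (auto simp: H_def subset_iff)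
    show "0 \<in> H" using HI[OF sub_0[OF G] sub_0[OF Y]] by simp
    fix z assume "z \<in> H"
    then obtain g w where z: "z = g + w" "g \<in> ?G" "w \<in> Y" by (auto simp: H_def)
    have gw: "g \<in> M" "w \<in> M" using z GX XM YM by auto
    show "sm c z \<in> H" for c
      using HI[OF sub_sm[OF G z(2), of c] sub_sm[OF Y z(3), of c]] gw by (simp add: z sm_add)
    show "pw k z \<in> H" for k
      using HI[OF sub_pw[OF G z(2), of k] sub_pw[OF Y z(3), of k]] gw by (simp add: z pw_add)
    show "act (e i) z \<in> H" for i
      using HI[OF sub_act[OF G z(2), of "e i"] sub_act[OF Y z(3), of "e i"]] gw by (simp add: z act_add)
    fix z' assume "z' \<in> H"
    then obtain g' w' where z': "z' = g' + w'" "g' \<in> ?G" "w' \<in> Y" by (auto simp: H_def)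
    show "z + z' \<in> H"
      using HI[OF sub_add[OF G z(2) z'(2)] sub_add[OF Y z(3) z'(3)]] by (simp add: z z' algebra_simps)
  qed
  moreover have "S \<subseteq> H"
  proof
    fix s assume s: "s \<in> S"
    have "u s \<in> ?G" using subset_gen[of "u ` S" sm act] s by blast
    then have "u s + v s \<in> H" using HI uv[OF s] by blast
    then show "s \<in> H" using uv[OF s] by simp
  qed
  ultimately have "M \<subseteq> H" using gen_least[of sm act H S] S(3) by simp
  have "X \<subseteq> ?G"
  proof
    fix z assume z: "z \<in> X"
    then have "z \<in> H" using XM \<open>M \<subseteq> H\<close> by blast
    then obtain g w where gw: "z = g + w" "g \<in> ?G" "w \<in> Y" by (auto simp: H_def)
    have "z - g \<in> X" using sub_diff[OF X z] gw GX by blast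
    then have "w \<in> X" using gw by simp
    then have "w = 0" using gw XY by blast
    then show "z \<in> ?G" using gw by simp
  qed
  then have "?G = X" using GX by blast
  moreover have "finite (u ` S)" "u ` S \<subseteq> X" using S uv by auto
  ultimately show ?thesis unfolding fin_gen_def by blast
qed

lemma ind_summand_chain:
  assumes fg: "fin_gen sm act M" and X: "ind_summand sm act M X"
  shows "\<exists>x h a Y. chain x h a \<and> a > 0 \<and> X = W x a 0 \<and> dsum2 sm act X Y M"
proof -
  obtain Y where Y: "dsum2 sm act X Y M" and ind: "indecomp sm act X"
    using X by (auto simp: ind_summand_def)
  obtain I x a where d: "chain_decomp I x a X"
    using chain_decomposition[OF summand_fin_gen[OF Y fg] dsum2_subset[OF Y]] by blast
  obtain p where p: "p \<in> I" "X = W (x p) (a p) 0" using indecomp_chain_decomp[OF d ind] by blast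
  have "chain (x p) (snd p) (a p)" "a p > 0" using d p by (auto simp: chain_decomp_def)
  then show ?thesis using p Y by blast
qed

text \<open>The two halves of a splitting are submodules of a chain, hence comparable, so their
  intersection is the smaller one.\<close>

lemma indecomp_chain:
  assumes ch: "chain x h a" and a: "a > 0"
  shows "indecomp sm act (W x a 0)"
  unfolding indecomp_def
proof (intro conjI allI impI)
  show "W x a 0 \<noteq> {0}" by (rule chain_nonzero[OF assms])
  fix U V assume d: "dsum2 sm act U V (W x a 0)"
  have d': "dsum2 sm act V U (W x a 0)"
  proof -
    have "{v + u |v u. v \<in> V \<and> u \<in> U} = {u + v |u v. u \<in> U \<and> v \<in> V}"
      by (metis (no_types, opaque_lifting) add.commute)
    then show ?thesis using d unfolding dsum2_def by (simp add: Int_commute)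
  qed
  obtain k where k: "k \<le> a" "U = W x a k"
    using submod_chain_cases[OF ch _ dsum2_subset[OF d]] d unfolding dsum2_def by blast
  obtain l where l: "l \<le> a" "V = W x a l"
    using submod_chain_cases[OF ch _ dsum2_subset[OF d']] d unfolding dsum2_def by blast
  have i0: "W x a k \<inter> W x a l = {0}" using d k l by (simp add: dsum2_def)
  show "U = {0} \<or> V = {0}"
  proof (cases "k \<le> l")
    case True
    then have "W x a l \<subseteq> W x a k" by (rule W_antimono)
    then show ?thesis using i0 l by blast
  next
    case False
    then have "W x a k \<subseteq> W x a l" by (intro W_antimono) simp
    then show ?thesis using i0 k by blast
  qed
qed

lemma chain_decomp_ind_summand:
  assumes d: "chain_decomp I x a M" and p: "p \<in> I"
  shows "ind_summand sm act M (W (x p) (a p) 0)"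
proof -
  have "chain (x p) (snd p) (a p)" "a p > 0" using d p by (auto simp: chain_decomp_def)
  then show ?thesis using chain_decomp_dsum2[OF d p] indecomp_chain
    unfolding ind_summand_def by blast
qed

end

section \<open>Shifts between chains\<close>

text \<open>The count is \<open>(a + (n - 1 - d)) div n\<close>. Stated as two linear inequalities,
  it can be combined with bounds on the lengths.\<close>

lemma count_residue_eq_iff:
  fixes a d n m :: nat
  assumes d: "d < n"
  shows "card {t. t < a \<and> t mod n = d} = m \<longleftrightarrow> m * n \<le> a + (n - 1 - d) \<and> a + (n - 1 - d) < m * n + n"
proof -
  have n: "n > 0" using d by simp
  define K where "K = (a + (n - 1 - d)) div n"
  have lt: "k * n + d < a \<longleftrightarrow> k < K" for k
  proof -
    have "k < K \<longleftrightarrow> Suc k * n \<le> a + (n - 1 - d)"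
      unfolding K_def Suc_le_eq[symmetric] by (rule less_eq_div_iff_mult_less_eq[OF n])
    also have "\<dots> \<longleftrightarrow> k * n + n \<le> a + (n - 1 - d)" by (simp add: add.commute)
    also have "\<dots> \<longleftrightarrow> k * n + d < a" using d by linarith
    finally show ?thesis by blast
  qed
  have "{t. t < a \<and> t mod n = d} = (\<lambda>k. k * n + d) ` {..<K}"
  proof (intro equalityI subsetI)
    fix t assume t: "t \<in> {t. t < a \<and> t mod n = d}"
    then have eq: "t div n * n + d = t" using div_mult_mod_eq[of t n] by simp
    then have "t div n < K" using t lt[of "t div n"] by simp
    then show "t \<in> (\<lambda>k. k * n + d) ` {..<K}" using eq by (intro image_eqI[of _ _ "t div n"]) simp_all
  next
    fix t assume "t \<in> (\<lambda>k. k * n + d) ` {..<K}"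
    then obtain k where k: "t = k * n + d" "k < K" by blast
    have "t mod n = d" unfolding k(1) using d by simp
    moreover have "t < a" unfolding k(1) lt by (rule k(2))
    ultimately show "t \<in> {t. t < a \<and> t mod n = d}" by simp
  qed
  moreover have "inj_on (\<lambda>k. k * n + d) {..<K}" using n by (auto simp: inj_on_def)
  ultimately have "card {t. t < a \<and> t mod n = d} = K" by (simp add: card_image)
  moreover have "K = m \<longleftrightarrow> m * n \<le> a + (n - 1 - d) \<and> a + (n - 1 - d) < m * n + n"
  proof
    assume "K = m"
    then show "m * n \<le> a + (n - 1 - d) \<and> a + (n - 1 - d) < m * n + n"
      unfolding K_def using div_times_less_eq_dividend[of "a + (n - 1 - d)" n]
        dividend_less_div_times[OF n, of "a + (n - 1 - d)"] by simp
  next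
    assume "m * n \<le> a + (n - 1 - d) \<and> a + (n - 1 - d) < m * n + n"
    then show "K = m" unfolding K_def
      by (rule_tac div_nat_eqI) (simp_all add: mult.commute)
  qed
  ultimately show ?thesis by simp
qed

text \<open>\<open>n\<close> is the size of the orbit of \<open>h\<close>, and \<open>d\<close> is
  the distance from \<open>h\<close> to \<open>h'\<close> along it. The way back has residue
  \<open>n - d\<close>, or 0 when the two points coincide.\<close>

lemma orbit_period:
  fixes f :: "'x \<Rightarrow> 'x"
  assumes inj: "inj f" and ret: "\<exists>r>0. (f ^^ r) h = h" and reach: "(f ^^ t0) h = h'"
  shows "\<exists>n d. d < n \<and> (\<forall>s. (f ^^ s) h = h \<longleftrightarrow> s mod n = 0) \<and> (\<forall>s. (f ^^ s) h' = h' \<longleftrightarrow> s mod n = 0) \<and>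
    (\<forall>t. (f ^^ t) h = h' \<longleftrightarrow> t mod n = d) \<and>
    (\<forall>t. (f ^^ t) h' = h \<longleftrightarrow> t mod n = (if d = 0 then 0 else n - d)) \<and> (d = 0 \<longleftrightarrow> h = h')"
proof -
  define n where "n = (LEAST r. 0 < r \<and> (f ^^ r) h = h)"
  have n: "n > 0" "(f ^^ n) h = h" using LeastI_ex[OF ret] by (auto simp: n_def)
  have least: "r = 0" if "r < n" "(f ^^ r) h = h" for r
    using not_less_Least[of r "\<lambda>r. 0 < r \<and> (f ^^ r) h = h"] that by (auto simp: n_def)
  have fm: "(f ^^ t) h = (f ^^ (t mod n)) h" for t using funpow_mod_eq[OF n(2)] by simp
  have iffh: "(f ^^ s) h = h \<longleftrightarrow> s mod n = 0" for s
    using fm[of s] least[of "s mod n"] n(1) by auto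
  have canc: "(f ^^ k) x = (f ^^ k) y \<longleftrightarrow> x = y" for k x y using inj_fn[OF inj, of k] by (simp add: inj_eq)
  have lt: "i = j" if "i \<le> j" "j < n" "(f ^^ i) h = (f ^^ j) h" for i j
  proof -
    have "(f ^^ j) h = (f ^^ i) ((f ^^ (j - i)) h)"
      using that(1) by (metis comp_apply funpow_add le_add_diff_inverse)
    then have "(f ^^ (j - i)) h = h" using that(3) canc[of i h] by metis
    then have "j - i = 0" using least[of "j - i"] that(2) by simp
    then show ?thesis using that(1) by simp
  qed
  define d where "d = t0 mod n"
  have d: "d < n" using n by (simp add: d_def)
  have h': "h' = (f ^^ d) h" using reach fm[of t0] by (simp add: d_def)
  have add: "(f ^^ s) h' = (f ^^ (s + d)) h" for s by (simp add: h' funpow_add)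
  have 2: "(f ^^ s) h' = h' \<longleftrightarrow> s mod n = 0" for s
  proof -
    have "(f ^^ s) h' = (f ^^ d) ((f ^^ s) h)" unfolding add by (simp add: funpow_add add.commute[of s])
    then show ?thesis using canc[of d] iffh h' by metis
  qed
  have 3: "(f ^^ t) h = h' \<longleftrightarrow> t mod n = d" for t
  proof
    assume "(f ^^ t) h = h'"
    then have eq: "(f ^^ (t mod n)) h = (f ^^ d) h" using fm[of t] h' by simp
    have "t mod n < n" using n by simp
    then show "t mod n = d" using eq d lt[of "t mod n" d] lt[of d "t mod n"] by (metis nle_le)
  qed (use fm[of t] h' in simp)
  have 4: "(f ^^ t) h' = h \<longleftrightarrow> t mod n = (if d = 0 then 0 else n - d)" for t
  proof -
    have u: "t mod n < n" using n by simp
    have "(f ^^ t) h' = h \<longleftrightarrow> (t mod n + d) mod n = 0" unfolding add iffh by (simp only: mod_add_left_eq)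
    also have "\<dots> \<longleftrightarrow> t mod n + d = 0 \<or> t mod n + d = n"
    proof (cases "t mod n + d < n")
      case True
      then have "(t mod n + d) mod n = t mod n + d" by (rule mod_less)
      then show ?thesis using True by linarith
    next
      case False
      then have "(t mod n + d) mod n = (t mod n + d - n) mod n" by (intro le_mod_geq) simp
      also have "\<dots> = t mod n + d - n" using u d by (intro mod_less) linarith
      finally show ?thesis using False n by linarith
    qed
    also have "\<dots> \<longleftrightarrow> t mod n = (if d = 0 then 0 else n - d)"
    proof (cases "d = 0")
      case True
      then show ?thesis using u by simp
    next
      case False
      then have "t mod n + d \<noteq> 0" "t mod n + d = n \<longleftrightarrow> t mod n = n - d" using d by linarith+
      then show ?thesis using False by simp
    qed
    finally show ?thesis .
  qed
  have "h = h' \<longleftrightarrow> d mod n = 0" unfolding h' iffh[of d, symmetric] by (rule eq_commute)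
  then have 5: "d = 0 \<longleftrightarrow> h = h'" using d by simp
  show ?thesis
    by (rule exI[of _ n], rule exI[of _ d], intro conjI allI) (rule d iffh 2 3 4 5)+
qed

lemma multiple_between:
  fixes k m n c :: nat
  assumes "k * n + c \<le> m * n" "m * n < k * n + c + n" "c < n" "0 < c"
  shows "Suc k = m"
proof -
  have "k * n < m * n" using assms by linarith
  then have "k < m" by simp
  moreover have "m * n < (k + 2) * n" using assms by (simp add: algebra_simps)
  then have "m < k + 2" by (metis mult_less_cancel2)
  ultimately show ?thesis by simp
qed

text \<open>\<open>S\<close> and \<open>T\<close> are the shifts in the two directions. The lengths
  exceed the largest ones, \<open>s0\<close> and \<open>t1\<close>, by at most one period
  \<open>n\<close>. Their partners complete them to multiples of \<open>n\<close>, and since both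
  sums are below both lengths, it is the same multiple \<open>m * n\<close>. Hence both lengths lie
  above \<open>m * n\<close> and at most one period beyond it.\<close>

lemma shift_arithmetic_forward:
  fixes a a' d n :: nat
  defines "d' \<equiv> (if d = 0 then 0 else n - d)"
  defines "S \<equiv> {s. s < a' \<and> s mod n = d' \<and> a' \<le> s + a}"
  defines "T \<equiv> {t. t < a \<and> t mod n = d \<and> a \<le> t + a'}"
  assumes d: "d < n"
    and S: "\<And>s. s \<in> S \<Longrightarrow> \<exists>t\<in>T. s + t < a \<and> s + t < a'"
    and T: "\<And>t. t \<in> T \<Longrightarrow> \<exists>s\<in>S. s + t < a \<and> s + t < a'"
  shows "S = {} \<and> T = {} \<or> d = 0 \<and> a = a' \<or>
    (\<exists>m\<ge>1. card {t. t < a \<and> t mod n = 0} = m + 1 \<and> card {t. t < a' \<and> t mod n = d'} = m \<and>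
      card {t. t < a' \<and> t mod n = 0} = m + 1 \<and> card {t. t < a \<and> t mod n = d} = m)"
proof (cases "S = {}")
  case True
  then show ?thesis using T by blast
next
  case False
  have n: "n > 0" using d by simp
  have finS: "finite S" and finT: "finite T" by (auto simp: S_def T_def)
  have "T \<noteq> {}" using S False by blast
  define s0 where "s0 = Max S"
  define t1 where "t1 = Max T"
  have s0: "s0 \<in> S" and s0m: "\<And>s. s \<in> S \<Longrightarrow> s \<le> s0" using finS False by (auto simp: s0_def)
  have t1: "t1 \<in> T" and t1m: "\<And>t. t \<in> T \<Longrightarrow> t \<le> t1" using finT \<open>T \<noteq> {}\<close> by (auto simp: t1_def)
  obtain t0 where t0: "t0 \<in> T" "s0 + t0 < a" "s0 + t0 < a'" using S[OF s0] by blast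
  obtain s1 where s1: "s1 \<in> S" "s1 + t1 < a" "s1 + t1 < a'" using T[OF t1] by blast
  have dd: "(d' + d) mod n = 0" using d by (auto simp: d'_def)
  have mult: "\<exists>m. s + t = m * n" if "s \<in> S" "t \<in> T" for s t
  proof -
    have "(s + t) mod n = (d' + d) mod n" using that unfolding S_def T_def by (metis (mono_tags, lifting) mem_Collect_eq mod_add_eq)
    then have "(s + t) mod n = 0" using dd by simp
    then show ?thesis by (metis add_0_right div_mult_mod_eq)
  qed
  obtain m where m: "s0 + t0 = m * n" using mult[OF s0 t0(1)] by blast
  obtain m1 where m1: "s1 + t1 = m1 * n" using mult[OF s1(1) t1] by blast
  have "s0 + n \<notin> S" using s0m[of "s0 + n"] n by auto
  then have a's0: "a' \<le> s0 + n" using s0 by (auto simp: S_def)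
  have "t1 + n \<notin> T" using t1m[of "t1 + n"] n by auto
  then have at1: "a \<le> t1 + n" using t1 by (auto simp: T_def)
  have "a \<le> t0 + a'" using t0 by (simp add: T_def)
  then have a_m: "a \<le> m * n + n" using a's0 m by simp
  have a'_m: "a' \<le> m * n + n" using a's0 m by simp
  have a_m1: "a \<le> m1 * n + n" using at1 m1 by simp
  have "m * n < (m1 + 1) * n" using a_m1 m t0 by (simp add: algebra_simps)
  moreover have "m1 * n < (m + 1) * n" using a_m m1 s1 by (simp add: algebra_simps)
  ultimately have mm: "m1 = m" by (metis Suc_eq_plus1 less_Suc_eq_le mult_less_cancel2 order_antisym)
  have am: "m * n < a" "m * n < a'" using m t0 by simp_all
  show ?thesis
  proof (cases "d = 0")
    case True
    have eqm: "r = m * n" if r: "r mod n = 0" "r \<le> m * n" "m * n < r + n" for r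
    proof -
      define k where "k = r div n"
      have k: "r = k * n" using div_mult_mod_eq[of r n] r(1) by (simp add: k_def)
      have "k * n \<le> m * n" "m * n < Suc k * n" using r(2,3) unfolding k by simp_all
      then have "k \<le> m \<and> m < Suc k" using n unfolding mult_le_cancel2 mult_less_cancel2 by blast
      then have "k = m" by linarith
      then show ?thesis using k by simp
    qed
    \<comment> \<open>For equal degrees the largest shifts are \<open>m * n\<close> itself, so their
      partners are 0. A shift by 0 never goes from a shorter chain to a longer one; having it in
      both directions makes the lengths equal.\<close>
    have "s0 mod n = 0" using s0 True by (simp add: S_def d'_def)
    then have "s0 = m * n" by (rule eqm) (use m a's0 am in simp_all)
    then have "t0 = 0" using m by simp
    then have "a \<le> a'" using t0 by (simp add: T_def)
    have "t1 mod n = 0" using t1 True by (simp add: T_def)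
    then have "t1 = m * n" by (rule eqm) (use m1 mm at1 am in simp_all)
    then have "s1 = 0" using m1 mm by simp
    then have "a' \<le> a" using s1 by (simp add: S_def)
    then show ?thesis using True \<open>a \<le> a'\<close> by simp
  next
    case False
    have d': "d' = n - d" "d' < n" "0 < d'" using False d by (auto simp: d'_def)
    define k where "k = t1 div n"
    have t1k: "t1 = k * n + d" using t1 unfolding T_def k_def by (metis (mono_tags, lifting) div_mult_mod_eq mem_Collect_eq)
    \<comment> \<open>For different degrees the largest shifts fall short of \<open>m * n\<close> by
      less than a period, which fixes their quotient as \<open>m - 1\<close>.\<close>
    have k: "Suc k = m"
      by (rule multiple_between[of k n d]) (use t1k m1 mm at1 am d False in simp_all)
    define j where "j = s0 div n"
    have s0j: "s0 = j * n + d'" using s0 unfolding S_def j_def by (metis (mono_tags, lifting) div_mult_mod_eq mem_Collect_eq)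
    have j: "Suc j = m"
      by (rule multiple_between[of j n d']) (use s0j m a's0 am d' in simp_all)
    have kn: "k * n + n = m * n" "j * n + n = m * n" using k j by (metis add.commute mult_Suc)+
    have a1: "a \<le> m * n + d" using at1 t1k kn by simp
    have a2: "a' \<le> m * n + d'" using a's0 s0j kn by simp
    have e1: "(m + 1) * n = m * n + n" by simp
    have "card {t. t < a \<and> t mod n = 0} = m + 1" "card {t. t < a' \<and> t mod n = 0} = m + 1"
      unfolding count_residue_eq_iff[OF n] e1 using am a_m a'_m n by (linarith | intro conjI)+
    moreover have "card {t. t < a \<and> t mod n = d} = m"
      unfolding count_residue_eq_iff[OF d] using am a1 d by linarith
    moreover have "card {t. t < a' \<and> t mod n = d'} = m"
      unfolding count_residue_eq_iff[OF d'(2)] using am a2 d' by linarith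
    moreover have "m \<ge> 1" using k by simp
    ultimately show ?thesis by blast
  qed
qed

text \<open>The counts place \<open>a\<close> above \<open>m * n\<close> and at most at
  \<open>m * n + d\<close>, and \<open>a'\<close> above \<open>m * n\<close> and at most at
  \<open>m * n + d'\<close>. These bounds make \<open>m * n - s\<close> a shift in the opposite
  direction.\<close>

lemma shift_arithmetic_backward:
  fixes a a' d n m :: nat
  defines "d' \<equiv> (if d = 0 then 0 else n - d)"
  assumes d: "d < n"
    and c: "card {t. t < a \<and> t mod n = 0} = m + 1" "card {t. t < a' \<and> t mod n = d'} = m"
      "card {t. t < a' \<and> t mod n = 0} = m + 1" "card {t. t < a \<and> t mod n = d} = m"
    and s: "s < a'" "s mod n = d'" "a' \<le> s + a"
  shows "s \<le> m * n" "m * n - s < a" "(m * n - s) mod n = d" "a \<le> (m * n - s) + a'"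
    "m * n < a" "a \<le> m * n + n" "m * n < a'" "a' \<le> m * n + n"
proof -
  have n: "n > 0" using d by simp
  \<comment> \<open>Otherwise the first and the last count would refer to one set, of size
    \<open>m + 1\<close> and of size \<open>m\<close>.\<close>
  have d0: "d \<noteq> 0"
  proof
    assume "d = 0"
    then show False using c by simp
  qed
  have d': "d' = n - d" "d' < n" "0 < d'" using d0 d by (auto simp: d'_def)
  have e1: "(m + 1) * n = m * n + n" by simp
  have a: "m * n < a" "a \<le> m * n + n" and a': "m * n < a'" "a' \<le> m * n + n"
    using c(1,3) n e1 unfolding count_residue_eq_iff[OF n] e1 by linarith+
  then show "m * n < a" "a \<le> m * n + n" "m * n < a'" "a' \<le> m * n + n" by simp_all
  have ad: "a \<le> m * n + d" using c(4) d unfolding count_residue_eq_iff[OF d] by linarith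
  have a'd: "a' \<le> m * n + d'" using c(2) d' unfolding count_residue_eq_iff[OF d'(2)] by linarith
  define k where "k = s div n"
  have sk: "s = k * n + d'" using s(2) unfolding k_def by (metis div_mult_mod_eq)
  have "k * n < m * n" using sk s(1) a'd by linarith
  then have "k < m" by simp
  then obtain j where j: "m = Suc (k + j)" using less_imp_Suc_add by blast
  have mn: "m * n = k * n + j * n + n" by (simp add: j algebra_simps)
  have ms: "m * n - s = j * n + d" and sm: "s \<le> m * n" using mn sk d' d by linarith+
  show "s \<le> m * n" by (rule sm)
  show "(m * n - s) mod n = d" using ms d by simp
  show "m * n - s < a" using a by simp
  show "a \<le> (m * n - s) + a'" unfolding ms using ad a' by simp
qed

section \<open>Shifts described by degrees and lengths\<close>

context serial_algebra
begin

text \<open>\<open>x \<mapsto> \<pi> ^ s y\<close> defines a nonzero homomorphism from the chain of degree \<open>h\<close> and length \<open>a\<close>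
  generated by \<open>x\<close> to that of degree \<open>h'\<close> and length \<open>a'\<close> generated by \<open>y\<close>.\<close>
definition valid :: "nat \<Rightarrow> nat \<Rightarrow> nat \<Rightarrow> nat \<Rightarrow> nat \<Rightarrow> bool" where
  "valid h a h' a' s \<longleftrightarrow> s < a' \<and> (\<sigma> ^^ s) h' = h \<and> a' \<le> s + a"

text \<open>From a chain to itself, \<open>valid\<close> reduces to the two conditions of this set,
  so this is the largest shift of the chain into itself.\<close>

definition smax :: "nat \<Rightarrow> nat \<Rightarrow> nat" where
  "smax h a = Max {s. s < a \<and> (\<sigma> ^^ s) h = h}"

text \<open>The multiplicity in a chain of the simple module of degree \<open>h'\<close>, see
  \<open>mult_top_chain\<close>.\<close>

definition tops :: "nat \<Rightarrow> nat \<Rightarrow> nat \<Rightarrow> nat" where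
  "tops h a h' = card {t. t < a \<and> (\<sigma> ^^ t) h = h'}"

lemma sigma_returns: "h < n \<Longrightarrow> \<exists>r>0. (\<sigma> ^^ r) h = h"
  by (rule inj_finite_orbit_returns[OF sigma_inj sigma_less])

lemma orbit_cases:
  assumes "h < n" "(\<sigma> ^^ t0) h = h'"
  obtains p d where "d < p" "\<And>s. (\<sigma> ^^ s) h = h \<longleftrightarrow> s mod p = 0"
    "\<And>s. (\<sigma> ^^ s) h' = h' \<longleftrightarrow> s mod p = 0" "\<And>s. (\<sigma> ^^ s) h = h' \<longleftrightarrow> s mod p = d"
    "\<And>s. (\<sigma> ^^ s) h' = h \<longleftrightarrow> s mod p = (if d = 0 then 0 else p - d)" "d = 0 \<longleftrightarrow> h = h'"
proof -
  obtain p d where H: "d < p" "\<forall>s. (\<sigma> ^^ s) h = h \<longleftrightarrow> s mod p = 0"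
    "\<forall>s. (\<sigma> ^^ s) h' = h' \<longleftrightarrow> s mod p = 0" "\<forall>s. (\<sigma> ^^ s) h = h' \<longleftrightarrow> s mod p = d"
    "\<forall>s. (\<sigma> ^^ s) h' = h \<longleftrightarrow> s mod p = (if d = 0 then 0 else p - d)" "d = 0 \<longleftrightarrow> h = h'"
    using orbit_period[OF sigma_inj sigma_returns[OF assms(1)] assms(2)] by (elim exE conjE) (rule that)
  show thesis
    by (rule that[OF H(1) spec[OF H(2)] spec[OF H(3)] spec[OF H(4)] spec[OF H(5)] H(6)])
qed

text \<open>\<open>\<sigma>\<close> permutes the indices below \<open>n\<close> and keeps the others
  among themselves, so \<open>h'\<close> is below \<open>n\<close> as well. Continuing around its
  finite cycle leads from \<open>h\<close> back to \<open>h'\<close>.\<close>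

lemma sigma_reverse:
  assumes h: "h < n" and s: "(\<sigma> ^^ s) h' = h"
  shows "\<exists>t. (\<sigma> ^^ t) h = h'"
proof -
  have "inj_on \<sigma> {..<n}" using sigma_inj by (simp add: inj_on_def inj_def)
  then have im: "\<sigma> ` {..<n} = {..<n}"
    using sigma_less by (intro card_subset_eq) (auto simp: card_image)
  have out: "n \<le> \<sigma> i" if i: "n \<le> i" for i
  proof (rule ccontr)
    assume "\<not> n \<le> \<sigma> i"
    then have "\<sigma> i \<in> \<sigma> ` {..<n}" unfolding im by simp
    then obtain j where "j < n" "\<sigma> i = \<sigma> j" by blast
    then show False using i injD[OF sigma_inj, of i j] by simp
  qed
  have h': "h' < n"
  proof (rule ccontr)
    assume "\<not> h' < n"
    then have "n \<le> (\<sigma> ^^ k) h'" for k by (induction k) (simp_all add: out)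
    then show False using h s by (metis linorder_not_le)
  qed
  then obtain r where r: "r > 0" "(\<sigma> ^^ r) h' = h'" using sigma_returns by blast
  have "(\<sigma> ^^ (k * r)) h' = h'" for k by (induction k) (simp_all add: funpow_add r)
  moreover have "s * r = (s * r - s) + s" using r(1) by (cases r) auto
  ultimately have "(\<sigma> ^^ ((s * r - s) + s)) h' = h'" by metis
  then have "(\<sigma> ^^ (s * r - s)) h = h'" unfolding funpow_add using s by simp
  then show ?thesis by blast
qed

text \<open>If any shift exists, the two degrees lie on one cycle, and the claim is
  \<open>shift_arithmetic_forward\<close> with degrees replaced by residues modulo its
  length.\<close>

lemma valid_shifts_dual:
  assumes h: "h < n" "h' < n"
    and S: "\<And>s. valid h a h' a' s \<Longrightarrow> \<exists>t. valid h' a' h a t \<and> s + t < a \<and> s + t < a'"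
    and T: "\<And>t. valid h' a' h a t \<Longrightarrow> \<exists>s. valid h a h' a' s \<and> s + t < a \<and> s + t < a'"
  shows "(\<forall>s. \<not> valid h a h' a' s) \<and> (\<forall>s. \<not> valid h' a' h a s) \<or> h = h' \<and> a = a' \<or>
    (\<exists>m\<ge>1. tops h a h = m + 1 \<and> tops h' a' h = m \<and> tops h' a' h' = m + 1 \<and> tops h a h' = m)"
proof (cases "\<exists>s. valid h a h' a' s \<or> valid h' a' h a s")
  case True
  then have "\<exists>t. (\<sigma> ^^ t) h = h'" using sigma_reverse[OF h(1)] by (auto simp: valid_def)
  then obtain t0 where t0: "(\<sigma> ^^ t0) h = h'" by blast
  obtain p d where o: "d < p" "\<And>s. (\<sigma> ^^ s) h = h \<longleftrightarrow> s mod p = 0"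
    "\<And>s. (\<sigma> ^^ s) h' = h' \<longleftrightarrow> s mod p = 0" "\<And>s. (\<sigma> ^^ s) h = h' \<longleftrightarrow> s mod p = d"
    "\<And>s. (\<sigma> ^^ s) h' = h \<longleftrightarrow> s mod p = (if d = 0 then 0 else p - d)" "d = 0 \<longleftrightarrow> h = h'"
    by (rule orbit_cases[OF h(1) t0]) (rule that)
  let ?S = "{s. s < a' \<and> s mod p = (if d = 0 then 0 else p - d) \<and> a' \<le> s + a}"
  let ?T = "{t. t < a \<and> t mod p = d \<and> a \<le> t + a'}"
  have vS: "s \<in> ?S \<longleftrightarrow> valid h a h' a' s" for s by (simp add: valid_def o(5))
  have vT: "t \<in> ?T \<longleftrightarrow> valid h' a' h a t" for t by (simp add: valid_def o(4))
  have "?S = {} \<and> ?T = {} \<or> d = 0 \<and> a = a' \<or>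
    (\<exists>m\<ge>1. card {t. t < a \<and> t mod p = 0} = m + 1 \<and>
      card {t. t < a' \<and> t mod p = (if d = 0 then 0 else p - d)} = m \<and>
      card {t. t < a' \<and> t mod p = 0} = m + 1 \<and> card {t. t < a \<and> t mod p = d} = m)"
  proof (rule shift_arithmetic_forward[OF o(1)])
    show "\<exists>t\<in>?T. s + t < a \<and> s + t < a'" if "s \<in> ?S" for s using S[of s] that vS vT by meson
    show "\<exists>s\<in>?S. s + t < a \<and> s + t < a'" if "t \<in> ?T" for t using T[of t] that vS vT by meson
  qed
  then show ?thesis
  proof (elim disjE)
    assume "?S = {} \<and> ?T = {}"
    then show ?thesis using vS vT by blast
  next
    assume "d = 0 \<and> a = a'"
    then show ?thesis using o(6) by blast
  qed (simp only: tops_def o(2-5), blast)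
qed blast

text \<open>The dual basis of the socle form rests on this reversal. For chains of the same type,
  cancelling \<open>\<sigma> ^^ s\<close> shows that the difference is again a self-shift; otherwise
  \<open>shift_arithmetic_backward\<close> applies and both maxima equal
  \<open>m * p\<close>.\<close>

lemma valid_reverse:
  assumes h: "h < n" "h' < n"
    and cases: "(\<forall>s. \<not> valid h a h' a' s) \<or> h = h' \<and> a = a' \<or>
      (\<exists>m. tops h a h = m + 1 \<and> tops h' a' h = m \<and> tops h' a' h' = m + 1 \<and> tops h a h' = m)"
    and v: "valid h a h' a' s"
  shows "s \<le> smax h a \<and> smax h' a' = smax h a \<and> valid h' a' h a (smax h a - s)"
  using cases
proof (elim disjE)
  assume eq: "h = h' \<and> a = a'"
  let ?A = "{s. s < a \<and> (\<sigma> ^^ s) h = h}"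
  have fin: "finite ?A" by simp
  have sA: "s \<in> ?A" using v eq by (simp add: valid_def)
  have mA: "smax h a \<in> ?A" unfolding smax_def by (rule Max_in[OF fin]) (use sA in blast)
  have le: "s \<le> smax h a" unfolding smax_def by (rule Max_ge[OF fin sA])
  have "(\<sigma> ^^ s) ((\<sigma> ^^ (smax h a - s)) h) = (\<sigma> ^^ smax h a) h"
    using le by (metis comp_apply funpow_add le_add_diff_inverse)
  also have "\<dots> = (\<sigma> ^^ s) h" using mA sA by simp
  finally have "(\<sigma> ^^ (smax h a - s)) h = h" using inj_fn[OF sigma_inj, of s] by (simp add: inj_eq)
  then show ?thesis using le mA eq by (auto simp: valid_def)
next
  assume "\<exists>m. tops h a h = m + 1 \<and> tops h' a' h = m \<and> tops h' a' h' = m + 1 \<and> tops h a h' = m"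
  then obtain m where m: "tops h a h = m + 1" "tops h' a' h = m" "tops h' a' h' = m + 1" "tops h a h' = m"
    by blast
  obtain t0 where t0: "(\<sigma> ^^ t0) h = h'" using sigma_reverse[OF h(1)] v unfolding valid_def by blast
  obtain p d where o: "d < p" "\<And>s. (\<sigma> ^^ s) h = h \<longleftrightarrow> s mod p = 0"
    "\<And>s. (\<sigma> ^^ s) h' = h' \<longleftrightarrow> s mod p = 0" "\<And>s. (\<sigma> ^^ s) h = h' \<longleftrightarrow> s mod p = d"
    "\<And>s. (\<sigma> ^^ s) h' = h \<longleftrightarrow> s mod p = (if d = 0 then 0 else p - d)" "d = 0 \<longleftrightarrow> h = h'"
    by (rule orbit_cases[OF h(1) t0]) (rule that)
  have s: "s < a'" "s mod p = (if d = 0 then 0 else p - d)" "a' \<le> s + a"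
    using v by (simp_all add: valid_def o(5))
  note A = shift_arithmetic_backward[OF o(1) m[unfolded tops_def o(2-5)] s]
  have mx: "Max {s. s < b \<and> s mod p = 0} = m * p" if b: "m * p < b" "b \<le> m * p + p" for b
  proof (rule Max_eqI)
    show "m * p \<in> {s. s < b \<and> s mod p = 0}" using b by simp
    fix y assume "y \<in> {s. s < b \<and> s mod p = 0}"
    then have y: "y < b" "y mod p = 0" by simp_all
    define k where "k = y div p"
    have k: "y = k * p" using div_mult_mod_eq[of y p] y(2) by (simp add: k_def)
    then have "k * p < Suc m * p" using y(1) b(2) by simp
    then have "k < Suc m" unfolding mult_less_cancel2 by blast
    then have "k \<le> m" by simp
    then show "y \<le> m * p" using k by simp
  qed simp
  have "smax h a = m * p" "smax h' a' = m * p"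
    unfolding smax_def o(2,3) using mx A(5-8) by blast+
  then show ?thesis using A(1-4) by (simp add: valid_def o(4))
qed (use v in blast)

end

section \<open>Endomorphisms of sums of chains\<close>

context serial_module
begin

abbreviation E :: "('m \<Rightarrow> 'm) set" where "E \<equiv> End_set sm act M"

lemma End_in: "f \<in> E \<Longrightarrow> u \<in> M \<Longrightarrow> f u \<in> M"
  and End_out: "f \<in> E \<Longrightarrow> u \<notin> M \<Longrightarrow> f u = 0"
  and End_add: "f \<in> E \<Longrightarrow> u \<in> M \<Longrightarrow> v \<in> M \<Longrightarrow> f (u + v) = f u + f v"
  and End_sm: "f \<in> E \<Longrightarrow> u \<in> M \<Longrightarrow> f (sm c u) = sm c (f u)"
  and End_act: "f \<in> E \<Longrightarrow> u \<in> M \<Longrightarrow> f (act r u) = act r (f u)"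
  by (simp_all add: End_set_def)

lemma End_pw: "f \<in> E \<Longrightarrow> u \<in> M \<Longrightarrow> f (pw k u) = pw k (f u)"
  by (simp add: pw_def End_act)

lemma End_0: "f \<in> E \<Longrightarrow> f 0 = 0"
  using End_add[of f 0 0] by simp

lemma End_sum: "f \<in> E \<Longrightarrow> (\<And>i. i \<in> I \<Longrightarrow> g i \<in> M) \<Longrightarrow> f (sum g I) = (\<Sum>i\<in>I. f (g i))"
  by (induction I rule: infinite_finite_induct) (simp_all add: End_0 End_add)

lemma End_lc: "f \<in> E \<Longrightarrow> x \<in> M \<Longrightarrow> f (lc x a c) = lc (f x) a c"
  by (simp add: lc_def End_sum End_sm End_pw)

lemma End_hom: "f \<in> E \<Longrightarrow> hom h x \<Longrightarrow> hom h (f x)"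
  using End_act[of f x "e h"] by (simp add: hom_def End_in)

text \<open>By \<open>act_expand\<close> it is enough to commute with \<open>\<pi>\<close> and the
  idempotents.\<close>

lemma EndI:
  assumes inM: "\<And>u. u \<in> M \<Longrightarrow> f u \<in> M" and out: "\<And>u. u \<notin> M \<Longrightarrow> f u = 0"
    and add: "\<And>u v. u \<in> M \<Longrightarrow> v \<in> M \<Longrightarrow> f (u + v) = f u + f v"
    and sm: "\<And>c u. u \<in> M \<Longrightarrow> f (sm c u) = sm c (f u)"
    and pw1: "\<And>u. u \<in> M \<Longrightarrow> f (pw 1 u) = pw 1 (f u)"
    and e: "\<And>i u. u \<in> M \<Longrightarrow> f (act (e i) u) = act (e i) (f u)"
  shows "f \<in> E"
proof -
  have pw: "f (pw k u) = pw k (f u)" if u: "u \<in> M" for k u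
  proof (induction k)
    case (Suc k)
    have "f (pw (Suc k) u) = f (pw 1 (pw k u))" using u by (simp add: pw_pw)
    also have "\<dots> = pw 1 (pw k (f u))" using u Suc by (simp only: pw1 pw_in)
    finally show ?case using inM[OF u] by (simp add: pw_pw)
  qed (use u inM in simp)
  have f0: "f 0 = 0" using add[of 0 0] by simp
  have sum: "f (sum g I) = (\<Sum>i\<in>I. f (g i))" if "\<And>i. i \<in> I \<Longrightarrow> g i \<in> M" for g :: "nat \<Rightarrow> 'm" and I
    using that by (induction I rule: infinite_finite_induct) (simp_all add: f0 add)
  have act: "f (act r u) = act r (f u)" if u: "u \<in> M" for r u
  proof -
    obtain c where c: "\<forall>x\<in>M. act r x = (\<Sum>i<n. \<Sum>t<N. sm (c i t) (pw t (act (e i) x)))"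
      using act_expand by blast
    have 1: "act r u = (\<Sum>i<n. \<Sum>t<N. sm (c i t) (pw t (act (e i) u)))" using c u by blast
    have 2: "act r (f u) = (\<Sum>i<n. \<Sum>t<N. sm (c i t) (pw t (act (e i) (f u))))"
      using c inM[OF u] by blast
    show ?thesis unfolding 1 2 using u by (simp add: sum sm pw e)
  qed
  show ?thesis unfolding End_set_def using inM out add sm act by blast
qed

lemma comp_End: "f \<in> E \<Longrightarrow> g \<in> E \<Longrightarrow> f \<circ> g \<in> E"
  by (rule EndI) (simp_all add: End_in End_out End_0 End_add End_sm End_pw End_act)

lemma add_End: "f \<in> E \<Longrightarrow> g \<in> E \<Longrightarrow> (\<lambda>u. f u + g u) \<in> E"
  by (rule EndI) (simp_all add: End_in End_out End_add End_sm End_pw End_act sm_add pw_add act_add)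

lemma sm_End: "f \<in> E \<Longrightarrow> (\<lambda>u. sm c (f u)) \<in> E"
  by (rule EndI)
    (simp_all add: End_in End_out End_add End_sm End_pw End_act sm_add pw_sm act_sm sm_sm mult.commute)

lemma zero_End: "(\<lambda>u. 0) \<in> E"
  by (rule EndI) simp_all

lemma sum_End: "(\<And>i. i \<in> I \<Longrightarrow> f i \<in> E) \<Longrightarrow> (\<lambda>u. \<Sum>i\<in>I. f i u) \<in> E"
  by (induction I rule: infinite_finite_induct) (simp_all add: zero_End add_End)

text \<open>Elements of \<open>E\<close> vanish outside \<open>M\<close>, so the unit of the
  endomorphism ring is the identity cut off there.\<close>

definition idM :: "'m \<Rightarrow> 'm" where "idM u = (if u \<in> M then u else 0)"

lemma idM_End: "idM \<in> E"
  by (rule EndI) (simp_all add: idM_def)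

lemma idM_comp: "f \<in> E \<Longrightarrow> idM \<circ> f = f" "f \<in> E \<Longrightarrow> f \<circ> idM = f"
  by (auto simp: idM_def fun_eq_iff End_out End_0)
    (metis End_in End_out zero_in)+

text \<open>\<open>\<theta>\<close> is the coefficient of the socle element
  \<open>pw (a - 1) x\<close> of a chain that splits off \<open>M\<close>. The conditions on
  \<open>pw a\<close> and on the idempotents are what makes the map \<open>extend\<close> below
  commute with \<open>\<pi>\<close> and preserve degrees.\<close>

definition coord :: "nat \<Rightarrow> nat \<Rightarrow> 'm \<Rightarrow> ('m \<Rightarrow> 'k) \<Rightarrow> bool" where
  "coord h a x \<theta> \<longleftrightarrow> chain x h a \<and> a > 0 \<and>
    (\<forall>u\<in>M. \<forall>v\<in>M. \<theta> (u + v) = \<theta> u + \<theta> v) \<and> (\<forall>c. \<forall>u\<in>M. \<theta> (sm c u) = c * \<theta> u) \<and>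
    (\<forall>u\<in>M. \<theta> (pw a u) = 0) \<and>
    (\<forall>u\<in>M. \<forall>i. \<theta> (act (e i) u) = (if i = (\<sigma> ^^ (a - 1)) h then \<theta> u else 0)) \<and>
    (\<forall>k. \<theta> (pw k x) = (if k = a - 1 then 1 else 0))"

lemma coord_add: "coord h a x \<theta> \<Longrightarrow> u \<in> M \<Longrightarrow> v \<in> M \<Longrightarrow> \<theta> (u + v) = \<theta> u + \<theta> v"
  and coord_sm: "coord h a x \<theta> \<Longrightarrow> u \<in> M \<Longrightarrow> \<theta> (sm c u) = c * \<theta> u"
  and coord_pw_a: "coord h a x \<theta> \<Longrightarrow> u \<in> M \<Longrightarrow> \<theta> (pw a u) = 0"
  and coord_e: "coord h a x \<theta> \<Longrightarrow> u \<in> M \<Longrightarrow>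
    \<theta> (act (e i) u) = (if i = (\<sigma> ^^ (a - 1)) h then \<theta> u else 0)"
  and coord_gen: "coord h a x \<theta> \<Longrightarrow> \<theta> (pw k x) = (if k = a - 1 then 1 else 0)"
  and coord_chain: "coord h a x \<theta> \<Longrightarrow> chain x h a"
  and coord_pos: "coord h a x \<theta> \<Longrightarrow> 0 < a"
  by (auto simp: coord_def)

lemma coord_0: "coord h a x \<theta> \<Longrightarrow> \<theta> 0 = 0"
  using coord_sm[of h a x \<theta> 0 0] by simp

lemma coord_sum: "coord h a x \<theta> \<Longrightarrow> (\<And>i. i \<in> I \<Longrightarrow> g i \<in> M) \<Longrightarrow> \<theta> (sum g I) = (\<Sum>i\<in>I. \<theta> (g i))"
  by (induction I rule: infinite_finite_induct) (simp_all add: coord_0 coord_add)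

text \<open>\<open>extend \<theta> a y\<close> is the endomorphism sending the generator of a chain summand with coordinate
  functional \<open>\<theta>\<close> to \<open>y\<close> and killing the complement: the functional reads off the coefficient of the
  socle element, so the coefficient of the \<open>t\<close>-th element is read off after shifting by
  \<open>a - 1 - t\<close>.\<close>
definition extend :: "('m \<Rightarrow> 'k) \<Rightarrow> nat \<Rightarrow> 'm \<Rightarrow> 'm \<Rightarrow> 'm" where
  "extend \<theta> a y z = (if z \<in> M then lc y a (\<lambda>t. \<theta> (pw (a - 1 - t) z)) else 0)"

lemma extend_End:
  assumes c: "coord h a x \<theta>" and y: "hom h y" "pw a y = 0"
  shows "extend \<theta> a y \<in> E"
proof (rule EndI)
  have yM: "y \<in> M" using y by simp
  obtain b where b: "a = Suc b" using coord_pos[OF c] by (cases a) auto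
  show "extend \<theta> a y u \<in> M" if "u \<in> M" for u using that yM by (simp add: extend_def)
  show "extend \<theta> a y u = 0" if "u \<notin> M" for u using that by (simp add: extend_def)
  show "extend \<theta> a y (u + v) = extend \<theta> a y u + extend \<theta> a y v" if "u \<in> M" "v \<in> M" for u v
    using that yM by (simp add: extend_def lc_add pw_add coord_add[OF c])
  show "extend \<theta> a y (sm s u) = sm s (extend \<theta> a y u)" if "u \<in> M" for s u
    using that yM by (simp add: extend_def lc_sm pw_sm coord_sm[OF c])
  show "extend \<theta> a y (pw 1 u) = pw 1 (extend \<theta> a y u)" if u: "u \<in> M" for u
  proof -
    have "extend \<theta> a y (pw 1 u) = (\<Sum>t<Suc b. sm (\<theta> (pw (b - t + 1) u)) (pw t y))"
      using u by (simp add: extend_def lc_def b pw_pw)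
    \<comment> \<open>The term \<open>t = 0\<close> drops out because \<open>\<theta>\<close> kills
      the image of \<open>\<pi> ^ a\<close>.\<close>
    also have "\<dots> = (\<Sum>t<b. sm (\<theta> (pw (b - Suc t + 1) u)) (pw (Suc t) y))"
      using coord_pw_a[OF c u] yM unfolding sum.lessThan_Suc_shift by (simp add: b)
    also have "\<dots> = (\<Sum>t<b. sm (\<theta> (pw (b - t) u)) (pw (Suc t) y))"
      by (rule sum.cong) (auto simp: Suc_diff_Suc)
    \<comment> \<open>The new last term is zero by \<open>pw a y = 0\<close>.\<close>
    also have "\<dots> = (\<Sum>t<Suc b. sm (\<theta> (pw (b - t) u)) (pw (Suc t) y))"
      using y(2) u by (simp add: b)
    also have "\<dots> = pw 1 (extend \<theta> a y u)"
      using u yM by (simp add: extend_def lc_def b pw_sum pw_sm pw_pw del: sum.lessThan_Suc)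
    finally show ?thesis .
  qed
  show "extend \<theta> a y (act (e i) u) = act (e i) (extend \<theta> a y u)" if u: "u \<in> M" for i u
  proof -
    have "\<theta> (pw (a - 1 - t) (act (e i) u)) = (if (\<sigma> ^^ t) h = i then \<theta> (pw (a - 1 - t) u) else 0)"
      if t: "t < a" for t
    proof -
      have "a - 1 = (a - 1 - t) + t" using t by simp
      then have "(\<sigma> ^^ (a - 1)) h = (\<sigma> ^^ (a - 1 - t)) ((\<sigma> ^^ t) h)"
        by (metis comp_apply funpow_add)
      moreover have "pw (a - 1 - t) (act (e i) u) = act (e ((\<sigma> ^^ (a - 1 - t)) i)) (pw (a - 1 - t) u)"
        using e_pw[OF u] by simp
      ultimately show ?thesis using coord_e[OF c, of "pw (a - 1 - t) u"] u sigma_power_inj by auto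
    qed
    then have "lc y a (\<lambda>t. \<theta> (pw (a - 1 - t) (act (e i) u))) =
        lc y a (\<lambda>t. if (\<sigma> ^^ t) h = i then \<theta> (pw (a - 1 - t) u) else 0)"
      by (rule lc_cong)
    moreover have "extend \<theta> a y (act (e i) u) = lc y a (\<lambda>t. \<theta> (pw (a - 1 - t) (act (e i) u)))"
      "extend \<theta> a y u = lc y a (\<lambda>t. \<theta> (pw (a - 1 - t) u))"
      using u by (simp_all add: extend_def)
    ultimately show ?thesis by (simp only: lc_e[OF y(1)])
  qed
qed

lemma extend_gen:
  assumes c: "coord h a x \<theta>" and y: "y \<in> M"
  shows "extend \<theta> a y x = y"
proof -
  have x: "x \<in> M" using coord_chain[OF c] by simp
  have "extend \<theta> a y x = lc y a (\<lambda>t. if t = 0 then 1 else 0)"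
    unfolding extend_def using x by (auto intro!: lc_cong simp: coord_gen[OF c])
  then show ?thesis using lc_single[OF y, of 0 a 1] coord_pos[OF c] y by simp
qed

lemma End_extend: "f \<in> E \<Longrightarrow> y \<in> M \<Longrightarrow> f (extend \<theta> a y z) = extend \<theta> a (f y) z"
  by (simp add: extend_def End_lc End_0)

lemma End_comp_extend: "f \<in> E \<Longrightarrow> y \<in> M \<Longrightarrow> f \<circ> extend \<theta> a y = extend \<theta> a (f y)"
  by (simp add: fun_eq_iff End_extend)

lemma lc_add_base: "x \<in> M \<Longrightarrow> y \<in> M \<Longrightarrow> lc (x + y) a c = lc x a c + lc y a c"
  by (simp add: lc_def pw_add sm_add sum.distrib)

lemma lc_sm_base: "x \<in> M \<Longrightarrow> lc (sm s x) a c = sm s (lc x a c)"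
  by (simp add: lc_def pw_sm sm_sum sm_sm mult.commute)

lemma extend_add: "x \<in> M \<Longrightarrow> y \<in> M \<Longrightarrow> extend \<theta> a (x + y) z = extend \<theta> a x z + extend \<theta> a y z"
  and extend_sm: "x \<in> M \<Longrightarrow> extend \<theta> a (sm s x) z = sm s (extend \<theta> a x z)"
  by (simp_all add: extend_def lc_add_base lc_sm_base)

lemma extend_0: "extend \<theta> a 0 z = 0"
  by (simp add: extend_def lc_def)

lemma extend_sum:
  "(\<And>i. i \<in> I \<Longrightarrow> y i \<in> M) \<Longrightarrow> extend \<theta> a (sum y I) z = (\<Sum>i\<in>I. extend \<theta> a (y i) z)"
  by (induction I rule: infinite_finite_induct) (simp_all add: extend_0 extend_add)

lemma coord_exists:
  assumes ch: "chain x h a" and a: "a > 0" and d: "dsum2 sm act (W x a 0) Y M"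
  shows "\<exists>\<theta>. coord h a x \<theta> \<and> (\<forall>c. \<forall>v\<in>Y. \<theta> (lc x a c + v) = c (a - 1))"
proof -
  have x: "x \<in> M" using ch by simp
  have X: "submod sm act (W x a 0)" and Y: "submod sm act Y" and XY: "W x a 0 \<inter> Y = {0}"
    and sum: "{u + v |u v. u \<in> W x a 0 \<and> v \<in> Y} = M" using d by (auto simp: dsum2_def)
  have YM: "v \<in> M" if v: "v \<in> Y" for v
  proof -
    have "0 + v \<in> {u + v |u v. u \<in> W x a 0 \<and> v \<in> Y}" using v sub_0[OF X] by blast
    then show ?thesis unfolding sum by simp
  qed
  have dec: "\<exists>c v. z = lc x a c + v \<and> v \<in> Y" if z: "z \<in> M" for z
  proof -
    have "z \<in> {u + v |u v. u \<in> W x a 0 \<and> v \<in> Y}" using z unfolding sum .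
    then show ?thesis by (auto simp: W_def)
  qed
  \<comment> \<open>The chosen coefficient function is not unique, but its values below
    \<open>a\<close> are, in particular the one at \<open>a - 1\<close>.\<close>
  define \<theta> where "\<theta> z = (SOME c. \<exists>v\<in>Y. z = lc x a c + v) (a - 1)" for z
  have uniq: "c (a - 1) = c' (a - 1)" if eq: "lc x a c + v = lc x a c' + v'" and v: "v \<in> Y" "v' \<in> Y"
    for c c' v v'
  proof -
    have "lc x a (\<lambda>t. c t - c' t) = lc x a c - lc x a c'" by (rule lc_diff[OF x, symmetric])
    also have "lc x a c = lc x a c' + v' - v" using eq by (metis add_diff_cancel_right')
    also have "lc x a c' + v' - v - lc x a c' = v' - v" by (simp add: algebra_simps)
    finally have "lc x a (\<lambda>t. c t - c' t) = v' - v" .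
    then have "lc x a (\<lambda>t. c t - c' t) \<in> Y" using sub_diff[OF Y v(2,1)] by simp
    moreover have "lc x a (\<lambda>t. c t - c' t) \<in> W x a 0" by (rule W_I) simp
    ultimately have "lc x a (\<lambda>t. c t - c' t) = 0" using XY by blast
    then have "c (a - 1) - c' (a - 1) = 0" by (rule lc_eq_0[OF ch]) (use a in simp)
    then show ?thesis by simp
  qed
  have th: "\<theta> (lc x a c + v) = c (a - 1)" if v: "v \<in> Y" for c v
  proof -
    let ?P = "\<lambda>d. \<exists>v'\<in>Y. lc x a c + v = lc x a d + v'"
    have "?P c" using v by blast
    then have "?P (SOME d. ?P d)" by (rule someI[of ?P c])
    then obtain v' where v': "v' \<in> Y" "lc x a c + v = lc x a (SOME d. ?P d) + v'" by blast
    have "c (a - 1) = (SOME d. ?P d) (a - 1)" by (rule uniq[OF v'(2) v v'(1)])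
    then show ?thesis by (simp add: \<theta>_def)
  qed
  have "coord h a x \<theta>"
    unfolding coord_def
  proof (intro conjI ballI allI)
    fix u assume "u \<in> M"
    then obtain c v where u: "u = lc x a c + v" "v \<in> Y" using dec by blast
    have vM: "v \<in> M" using YM u by blast
    show "\<theta> (sm s u) = s * \<theta> u" for s
      using th[OF sub_sm[OF Y u(2), of s], of "\<lambda>t. s * c t"] th[OF u(2), of c] x vM
      by (simp add: u(1) sm_add lc_sm)
    show "\<theta> (pw a u) = 0"
      using th[OF sub_pw[OF Y u(2), of a], of "\<lambda>t. if t < a then 0 else c (t - a)"] x vM a
      by (simp add: u(1) pw_add lc_pw[OF ch])
    show "\<theta> (act (e i) u) = (if i = (\<sigma> ^^ (a - 1)) h then \<theta> u else 0)" for i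
      using th[OF sub_act[OF Y u(2), of "e i"], of "\<lambda>t. if (\<sigma> ^^ t) h = i then c t else 0"]
        th[OF u(2), of c] x vM by (auto simp: u(1) act_add lc_e[OF chain_hom[OF ch]])
    fix u' assume "u' \<in> M"
    then obtain c' v' where u': "u' = lc x a c' + v'" "v' \<in> Y" using dec by blast
    have "lc x a c + lc x a c' = lc x a (\<lambda>t. c t + c' t)" by (rule lc_add[OF x])
    then have eq: "u + u' = lc x a (\<lambda>t. c t + c' t) + (v + v')" unfolding u(1) u'(1)
      by (simp add: algebra_simps)
    have "\<theta> (u + u') = c (a - 1) + c' (a - 1)" unfolding eq by (rule th[OF sub_add[OF Y u(2) u'(2)]])
    then show "\<theta> (u + u') = \<theta> u + \<theta> u'"
      using th[OF u(2), of c] th[OF u'(2), of c'] by (simp add: u(1) u'(1))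
  next
    fix k
    show "\<theta> (pw k x) = (if k = a - 1 then 1 else 0)"
    proof (cases "k < a")
      case True
      then show ?thesis
        using th[OF sub_0[OF Y], of "\<lambda>t. if t = k then 1 else 0"] lc_single[OF x True, of 1] x by auto
    next
      case False
      then have "pw k x = 0" using chain_pw_0[OF ch, of k] by simp
      then show ?thesis using th[OF sub_0[OF Y], of "\<lambda>t. 0"] x False a by auto
    qed
  qed (rule ch a)+
  then show ?thesis using th by blast
qed

lemma coord_hom:
  assumes c: "coord h a x \<theta>" and y: "hom h' y" and t: "t < a" and nz: "\<theta> (pw (a - 1 - t) y) \<noteq> 0"
  shows "(\<sigma> ^^ t) h = h'"
proof -
  have yM: "y \<in> M" using y by simp
  have "\<theta> (pw (a - 1 - t) y) = \<theta> (act (e ((\<sigma> ^^ (a - 1 - t)) h')) (pw (a - 1 - t) y))"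
    using hom_pw[OF y] by (simp add: hom_def)
  then have "(\<sigma> ^^ (a - 1 - t)) h' = (\<sigma> ^^ (a - 1)) h" using coord_e[OF c] yM nz by (auto split: if_splits)
  moreover have "(\<sigma> ^^ (a - 1)) h = (\<sigma> ^^ (a - 1 - t)) ((\<sigma> ^^ t) h)"
  proof -
    have "a - 1 = (a - 1 - t) + t" using t by simp
    then show ?thesis by (metis comp_apply funpow_add)
  qed
  ultimately show ?thesis using sigma_power_inj by metis
qed

text \<open>To be read with \<open>y\<close> the image of a generator of degree \<open>h'\<close>
  and length \<open>b\<close>: a homomorphism has nonzero coefficients only at valid shifts.\<close>

lemma coord_valid:
  assumes c: "coord h a x \<theta>" and y: "hom h' y" "pw b y = 0" and t: "t < a"
    and nz: "\<theta> (pw (a - 1 - t) y) \<noteq> 0"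
  shows "valid h' b h a t"
proof -
  have "a \<le> t + b"
  proof (rule ccontr)
    assume "\<not> a \<le> t + b"
    then have "a - 1 - t = (a - 1 - t - b) + b" by linarith
    then have "pw (a - 1 - t) y = pw (a - 1 - t - b) (pw b y)" using y by (metis hom_in pw_pw)
    then show False using y nz coord_0[OF c] by simp
  qed
  then show ?thesis using coord_hom[OF c y(1) t nz] t by (simp add: valid_def)
qed

lemma valid_shift:
  assumes y: "chain y h' b" and v: "valid h a h' b s"
  shows "hom h (pw s y)" "pw a (pw s y) = 0" "pw s y \<noteq> 0" "pw s y \<in> M"
proof -
  show "hom h (pw s y)" using hom_pw[OF chain_hom[OF y], of s] v by (simp add: valid_def)
  show "pw a (pw s y) = 0" using v chain_pw_0[OF y, of "a + s"] y by (simp add: pw_pw valid_def)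
  show "pw s y \<noteq> 0" using chain_pw[OF y, of s] v by (simp add: valid_def)
  show "pw s y \<in> M" using y by simp
qed

end

section \<open>Symmetrizing forms\<close>

context serial_module
begin

definition End_linear :: "(('m \<Rightarrow> 'm) \<Rightarrow> 'k) \<Rightarrow> bool" where
  "End_linear \<phi> \<longleftrightarrow> (\<forall>f\<in>E. \<forall>g\<in>E. \<phi> (\<lambda>u. f u + g u) = \<phi> f + \<phi> g) \<and>
    (\<forall>c. \<forall>f\<in>E. \<phi> (\<lambda>u. sm c (f u)) = c * \<phi> f)"

lemma dual_set_iff: "\<phi> \<in> dual_set sm E \<longleftrightarrow> End_linear \<phi> \<and> (\<forall>f. f \<notin> E \<longrightarrow> \<phi> f = 0)"
  by (auto simp: dual_set_def End_linear_def)

lemma End_linear_add: "End_linear \<phi> \<Longrightarrow> f \<in> E \<Longrightarrow> g \<in> E \<Longrightarrow> \<phi> (\<lambda>u. f u + g u) = \<phi> f + \<phi> g"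
  and End_linear_sm: "End_linear \<phi> \<Longrightarrow> f \<in> E \<Longrightarrow> \<phi> (\<lambda>u. sm c (f u)) = c * \<phi> f"
  by (simp_all add: End_linear_def)

lemma End_linear_0: "End_linear \<phi> \<Longrightarrow> \<phi> (\<lambda>u. 0) = 0"
  using End_linear_sm[OF _ zero_End, of \<phi> 0] by simp

lemma End_linear_sum:
  assumes \<phi>: "End_linear \<phi>" and "finite V" "\<And>v. v \<in> V \<Longrightarrow> k v \<in> E"
  shows "\<phi> (\<lambda>u. \<Sum>v\<in>V. sm (c v) (k v u)) = (\<Sum>v\<in>V. c v * \<phi> (k v))"
  using assms(2,3)
proof (induction V rule: finite_induct)
  case empty
  then show ?case using End_linear_0[OF \<phi>] by simp
next
  case (insert w V)
  have 1: "(\<lambda>u. \<Sum>v\<in>V. sm (c v) (k v u)) \<in> E" using insert by (intro sum_End sm_End) auto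
  have kw: "k w \<in> E" using insert.prems by simp
  note End_linear_add[OF \<phi> sm_End[OF kw, of "c w"] 1]
  moreover note End_linear_sm[OF \<phi> kw, of "c w"]
  ultimately show ?case using insert by simp
qed

lemma End_into: "f \<in> E \<Longrightarrow> f u \<in> M"
  using End_in End_out zero_in by metis

definition symmetrizing :: "(('m \<Rightarrow> 'm) \<Rightarrow> 'k) \<Rightarrow> bool" where
  "symmetrizing \<tau> \<longleftrightarrow> End_linear \<tau> \<and> (\<forall>f\<in>E. \<forall>g\<in>E. \<tau> (f \<circ> g) = \<tau> (g \<circ> f)) \<and>
    (\<forall>f\<in>E. (\<forall>g\<in>E. \<tau> (g \<circ> f) = 0) \<longrightarrow> f = (\<lambda>u. 0))"

text \<open>The form is the image of the unit. Using the bimodule property with units on one side or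
  the other expresses \<open>\<Phi> f y\<close> both as \<open>\<tau> (y \<circ> f)\<close> and as
  \<open>\<tau> (f \<circ> y)\<close>, which is the trace property; injectivity of
  \<open>\<Phi>\<close> gives nondegeneracy.\<close>

lemma symmetric_form:
  assumes "end_symmetric sm act M"
  shows "\<exists>\<tau>. symmetrizing \<tau>"
proof -
  obtain \<Phi> where bij: "bij_betw \<Phi> E (dual_set sm E)"
    and bim: "\<forall>a\<in>E. \<forall>f\<in>E. \<forall>b\<in>E. \<Phi> (a \<circ> f \<circ> b) = (\<lambda>y. if y \<in> E then \<Phi> f (b \<circ> y \<circ> a) else 0)"
    using assms unfolding end_symmetric_def Let_def by blast
  define \<tau> where "\<tau> = \<Phi> idM"
  have "\<tau> \<in> dual_set sm E" unfolding \<tau>_def by (rule bij_betwE[OF bij, rule_format, OF idM_End])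
  then have lin: "End_linear \<tau>" by (simp add: dual_set_iff)
  have 1: "\<Phi> f y = \<tau> (y \<circ> f)" if "f \<in> E" "y \<in> E" for f y
  proof -
    have "\<Phi> (f \<circ> idM \<circ> idM) y = \<Phi> idM (idM \<circ> y \<circ> f)"
      using bim that idM_End by simp
    then show ?thesis using that by (simp add: idM_comp \<tau>_def)
  qed
  have 2: "\<Phi> f y = \<tau> (f \<circ> y)" if "f \<in> E" "y \<in> E" for f y
  proof -
    have "\<Phi> (idM \<circ> idM \<circ> f) y = \<Phi> idM (f \<circ> y \<circ> idM)"
      using bim that idM_End by simp
    then show ?thesis using that idM_End comp_End by (simp add: idM_comp \<tau>_def)
  qed
  have tr: "\<tau> (f \<circ> g) = \<tau> (g \<circ> f)" if "f \<in> E" "g \<in> E" for f g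
    using 1[OF that] 2[OF that] by simp
  have nd: "f = (\<lambda>u. 0)" if f: "f \<in> E" and z: "\<And>g. g \<in> E \<Longrightarrow> \<tau> (g \<circ> f) = 0" for f
  proof -
    have out: "\<Phi> g y = 0" if "g \<in> E" "y \<notin> E" for g y
      using bij_betwE[OF bij] that by (auto simp: dual_set_iff)
    have "\<Phi> f y = \<Phi> (\<lambda>u. 0) y" for y
    proof (cases "y \<in> E")
      case True
      have y0: "y \<circ> (\<lambda>u. 0) = (\<lambda>u. 0)" using End_0[OF True] by (simp add: fun_eq_iff)
      have "\<Phi> (\<lambda>u. 0) y = 0" unfolding 1[OF zero_End True] y0 by (rule End_linear_0[OF lin])
      then show ?thesis using 1[OF f True] z[OF True] by simp
    next
      case False
      then show ?thesis using out f zero_End by simp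
    qed
    then have "\<Phi> f = \<Phi> (\<lambda>u. 0)" by blast
    then show ?thesis using inj_onD[OF bij_betw_imp_inj_on[OF bij] _ f zero_End] by simp
  qed
  show ?thesis unfolding symmetrizing_def using lin tr nd by blast
qed

text \<open>Nondegeneracy supplies \<open>g\<close> with \<open>\<tau> (g \<circ> f)\<close>
  nonzero, where \<open>f\<close> is the shift by \<open>s\<close>. The trace property confines
  \<open>g\<close> to a map between the two chains, and linearity singles out one shift
  \<open>t\<close> of its expansion. The composites of that shift with \<open>f\<close> in both
  orders have the same nonzero value under \<open>\<tau>\<close>, so neither vanishes, and this
  bounds \<open>s + t\<close> by both lengths.\<close>

lemma form_shift:
  assumes sym: "symmetrizing \<tau>"
    and x: "coord h a x \<theta>" and y: "coord h' b y \<theta>'" and s: "valid h a h' b s"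
  shows "\<exists>t. valid h' b h a t \<and> s + t < a \<and> s + t < b"
proof -
  have lin: "End_linear \<tau>" and tr: "\<And>f g. f \<in> E \<Longrightarrow> g \<in> E \<Longrightarrow> \<tau> (f \<circ> g) = \<tau> (g \<circ> f)"
    and nd: "\<And>f. f \<in> E \<Longrightarrow> (\<And>g. g \<in> E \<Longrightarrow> \<tau> (g \<circ> f) = 0) \<Longrightarrow> f = (\<lambda>u. 0)"
    using sym unfolding symmetrizing_def by blast+
  have chx: "chain x h a" and chy: "chain y h' b" using x y coord_chain by blast+
  have xM: "x \<in> M" and yM: "y \<in> M" using chx chy by simp_all
  note vs = valid_shift[OF chy s]
  define f where "f = extend \<theta> a (pw s y)"
  have fE: "f \<in> E" unfolding f_def by (rule extend_End[OF x vs(1,2)])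
  have fx: "f x = pw s y" unfolding f_def by (rule extend_gen[OF x vs(4)])
  then have "f \<noteq> (\<lambda>u. 0)" using vs(3) by auto
  then obtain g where gE: "g \<in> E" and g: "\<tau> (g \<circ> f) \<noteq> 0" using nd[OF fE] by blast
  \<comment> \<open>The projections of \<open>M\<close> onto the two chains, as
    endomorphisms.\<close>
  define eX where "eX = extend \<theta> a x"
  define eY where "eY = extend \<theta>' b y"
  have eXE: "eX \<in> E" unfolding eX_def
    by (rule extend_End[OF x chain_hom[OF chx] chain_pw_0[OF chx order_refl]])
  have eYE: "eY \<in> E" unfolding eY_def
    by (rule extend_End[OF y chain_hom[OF chy] chain_pw_0[OF chy order_refl]])
  have eYy: "eY y = y" unfolding eY_def by (rule extend_gen[OF y yM])
  have feX: "f \<circ> eX = f" unfolding eX_def End_comp_extend[OF fE xM] fx by (simp add: f_def)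
  have eYf: "eY \<circ> f = f" unfolding f_def End_comp_extend[OF eYE vs(4)]
    using End_pw[OF eYE yM] eYy by simp
  define k where "k = eX \<circ> g \<circ> eY"
  have kE: "k \<in> E" unfolding k_def by (intro comp_End eXE gE eYE)
  have "\<tau> (g \<circ> f) = \<tau> ((g \<circ> f) \<circ> eX)" by (simp only: comp_assoc feX)
  also have "\<dots> = \<tau> (eX \<circ> (g \<circ> f))" by (intro tr comp_End eXE gE fE)
  also have "\<dots> = \<tau> (k \<circ> f)" by (simp only: k_def comp_assoc eYf)
  finally have kf: "\<tau> (k \<circ> f) \<noteq> 0" using g by simp
  \<comment> \<open>The coefficients of \<open>k y\<close>, where \<open>k\<close> is
    \<open>g\<close> cut down to a map from the chain of \<open>y\<close> to that of
    \<open>x\<close>.\<close>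
  define c where "c t = \<theta> (pw (a - 1 - t) (g y))" for t
  define A where "A = {t. t < a \<and> c t \<noteq> 0}"
  have gy: "hom h' (g y)" "pw b (g y) = 0"
    using End_hom[OF gE chain_hom[OF chy]] End_pw[OF gE yM, of b] chain_pw_0[OF chy order_refl] End_0[OF gE]
    by simp_all
  have Av: "valid h' b h a t" if "t \<in> A" for t
    using coord_valid[OF x gy, of t] that by (simp add: A_def c_def)
  have "k y = eX (g y)" by (simp add: k_def eYy)
  also have "\<dots> = (\<Sum>t<a. sm (c t) (pw t x))"
    using gy(1) by (simp add: eX_def extend_def lc_def c_def)
  also have "\<dots> = (\<Sum>t\<in>A. sm (c t) (pw t x))"
    by (rule sum.mono_neutral_right) (use xM in \<open>auto simp: A_def\<close>)
  finally have ky: "k y = (\<Sum>t\<in>A. sm (c t) (pw t x))" .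
  have "k (pw s y) = pw s (k y)" by (rule End_pw[OF kE yM])
  also have "\<dots> = (\<Sum>t\<in>A. sm (c t) (pw (s + t) x))"
    unfolding ky using xM by (simp add: pw_sum pw_sm pw_pw)
  finally have ks: "k (pw s y) = (\<Sum>t\<in>A. sm (c t) (pw (s + t) x))" .
  \<comment> \<open>\<open>u t\<close> is the self-shift by \<open>s + t\<close> of the chain of
    \<open>x\<close>; it is \<open>f\<close> followed by the shift \<open>m t\<close> back.\<close>
  define u where "u t = extend \<theta> a (pw (s + t) x)" for t
  define m where "m t = extend \<theta>' b (pw t x)" for t
  have mE: "m t \<in> E" if t: "t \<in> A" for t
    using extend_End[OF y valid_shift(1,2)[OF chx Av[OF t]]] by (simp add: m_def)
  have mu: "m t \<circ> f = u t" if t: "t \<in> A" for t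
  proof -
    have "m t (pw s y) = pw (s + t) x"
      using End_pw[OF mE[OF t] yM, of s] extend_gen[OF y, of "pw t x"] xM by (simp add: m_def pw_pw)
    then show ?thesis unfolding f_def End_comp_extend[OF mE[OF t] vs(4)] by (simp add: u_def)
  qed
  have uE: "u t \<in> E" if t: "t \<in> A" for t using comp_End[OF mE[OF t] fE] mu[OF t] by simp
  have "k \<circ> f = extend \<theta> a (\<Sum>t\<in>A. sm (c t) (pw (s + t) x))"
    unfolding f_def End_comp_extend[OF kE vs(4)] ks ..
  also have "\<dots> = (\<lambda>z. \<Sum>t\<in>A. sm (c t) (u t z))"
    using xM by (simp add: fun_eq_iff extend_sum extend_sm u_def)
  finally have kfs: "\<tau> (k \<circ> f) = (\<Sum>t\<in>A. c t * \<tau> (u t))"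
    using End_linear_sum[OF lin, of A u c] uE by (simp add: A_def)
  have "\<exists>t\<in>A. \<tau> (u t) \<noteq> 0"
  proof (rule ccontr)
    assume "\<not> ?thesis"
    then have "(\<Sum>t\<in>A. c t * \<tau> (u t)) = 0" by (intro sum.neutral) simp
    then show False using kf kfs by simp
  qed
  then obtain t where t: "t \<in> A" "\<tau> (u t) \<noteq> 0" by blast
  have "s + t < a"
  proof (rule ccontr)
    assume "\<not> s + t < a"
    then have "pw (s + t) x = 0" using chain_pw_0[OF chx] by simp
    then have "u t = (\<lambda>z. 0)" by (simp add: u_def extend_0 fun_eq_iff)
    then show False using t End_linear_0[OF lin] by simp
  qed
  moreover have "s + t < b"
  proof (rule ccontr)
    assume "\<not> s + t < b"
    then have "pw (t + s) y = 0" using chain_pw_0[OF chy, of "t + s"] by simp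
    then have "f (pw t x) = 0" using End_pw[OF fE xM, of t] fx yM by (simp add: pw_pw)
    then have "f \<circ> m t = (\<lambda>z. 0)"
      using End_comp_extend[OF fE, of "pw t x" \<theta>' b] xM by (simp add: m_def extend_0 fun_eq_iff)
    then have "\<tau> (m t \<circ> f) = 0" using tr[OF mE[OF t(1)] fE] End_linear_0[OF lin] by simp
    then show False using t mu by simp
  qed
  ultimately show ?thesis using Av[OF t(1)] by blast
qed

text \<open>Here \<open>m\<close> is a basis of \<open>End(M)\<close> with coordinates \<open>F\<close>, and \<open>m (\<rho> v)\<close> is the basis element
  dual to \<open>m v\<close> under the form \<open>(f, g) \<mapsto> \<tau> (f \<circ> g)\<close>.\<close>

lemma end_symmetricI:
  assumes fin: "finite V" and mE: "\<And>v. v \<in> V \<Longrightarrow> m v \<in> E"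
    and expand: "\<And>f u. f \<in> E \<Longrightarrow> f u = (\<Sum>v\<in>V. sm (F f v) (m v u))"
    and coeff: "\<And>c w. w \<in> V \<Longrightarrow> F (\<lambda>u. \<Sum>v\<in>V. sm (c v) (m v u)) w = c w"
    and rev: "\<And>v. v \<in> V \<Longrightarrow> \<rho> v \<in> V" "\<And>v. v \<in> V \<Longrightarrow> \<rho> (\<rho> v) = v"
    and lin: "End_linear \<tau>"
    and left: "\<And>g v. g \<in> E \<Longrightarrow> v \<in> V \<Longrightarrow> \<tau> (g \<circ> m v) = F g (\<rho> v)"
    and right: "\<And>g v. g \<in> E \<Longrightarrow> v \<in> V \<Longrightarrow> \<tau> (m v \<circ> g) = F g (\<rho> v)"
  shows "end_symmetric sm act M"
proof -
  have comp_expand: "f \<circ> g = (\<lambda>u. \<Sum>v\<in>V. sm (F f v) ((m v \<circ> g) u))" if "f \<in> E" for f g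
    using expand[OF that] by (simp add: fun_eq_iff)
  \<comment> \<open>Only \<open>f\<close> has to be expanded in the basis, since \<open>left\<close>
    and \<open>right\<close> give the same coefficient of \<open>g\<close>.\<close>
  have tr: "\<tau> (f \<circ> g) = \<tau> (g \<circ> f)" if f: "f \<in> E" and g: "g \<in> E" for f g
  proof -
    have "\<tau> (f \<circ> g) = (\<Sum>v\<in>V. F f v * \<tau> (m v \<circ> g))"
      unfolding comp_expand[OF f, of g] by (rule End_linear_sum[OF lin fin]) (intro comp_End mE g)
    also have "\<dots> = (\<Sum>v\<in>V. F f v * \<tau> (g \<circ> m v))" using left right g by simp
    also have "\<dots> = \<tau> (\<lambda>u. \<Sum>v\<in>V. sm (F f v) ((g \<circ> m v) u))"
      by (rule End_linear_sum[OF lin fin, symmetric]) (intro comp_End mE g)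
    also have "(\<lambda>u. \<Sum>v\<in>V. sm (F f v) ((g \<circ> m v) u)) = g \<circ> f"
    proof
      fix u
      have "(g \<circ> f) u = g (\<Sum>v\<in>V. sm (F f v) (m v u))" using expand[OF f] by simp
      also have "\<dots> = (\<Sum>v\<in>V. sm (F f v) ((g \<circ> m v) u))"
        using End_into[OF mE] by (simp add: End_sum[OF g] End_sm[OF g])
      finally show "(\<Sum>v\<in>V. sm (F f v) ((g \<circ> m v) u)) = (g \<circ> f) u" by simp
    qed
    finally show ?thesis .
  qed
  define \<Phi> where "\<Phi> f = (\<lambda>y. if y \<in> E then \<tau> (y \<circ> f) else 0)" for f
  have \<Phi>lin: "End_linear (\<Phi> f)" if f: "f \<in> E" for f
    unfolding End_linear_def
  proof (intro conjI ballI allI)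
    fix y z assume yz: "y \<in> E" "z \<in> E"
    have "(\<lambda>u. y u + z u) \<circ> f = (\<lambda>u. (y \<circ> f) u + (z \<circ> f) u)" by (simp add: fun_eq_iff)
    moreover have "\<tau> \<dots> = \<tau> (y \<circ> f) + \<tau> (z \<circ> f)"
      by (rule End_linear_add[OF lin comp_End[OF yz(1) f] comp_End[OF yz(2) f]])
    ultimately show "\<Phi> f (\<lambda>u. y u + z u) = \<Phi> f y + \<Phi> f z" using yz add_End by (simp add: \<Phi>_def)
    fix c
    have "(\<lambda>u. sm c (y u)) \<circ> f = (\<lambda>u. sm c ((y \<circ> f) u))" by (simp add: fun_eq_iff)
    moreover have "\<tau> \<dots> = c * \<tau> (y \<circ> f)"
      by (rule End_linear_sm[OF lin comp_End[OF yz(1) f]])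
    ultimately show "\<Phi> f (\<lambda>u. sm c (y u)) = c * \<Phi> f y" using yz sm_End by (simp add: \<Phi>_def)
  qed
  have \<Phi>m: "\<Phi> f (m v) = F f (\<rho> v)" if "f \<in> E" "v \<in> V" for f v
    using right[OF that] mE[OF that(2)] by (simp add: \<Phi>_def)
  have "bij_betw \<Phi> E (dual_set sm E)"
    unfolding bij_betw_def
  proof
    show "inj_on \<Phi> E"
    proof (rule inj_onI)
      fix f g assume fg: "f \<in> E" "g \<in> E" "\<Phi> f = \<Phi> g"
      have "F f v = F g v" if v: "v \<in> V" for v
        using \<Phi>m[OF fg(1) rev(1)[OF v]] \<Phi>m[OF fg(2) rev(1)[OF v]] fg(3) rev(2)[OF v] by simp
      then have "(\<Sum>v\<in>V. sm (F f v) (m v u)) = (\<Sum>v\<in>V. sm (F g v) (m v u))" for u by simp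
      then show "f = g" using expand[OF fg(1)] expand[OF fg(2)] by (simp add: fun_eq_iff)
    qed
    show "\<Phi> ` E = dual_set sm E"
    proof
      show "\<Phi> ` E \<subseteq> dual_set sm E" using \<Phi>lin by (auto simp: dual_set_iff \<Phi>_def)
      show "dual_set sm E \<subseteq> \<Phi> ` E"
      proof
        fix \<phi> assume "\<phi> \<in> dual_set sm E"
        then have \<phi>: "End_linear \<phi>" and out: "\<And>f. f \<notin> E \<Longrightarrow> \<phi> f = 0" by (simp_all add: dual_set_iff)
        \<comment> \<open>A functional is recovered from its values on the basis: the coefficient at
          \<open>v\<close> is its value on the basis element dual to \<open>m v\<close>.\<close>
        define f where "f = (\<lambda>u. \<Sum>v\<in>V. sm (\<phi> (m (\<rho> v))) (m v u))"
        have fE: "f \<in> E" unfolding f_def by (intro sum_End sm_End mE)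
        have Ff: "F f v = \<phi> (m (\<rho> v))" if "v \<in> V" for v
          unfolding f_def using coeff[OF that, of "\<lambda>v. \<phi> (m (\<rho> v))"] .
        have "\<Phi> f y = \<phi> y" for y
        proof (cases "y \<in> E")
          case True
          have y: "y = (\<lambda>u. \<Sum>v\<in>V. sm (F y v) (m v u))" using expand[OF True] by (simp add: fun_eq_iff)
          have "\<Phi> f y = (\<Sum>v\<in>V. F y v * \<Phi> f (m v))"
            by (subst y) (rule End_linear_sum[OF \<Phi>lin[OF fE] fin mE])
          also have "\<dots> = (\<Sum>v\<in>V. F y v * \<phi> (m v))"
            by (rule sum.cong) (simp_all add: \<Phi>m[OF fE] Ff rev)
          also have "\<dots> = \<phi> (\<lambda>u. \<Sum>v\<in>V. sm (F y v) (m v u))"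
            by (rule End_linear_sum[OF \<phi> fin mE, symmetric])
          finally show ?thesis using y by simp
        qed (simp add: \<Phi>_def out)
        then have "\<Phi> f = \<phi>" by blast
        then show "\<phi> \<in> \<Phi> ` E" using fE by blast
      qed
    qed
  qed
  moreover have "\<Phi> (\<lambda>u. f u + g u) = (\<lambda>y. \<Phi> f y + \<Phi> g y)" if fg: "f \<in> E" "g \<in> E" for f g
  proof
    fix y
    show "\<Phi> (\<lambda>u. f u + g u) y = \<Phi> f y + \<Phi> g y"
    proof (cases "y \<in> E")
      case True
      have "y \<circ> (\<lambda>u. f u + g u) = (\<lambda>u. (y \<circ> f) u + (y \<circ> g) u)"
        using End_into[OF fg(1)] End_into[OF fg(2)] by (simp add: fun_eq_iff End_add[OF True])
      moreover have "\<tau> \<dots> = \<tau> (y \<circ> f) + \<tau> (y \<circ> g)"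
        by (rule End_linear_add[OF lin comp_End[OF True fg(1)] comp_End[OF True fg(2)]])
      ultimately show ?thesis using True by (simp add: \<Phi>_def)
    qed (simp add: \<Phi>_def)
  qed
  moreover have "\<Phi> (\<lambda>u. sm c (f u)) = (\<lambda>y. c * \<Phi> f y)" if f: "f \<in> E" for c f
  proof
    fix y
    show "\<Phi> (\<lambda>u. sm c (f u)) y = c * \<Phi> f y"
    proof (cases "y \<in> E")
      case True
      have "y \<circ> (\<lambda>u. sm c (f u)) = (\<lambda>u. sm c ((y \<circ> f) u))"
        using End_into[OF f] by (simp add: fun_eq_iff End_sm[OF True])
      moreover have "\<tau> \<dots> = c * \<tau> (y \<circ> f)"
        by (rule End_linear_sm[OF lin comp_End[OF True f]])
      ultimately show ?thesis using True by (simp add: \<Phi>_def)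
    qed (simp add: \<Phi>_def)
  qed
  moreover have "\<Phi> (a \<circ> f \<circ> b) = (\<lambda>y. if y \<in> E then \<Phi> f (b \<circ> y \<circ> a) else 0)"
    if afb: "a \<in> E" "f \<in> E" "b \<in> E" for a f b
  proof
    fix y
    show "\<Phi> (a \<circ> f \<circ> b) y = (if y \<in> E then \<Phi> f (b \<circ> y \<circ> a) else 0)"
    proof (cases "y \<in> E")
      case True
      have "\<tau> (y \<circ> (a \<circ> f \<circ> b)) = \<tau> ((y \<circ> a \<circ> f) \<circ> b)" by (simp only: comp_assoc)
      also have "\<dots> = \<tau> (b \<circ> (y \<circ> a \<circ> f))" by (intro tr comp_End True afb)
      finally show ?thesis using True afb comp_End by (simp add: \<Phi>_def comp_assoc)
    qed (simp add: \<Phi>_def)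
  qed
  ultimately show ?thesis unfolding end_symmetric_def Let_def by (intro exI[of _ \<Phi>]) blast
qed

end

section \<open>The basis of shifts\<close>

lemma (in serial_algebra) smax_less: "a > 0 \<Longrightarrow> smax h a < a"
proof -
  assume a: "a > 0"
  have "smax h a \<in> {s. s < a \<and> (\<sigma> ^^ s) h = h}" unfolding smax_def
    by (rule Max_in) (use a in \<open>auto intro: exI[of _ 0]\<close>)
  then show ?thesis by simp
qed

text \<open>\<open>orth\<close> says that a coordinate functional vanishes on the other chains, and
  \<open>complete\<close> that the projections onto the chains add up to the identity.\<close>

locale chain_basis = serial_module sa n e \<pi> \<sigma> N sm act M
  for sa :: "'k::field \<Rightarrow> 'a::ring_1 \<Rightarrow> 'a" and n e \<pi> \<sigma> N
  and sm :: "'k \<Rightarrow> 'm::ab_group_add \<Rightarrow> 'm" and act :: "'a \<Rightarrow> 'm \<Rightarrow> 'm" and M +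
  fixes I :: "'i set" and x :: "'i \<Rightarrow> 'm" and h a :: "'i \<Rightarrow> nat" and \<theta> :: "'i \<Rightarrow> 'm \<Rightarrow> 'k"
  assumes finI: "finite I"
    and co: "p \<in> I \<Longrightarrow> coord (h p) (a p) (x p) (\<theta> p)"
    and orth: "p \<in> I \<Longrightarrow> q \<in> I \<Longrightarrow> p \<noteq> q \<Longrightarrow> \<theta> p (pw k (x q)) = 0"
    and complete: "z \<in> M \<Longrightarrow> (\<Sum>p\<in>I. extend (\<theta> p) (a p) (x p) z) = z"
begin

lemma basis_chain: "p \<in> I \<Longrightarrow> chain (x p) (h p) (a p)"
  using co coord_chain by blast

lemma basis_in: "p \<in> I \<Longrightarrow> x p \<in> M"
  by (rule chain_in[OF basis_chain])

lemma theta_gen: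
  "p \<in> I \<Longrightarrow> q \<in> I \<Longrightarrow> \<theta> p (pw k (x q)) = (if p = q \<and> k = a p - 1 then 1 else 0)"
  using orth[of p q k] coord_gen[OF co[of p], of k] by (cases "p = q") simp_all

definition V :: "('i \<times> 'i \<times> nat) set" where
  "V = {(p, q, t). p \<in> I \<and> q \<in> I \<and> valid (h p) (a p) (h q) (a q) t}"

definition shift_map :: "'i \<times> 'i \<times> nat \<Rightarrow> 'm \<Rightarrow> 'm" where
  "shift_map = (\<lambda>(p, q, t). extend (\<theta> p) (a p) (pw t (x q)))"

definition coef :: "('m \<Rightarrow> 'm) \<Rightarrow> 'i \<times> 'i \<times> nat \<Rightarrow> 'k" where
  "coef f = (\<lambda>(p, q, t). \<theta> q (pw (a q - 1 - t) (f (x p))))"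

definition soc_form :: "('m \<Rightarrow> 'm) \<Rightarrow> 'k" where
  "soc_form f = (\<Sum>p\<in>I. coef f (p, p, smax (h p) (a p)))"

definition rev_shift :: "'i \<times> 'i \<times> nat \<Rightarrow> 'i \<times> 'i \<times> nat" where
  "rev_shift = (\<lambda>(p, q, t). (q, p, smax (h p) (a p) - t))"

lemma V_subset: "V \<subseteq> Sigma I (\<lambda>p. Sigma I (\<lambda>q. {..<a q}))"
  by (auto simp: V_def valid_def)

lemma finite_V: "finite V"
  using V_subset by (rule finite_subset) (auto simp: finI)

lemma shift_map_End: "v \<in> V \<Longrightarrow> shift_map v \<in> E"
  using extend_End[OF co valid_shift(1,2)[OF basis_chain]] by (auto simp: V_def shift_map_def)

lemma shift_map_gen:
  assumes "(p, q, t) \<in> V" "r \<in> I"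
  shows "shift_map (p, q, t) (x r) = (if r = p then pw t (x q) else 0)"
proof (cases "r = p")
  case True
  then show ?thesis using assms extend_gen[OF co] basis_in by (simp add: shift_map_def V_def)
next
  case False
  then have "lc (pw t (x q)) (a p) (\<lambda>u. \<theta> p (pw (a p - 1 - u) (x r))) =
      lc (pw t (x q)) (a p) (\<lambda>u. 0)"
    using assms by (intro lc_cong) (simp add: orth V_def)
  then show ?thesis using False assms basis_in by (simp add: shift_map_def extend_def V_def)
qed

lemma End_expand:
  assumes f: "f \<in> E"
  shows "f u = (\<Sum>v\<in>V. sm (coef f v) (shift_map v u))"
proof (cases "u \<in> M")
  case False
  then have "shift_map v u = 0" for v by (cases v) (simp add: shift_map_def extend_def)
  then show ?thesis using End_out[OF f False] by simp
next
  case u: True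
  have fxM: "f (x p) \<in> M" if "p \<in> I" for p using End_in[OF f basis_in[OF that]] .
  have fx: "f (x p) = (\<Sum>q\<in>I. \<Sum>t<a q. sm (coef f (p, q, t)) (pw t (x q)))" if p: "p \<in> I" for p
    using complete[OF fxM[OF p]] fxM[OF p] by (simp add: extend_def lc_def coef_def)
  have "f u = f (\<Sum>p\<in>I. extend (\<theta> p) (a p) (x p) u)" using complete[OF u] by simp
  also have "\<dots> = (\<Sum>p\<in>I. extend (\<theta> p) (a p) (f (x p)) u)"
  proof (subst End_sum[OF f])
    show "extend (\<theta> p) (a p) (x p) u \<in> M" if "p \<in> I" for p
      using basis_in[OF that] by (simp add: extend_def)
    show "(\<Sum>p\<in>I. f (extend (\<theta> p) (a p) (x p) u)) = (\<Sum>p\<in>I. extend (\<theta> p) (a p) (f (x p)) u)"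
      by (rule sum.cong[OF refl], rule End_extend[OF f basis_in])
  qed
  also have "\<dots> = (\<Sum>p\<in>I. \<Sum>q\<in>I. \<Sum>t<a q. sm (coef f (p, q, t)) (shift_map (p, q, t) u))"
  proof (rule sum.cong[OF refl])
    fix p assume p: "p \<in> I"
    show "extend (\<theta> p) (a p) (f (x p)) u = (\<Sum>q\<in>I. \<Sum>t<a q. sm (coef f (p, q, t)) (shift_map (p, q, t) u))"
      unfolding fx[OF p] using basis_in by (simp add: extend_sum extend_sm shift_map_def)
  qed
  also have "\<dots> = (\<Sum>v\<in>Sigma I (\<lambda>p. Sigma I (\<lambda>q. {..<a q})). sm (coef f v) (shift_map v u))"
    using finI by (simp add: sum.Sigma split_def)
  \<comment> \<open>Triples outside \<open>V\<close> contribute nothing, since by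
    \<open>coord_valid\<close> a nonzero coefficient belongs to a valid shift.\<close>
  also have "\<dots> = (\<Sum>v\<in>V. sm (coef f v) (shift_map v u))"
  proof (rule sum.mono_neutral_right)
    show "\<forall>v\<in>Sigma I (\<lambda>p. Sigma I (\<lambda>q. {..<a q})) - V. sm (coef f v) (shift_map v u) = 0"
    proof
      fix v assume "v \<in> Sigma I (\<lambda>p. Sigma I (\<lambda>q. {..<a q})) - V"
      then obtain p q t where v: "v = (p, q, t)" "p \<in> I" "q \<in> I" "t < a q" "(p, q, t) \<notin> V" by auto
      have hom: "hom (h p) (f (x p))" using End_hom[OF f chain_hom[OF basis_chain[OF v(2)]]] .
      have "pw (a p) (f (x p)) = f (pw (a p) (x p))" using End_pw[OF f basis_in[OF v(2)]] by simp
      also have "\<dots> = 0" using chain_pw_0[OF basis_chain[OF v(2)] order_refl] End_0[OF f] by simp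
      finally have z: "pw (a p) (f (x p)) = 0" .
      have "coef f (p, q, t) = 0"
        using coord_valid[OF co[OF v(3)] hom z v(4)] v unfolding coef_def V_def by auto
      then show "sm (coef f v) (shift_map v u) = 0" using u basis_in v by (simp add: shift_map_def extend_def)
    qed
  qed (use finI V_subset in auto)
  finally show ?thesis .
qed

lemma coef_shift_map:
  assumes v: "v \<in> V" and w: "w \<in> V"
  shows "coef (shift_map v) w = (if v = w then 1 else 0)"
proof -
  obtain p q t where vp: "v = (p, q, t)" by (cases v)
  obtain p' q' t' where wp: "w = (p', q', t')" by (cases w)
  have I: "p \<in> I" "q \<in> I" "p' \<in> I" "q' \<in> I" and t: "t < a q" "t' < a q'"
    using v w by (auto simp: vp wp V_def valid_def)
  have "coef (shift_map v) w = \<theta> q' (pw (a q' - 1 - t') (if p' = p then pw t (x q) else 0))"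
    using shift_map_gen[of p q t p'] v I by (simp add: coef_def vp wp)
  also have "\<dots> = (if v = w then 1 else 0)"
    using theta_gen[OF I(4,2), of "a q' - 1 - t' + t"] coord_0[OF co[OF I(4)]] basis_in[OF I(2)] t
    by (auto simp: vp wp pw_pw)
  finally show ?thesis .
qed

lemma coef_sum:
  assumes w: "w \<in> V" and k: "\<And>v. v \<in> S \<Longrightarrow> k v \<in> E"
  shows "coef (\<lambda>u. \<Sum>v\<in>S. sm (c v) (k v u)) w = (\<Sum>v\<in>S. c v * coef (k v) w)"
proof -
  obtain p q t where wp: "w = (p, q, t)" by (cases w)
  have I: "p \<in> I" "q \<in> I" using w by (auto simp: wp V_def)
  have "k v (x p) \<in> M" if "v \<in> S" for v using End_into[OF k[OF that]] .
  then show ?thesis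
    by (simp add: wp coef_def pw_sum pw_sm coord_sum[OF co[OF I(2)]] coord_sm[OF co[OF I(2)]])
qed

lemma coef_combination:
  assumes w: "w \<in> V"
  shows "coef (\<lambda>u. \<Sum>v\<in>V. sm (c v) (shift_map v u)) w = c w"
proof -
  have "coef (\<lambda>u. \<Sum>v\<in>V. sm (c v) (shift_map v u)) w = (\<Sum>v\<in>V. c v * coef (shift_map v) w)"
    by (rule coef_sum[OF w shift_map_End])
  also have "\<dots> = (\<Sum>v\<in>V. if v = w then c v else 0)"
    by (rule sum.cong) (simp_all add: coef_shift_map w)
  finally show ?thesis using w finite_V by simp
qed

lemma soc_form_linear: "End_linear soc_form"
proof -
  have add: "coef (\<lambda>u. f u + g u) (p, p, t) = coef f (p, p, t) + coef g (p, p, t)"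
    and sm: "coef (\<lambda>u. sm c (f u)) (p, p, t) = c * coef f (p, p, t)"
    if "f \<in> E" "g \<in> E" "p \<in> I" for f g p t c
    using End_into[OF that(1)] End_into[OF that(2)]
    by (simp_all add: coef_def pw_add pw_sm coord_add[OF co[OF that(3)]] coord_sm[OF co[OF that(3)]])
  show ?thesis unfolding End_linear_def soc_form_def
    by (simp add: add sm sum.distrib sum_distrib_left)
qed

text \<open>The composite kills every generator except \<open>x p\<close>, so a single summand of
  \<open>soc_form\<close> survives; the factor \<open>\<pi> ^ t\<close> lowers the position that is
  read by \<open>t\<close>.\<close>

lemma soc_form_comp_shift_map:
  assumes g: "g \<in> E" and v: "(p, q, t) \<in> V" and t: "t \<le> smax (h p) (a p)"
  shows "soc_form (g \<circ> shift_map (p, q, t)) = coef g (q, p, smax (h p) (a p) - t)"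
proof -
  have I: "p \<in> I" "q \<in> I" using v by (auto simp: V_def)
  let ?s = "smax (h p) (a p)"
  have s: "?s < a p" using smax_less coord_pos[OF co[OF I(1)]] by blast
  have "coef (g \<circ> shift_map (p, q, t)) (r, r, smax (h r) (a r)) =
      (if r = p then coef g (q, p, ?s - t) else 0)" if r: "r \<in> I" for r
  proof (cases "r = p")
    case True
    have "pw (a p - 1 - ?s) (g (pw t (x q))) = pw (a p - 1 - ?s + t) (g (x q))"
      using End_pw[OF g basis_in[OF I(2)], of t] End_in[OF g basis_in[OF I(2)]] by (simp add: pw_pw)
    moreover have "a p - 1 - ?s + t = a p - 1 - (?s - t)" using s t by simp
    ultimately show ?thesis using True shift_map_gen[OF v I(1)] by (simp add: coef_def)
  next
    case False
    then show ?thesis using shift_map_gen[OF v r] End_0[OF g] coord_0[OF co[OF r]] by (simp add: coef_def)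
  qed
  then have "soc_form (g \<circ> shift_map (p, q, t)) = (\<Sum>r\<in>I. if r = p then coef g (q, p, ?s - t) else 0)"
    unfolding soc_form_def by (intro sum.cong) simp_all
  then show ?thesis using I finI by simp
qed

text \<open>Here the shift is applied last, so the image lies in the chain of \<open>x q\<close> and
  only \<open>\<theta> q\<close> sees it. The last hypothesis ensures that the position
  \<open>smax (h q) (a q) - t\<close> to be read exists in the chain of \<open>x p\<close>.\<close>

lemma soc_form_shift_map_comp:
  assumes g: "g \<in> E" and v: "(p, q, t) \<in> V" and t: "t \<le> smax (h q) (a q)"
    and s: "smax (h q) (a q) - t < a p"
  shows "soc_form (shift_map (p, q, t) \<circ> g) = coef g (q, p, smax (h q) (a q) - t)"
proof -
  have I: "p \<in> I" "q \<in> I" using v by (auto simp: V_def)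
  let ?s = "smax (h q) (a q)"
  have sq: "?s < a q" using smax_less coord_pos[OF co[OF I(2)]] by blast
  have "coef (shift_map (p, q, t) \<circ> g) (r, r, smax (h r) (a r)) =
      (if r = q then coef g (q, p, ?s - t) else 0)" if r: "r \<in> I" for r
  proof -
    let ?j = "a r - 1 - smax (h r) (a r)"
    have gM: "g (x r) \<in> M" using End_in[OF g basis_in[OF r]] .
    have "coef (shift_map (p, q, t) \<circ> g) (r, r, smax (h r) (a r)) =
        \<theta> r (pw ?j (lc (pw t (x q)) (a p) (\<lambda>u. \<theta> p (pw (a p - 1 - u) (g (x r))))))"
      using gM by (simp add: coef_def shift_map_def extend_def)
    also have "\<dots> = (\<Sum>u<a p. \<theta> p (pw (a p - 1 - u) (g (x r))) * \<theta> r (pw (?j + (u + t)) (x q)))"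
      unfolding lc_def using basis_in[OF I(2)]
      by (simp add: pw_sum pw_sm pw_pw coord_sum[OF co[OF r]] coord_sm[OF co[OF r]])
    also have "\<dots> = (\<Sum>u<a p. if u = ?s - t then (if r = q then coef g (q, p, ?s - t) else 0) else 0)"
    proof (rule sum.cong[OF refl])
      fix u assume u: "u \<in> {..<a p}"
      have "?j + (u + t) = a r - 1 \<longleftrightarrow> u = ?s - t" if "r = q" using that sq t by auto
      then show "\<theta> p (pw (a p - 1 - u) (g (x r))) * \<theta> r (pw (?j + (u + t)) (x q)) =
          (if u = ?s - t then (if r = q then coef g (q, p, ?s - t) else 0) else 0)"
        using theta_gen[OF r I(2), of "?j + (u + t)"] by (auto simp: coef_def)
    qed
    also have "\<dots> = (if r = q then coef g (q, p, ?s - t) else 0)" using s by simp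
    finally show ?thesis .
  qed
  then have "soc_form (shift_map (p, q, t) \<circ> g) = (\<Sum>r\<in>I. if r = q then coef g (q, p, ?s - t) else 0)"
    unfolding soc_form_def by (intro sum.cong) simp_all
  then show ?thesis using I finI by simp
qed

text \<open>Equality of the two maxima is used twice: it makes \<open>rev_shift\<close> an
  involution, and it makes both orders of composition pick out the same coefficient.\<close>

theorem end_symmetric_if_reversible:
  assumes R: "\<And>p q t. (p, q, t) \<in> V \<Longrightarrow> t \<le> smax (h p) (a p) \<and> smax (h q) (a q) = smax (h p) (a p) \<and>
    (q, p, smax (h p) (a p) - t) \<in> V"
  shows "end_symmetric sm act M"
proof (rule end_symmetricI[OF finite_V shift_map_End End_expand coef_combination _ _ soc_form_linear])
  fix v assume v: "v \<in> V"
  obtain p q t where vp: "v = (p, q, t)" by (cases v)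
  note r = R[OF v[unfolded vp]]
  show "rev_shift v \<in> V" "rev_shift (rev_shift v) = v" using r by (simp_all add: rev_shift_def vp)
  fix g assume g: "g \<in> E"
  show "soc_form (g \<circ> shift_map v) = coef g (rev_shift v)"
    using soc_form_comp_shift_map[OF g v[unfolded vp]] r by (simp add: vp rev_shift_def)
  have "smax (h p) (a p) - t < a p" using r by (simp add: V_def valid_def)
  then show "soc_form (shift_map v \<circ> g) = coef g (rev_shift v)"
    using soc_form_shift_map_comp[OF g v[unfolded vp]] r by (simp add: vp rev_shift_def)
qed

end

section \<open>The criterion\<close>

context serial_module
begin

lemma chain_grade:
  assumes ch: "chain x h a" and a: "a > 0"
  shows "h < n"
proof (rule ccontr)
  assume "\<not> h < n"
  then have "act (e h) x = 0" using ch e_out[of h] by simp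
  then have "x = 0" using chain_hom[OF ch] by (simp add: hom_def)
  then show False using chain_pw[OF ch, of 0] a by simp
qed

lemma chain_basis_exists:
  assumes fg: "fin_gen sm act M"
  shows "\<exists>I x a \<theta>. chain_decomp I x a M \<and> chain_basis sa n e \<pi> \<sigma> N sm act M I x snd a \<theta>"
proof -
  obtain I x a where d: "chain_decomp I x a M" using chain_decomposition[OF fg order_refl] by blast
  have fin: "finite I" and ch: "\<And>p. p \<in> I \<Longrightarrow> chain (x p) (snd p) (a p)"
    and pos: "\<And>p. p \<in> I \<Longrightarrow> a p > 0" and M: "M = combs I x a"
    using d by (auto simp: chain_decomp_def)
  have xM: "x p \<in> M" if "p \<in> I" for p using chain_in[OF ch[OF that]] .
  have "\<exists>\<theta>. coord (snd p) (a p) (x p) \<theta> \<and>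
      (\<forall>c. \<forall>v\<in>combs (I - {p}) x a. \<theta> (lc (x p) (a p) c + v) = c (a p - 1))" if p: "p \<in> I" for p
    by (rule coord_exists[OF ch[OF p] pos[OF p] chain_decomp_dsum2[OF d p]])
  then obtain \<theta> where co: "\<And>p. p \<in> I \<Longrightarrow> coord (snd p) (a p) (x p) (\<theta> p)"
    and th: "\<And>p c v. p \<in> I \<Longrightarrow> v \<in> combs (I - {p}) x a \<Longrightarrow> \<theta> p (lc (x p) (a p) c + v) = c (a p - 1)"
    by metis
  have orth: "\<theta> p (pw k (x q)) = 0" if p: "p \<in> I" and q: "q \<in> I" and ne: "p \<noteq> q" for p q k
  proof -
    have "x q \<in> combs (I - {p}) x a"
      using fin xM q ne pos by (intro generator_in_combs) auto
    moreover have "submod sm act (combs (I - {p}) x a)"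
      by (rule submod_combs[of _ x snd a]) (use ch in auto)
    ultimately have "pw k (x q) \<in> combs (I - {p}) x a" by (intro sub_pw)
    from th[OF p this, of "\<lambda>t. 0"] show ?thesis using xM[OF p] by simp
  qed
  have complete: "(\<Sum>p\<in>I. extend (\<theta> p) (a p) (x p) z) = z" if z: "z \<in> M" for z
  proof -
    obtain c where c: "z = (\<Sum>q\<in>I. lc (x q) (a q) (c q))" using z unfolding M combs_def by blast
    have "extend (\<theta> p) (a p) (x p) z = lc (x p) (a p) (c p)" if p: "p \<in> I" for p
    proof -
      \<comment> \<open>The power of \<open>\<pi>\<close> moves position \<open>t\<close> of the
        chain of \<open>x p\<close> to its socle, where \<open>\<theta> p\<close> reads it.\<close>
      have "\<theta> p (pw (a p - 1 - t) z) = c p t" if t: "t < a p" for t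
      proof -
        let ?d = "\<lambda>q s. if s < a p - 1 - t then 0 else c q (s - (a p - 1 - t))"
        have "pw j z = (\<Sum>q\<in>I. lc (x q) (a q) (\<lambda>s. if s < j then 0 else c q (s - j)))" for j
          unfolding c using xM lc_pw[OF ch] by (simp add: pw_sum)
        then have "pw (a p - 1 - t) z = (\<Sum>q\<in>I. lc (x q) (a q) (?d q))" .
        also have "\<dots> = lc (x p) (a p) (?d p) + (\<Sum>q\<in>I - {p}. lc (x q) (a q) (?d q))"
          by (rule sum.remove[OF fin p])
        also have "\<theta> p \<dots> = ?d p (a p - 1)" by (rule th[OF p combsI])
        also have "\<dots> = c p t" using t by auto
        finally show ?thesis .
      qed
      then have "lc (x p) (a p) (\<lambda>t. \<theta> p (pw (a p - 1 - t) z)) = lc (x p) (a p) (c p)" by (rule lc_cong)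
      then show ?thesis using z by (simp add: extend_def)
    qed
    then show ?thesis unfolding c by simp
  qed
  have "chain_basis sa n e \<pi> \<sigma> N sm act M I x snd a \<theta>"
    by unfold_locales (use fin co orth complete in auto)
  then show ?thesis using d by blast
qed

section \<open>The condition on a pair of summands\<close>

definition pair_cond :: "'m set \<Rightarrow> 'm set \<Rightarrow> bool" where
  "pair_cond X Y \<longleftrightarrow>
    (let l = min (loewy_length sm act X) (loewy_length sm act Y) in
       mult sm act (top_mod sa sm act Y) (soc_ser sm act X l) = 0 \<and>
       mult sm act (top_mod sa sm act X) (soc_ser sm act Y l) = 0) \<or>
    (\<exists>m\<ge>1. mult sm act (top_mod sa sm act X) X = m + 1 \<and>
       mult sm act (top_mod sa sm act X) Y = m \<and>
       mult sm act (top_mod sa sm act Y) Y = m + 1 \<and>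
       mult sm act (top_mod sa sm act Y) X = m)"

text \<open>The \<open>l\<close>-th socle of a chain consists of the positions from
  \<open>a - l\<close> on. For \<open>l = min a b\<close>, being such a position \<open>t\<close>
  amounts to \<open>a \<le> t + b\<close>, the last condition of a valid shift.\<close>

lemma mult_soc_eq_0_iff:
  assumes x: "chain x h a" and y: "chain y h' b" "b > 0"
  shows "mult sm act (top_mod sa sm act (W y b 0)) (soc_ser sm act (W x a 0) (min a b)) = 0 \<longleftrightarrow>
    (\<forall>t. \<not> valid h' b h a t)"
proof -
  have "{t. a - min a b \<le> t \<and> t < a \<and> (\<sigma> ^^ t) h = h'} = {t. valid h' b h a t}"
    by (auto simp: valid_def)
  moreover have "finite {t. valid h' b h a t}" by (rule finite_subset[of _ "{..<a}"]) (auto simp: valid_def)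
  ultimately show ?thesis
    unfolding soc_ser_chain[OF x] by (simp add: mult_top_chain[OF x _ y])
qed

lemma pair_cond_chain:
  assumes x: "chain x h a" "a > 0" and y: "chain y h' b" "b > 0"
  shows "pair_cond (W x a 0) (W y b 0) \<longleftrightarrow>
    (\<forall>s. \<not> valid h a h' b s) \<and> (\<forall>s. \<not> valid h' b h a s) \<or>
    (\<exists>m\<ge>1. tops h a h = m + 1 \<and> tops h' b h = m \<and> tops h' b h' = m + 1 \<and> tops h a h' = m)"
proof -
  have t: "mult sm act (top_mod sa sm act (W v d 0)) (W u c 0) = tops i c j"
    if "chain u i c" "chain v j d" "d > 0" for u i c v j d
    using mult_top_chain[OF that(1) _ that(2,3), of 0] by (simp add: tops_def)
  have "mult sm act (top_mod sa sm act (W x a 0)) (soc_ser sm act (W y b 0) (min a b)) = 0 \<longleftrightarrow>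
    (\<forall>t. \<not> valid h a h' b t)"
    using mult_soc_eq_0_iff[OF y(1) x] by (simp add: min.commute)
  then show ?thesis
    unfolding pair_cond_def Let_def loewy_chain[OF x(1)] loewy_chain[OF y(1)]
      mult_soc_eq_0_iff[OF x(1) y] t[OF x(1) x] t[OF x(1) y] t[OF y(1) x] t[OF y(1) y]
    by blast
qed

lemma pair_cond_if_symmetric:
  assumes fg: "fin_gen sm act M" and sym: "end_symmetric sm act M"
    and X: "ind_summand sm act M X" and Y: "ind_summand sm act M Y"
    and ni: "\<not> mod_iso sm act X sm act Y"
  shows "pair_cond X Y"
proof -
  obtain x h a X' where x: "chain x h a" "a > 0" "X = W x a 0" "dsum2 sm act X X' M"
    using ind_summand_chain[OF fg X] by blast
  obtain y h' b Y' where y: "chain y h' b" "b > 0" "Y = W y b 0" "dsum2 sm act Y Y' M"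
    using ind_summand_chain[OF fg Y] by blast
  obtain \<theta> where cx: "coord h a x \<theta>" using coord_exists[OF x(1,2)] x(3,4) by blast
  obtain \<theta>' where cy: "coord h' b y \<theta>'" using coord_exists[OF y(1,2)] y(3,4) by blast
  obtain \<tau> where \<tau>: "symmetrizing \<tau>"
    using symmetric_form[OF sym] by blast
  have S: "\<exists>t. valid h' b h a t \<and> s + t < a \<and> s + t < b" if "valid h a h' b s" for s
    by (rule form_shift[OF \<tau> cx cy that])
  have T: "\<exists>s. valid h a h' b s \<and> s + t < a \<and> s + t < b" if t: "valid h' b h a t" for t
  proof -
    obtain s where "valid h a h' b s" "t + s < b" "t + s < a"
      using form_shift[OF \<tau> cy cx t] by blast
    then show ?thesis by (intro exI[of _ s]) simp
  qed
  \<comment> \<open>This removes the alternative of chains of the same type from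
    \<open>valid_shifts_dual\<close>.\<close>
  have "\<not> (h = h' \<and> a = b)" using ni mod_iso_chain[OF x(1) y(1) x(2)] x(3) y(3) by simp
  then show ?thesis
    using valid_shifts_dual[OF chain_grade[OF x(1,2)] chain_grade[OF y(1,2)] S T]
    unfolding x(3) y(3) pair_cond_chain[OF x(1,2) y(1,2)] by blast
qed

lemma symmetric_if_pair_cond:
  assumes fg: "fin_gen sm act M"
    and pc: "\<And>X Y. ind_summand sm act M X \<Longrightarrow> ind_summand sm act M Y \<Longrightarrow>
      \<not> mod_iso sm act X sm act Y \<Longrightarrow> pair_cond X Y"
  shows "end_symmetric sm act M"
proof -
  obtain I x a \<theta> where d: "chain_decomp I x a M"
    and cb: "chain_basis sa n e \<pi> \<sigma> N sm act M I x snd a \<theta>"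
    using chain_basis_exists[OF fg] by blast
  interpret chain_basis sa n e \<pi> \<sigma> N sm act M I x snd a \<theta> by (rule cb)
  have pos: "a p > 0" if "p \<in> I" for p using coord_pos[OF co[OF that]] .
  show ?thesis
  proof (rule end_symmetric_if_reversible)
    fix p q t assume pqt: "(p, q, t) \<in> V"
    then have p: "p \<in> I" and q: "q \<in> I" and v: "valid (snd p) (a p) (snd q) (a q) t"
      by (simp_all add: V_def)
    have "(\<forall>s. \<not> valid (snd p) (a p) (snd q) (a q) s) \<or> snd p = snd q \<and> a p = a q \<or>
      (\<exists>m. tops (snd p) (a p) (snd p) = m + 1 \<and> tops (snd q) (a q) (snd p) = m \<and>
        tops (snd q) (a q) (snd q) = m + 1 \<and> tops (snd p) (a p) (snd q) = m)"
    \<comment> \<open>Chains of the same type, including a chain paired with itself, are isomorphic,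
      so the hypothesis says nothing about them; \<open>valid_reverse\<close> has a separate case
      for them.\<close>
    proof (cases "snd p = snd q \<and> a p = a q")
      case False
      then have "\<not> mod_iso sm act (W (x p) (a p) 0) sm act (W (x q) (a q) 0)"
        using mod_iso_chain[OF basis_chain[OF p] basis_chain[OF q] pos[OF p]] by blast
      then have "pair_cond (W (x p) (a p) 0) (W (x q) (a q) 0)"
        by (intro pc chain_decomp_ind_summand[OF d] p q)
      then show ?thesis
        unfolding pair_cond_chain[OF basis_chain[OF p] pos[OF p] basis_chain[OF q] pos[OF q]] by blast
    qed blast
    from valid_reverse[OF chain_grade[OF basis_chain[OF p] pos[OF p]] chain_grade[OF basis_chain[OF q] pos[OF q]] this v]
    show "t \<le> smax (snd p) (a p) \<and> smax (snd q) (a q) = smax (snd p) (a p) \<and>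
        (q, p, smax (snd p) (a p) - t) \<in> V"
      using p q by (simp add: V_def)
  qed
qed

text \<open>With equal tops the shift by 0 from the longer chain to the shorter one is valid,
  against (a), and in (b) one number would be both \<open>m + 1\<close> and
  \<open>m\<close>.\<close>

lemma pair_cond_tops_not_iso:
  assumes fg: "fin_gen sm act M" and X: "ind_summand sm act M X" and Y: "ind_summand sm act M Y"
    and pc: "pair_cond X Y"
  shows "\<not> sq_iso sm act (top_mod sa sm act X) (top_mod sa sm act Y)"
proof
  obtain x h a where x: "chain x h a" "a > 0" "X = W x a 0"
    using ind_summand_chain[OF fg X] by blast
  obtain y h' b where y: "chain y h' b" "b > 0" "Y = W y b 0"
    using ind_summand_chain[OF fg Y] by blast
  assume "sq_iso sm act (top_mod sa sm act X) (top_mod sa sm act Y)"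
  then have h: "h = h'" using top_iso_chain[OF x(1,2) y(1,2)] x(3) y(3) by simp
  have "valid h a h' b 0 \<or> valid h' b h a 0" using x(2) y(2) by (auto simp: valid_def h)
  then show False
    using pc h unfolding x(3) y(3) pair_cond_chain[OF x(1,2) y(1,2)] by auto
qed

end

theorem theorem4p5:
  fixes sa :: "'k::field \<Rightarrow> 'a::ring_1 \<Rightarrow> 'a"
    and sm :: "'k \<Rightarrow> 'm::ab_group_add \<Rightarrow> 'm"
    and act :: "'a \<Rightarrow> 'm \<Rightarrow> 'm"
    and M :: "'m set"
  assumes "alg_closed TYPE('k)"
    and "kalg sa" and "findim sa"
    and "basic_alg sa" and "connected_alg TYPE('a)" and "nakayama sa"
    and "is_module sa sm act M" and "fin_gen sm act M" and "M \<noteq> {0}"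
  shows "(end_symmetric sm act M \<longleftrightarrow>
           (\<forall>X Y. ind_summand sm act M X \<and> ind_summand sm act M Y \<and>
                  \<not> mod_iso sm act X sm act Y \<longrightarrow>
              (let l = min (loewy_length sm act X) (loewy_length sm act Y) in
                 mult sm act (top_mod sa sm act Y) (soc_ser sm act X l) = 0 \<and>
                 mult sm act (top_mod sa sm act X) (soc_ser sm act Y l) = 0)
            \<or> (\<exists>m\<ge>1. mult sm act (top_mod sa sm act X) X = m + 1 \<and>
                      mult sm act (top_mod sa sm act X) Y = m \<and>
                      mult sm act (top_mod sa sm act Y) Y = m + 1 \<and>
                      mult sm act (top_mod sa sm act Y) X = m)))
       \<and> (end_symmetric sm act M \<longrightarrow>
           (\<forall>X Y. ind_summand sm act M X \<and> ind_summand sm act M Y \<and>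
                  \<not> mod_iso sm act X sm act Y \<longrightarrow>
              \<not> sq_iso sm act (top_mod sa sm act X) (top_mod sa sm act Y)))"
proof -
  interpret fd_kalgebra sa by unfold_locales (rule assms)+
  obtain n e \<pi> \<sigma> N where "serial_algebra sa n e \<pi> \<sigma> N"
    using nakayama_serial[OF assms(4,6)] by blast
  then interpret serial_module sa n e \<pi> \<sigma> N sm act M
    using assms(7) by (intro serial_module.intro serial_module_axioms.intro)
  show ?thesis
    unfolding pair_cond_def[symmetric]
    using pair_cond_if_symmetric[OF assms(8)] symmetric_if_pair_cond[OF assms(8)]
      pair_cond_tops_not_iso[OF assms(8)] by blast
qed

end
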